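(* Let $N=\begin{pmatrix} m & n \\ p & q \end{pmatrix}$ be any matrix of integers $m,n,p,q\ge 1$ with $\det N>0$. There is an open dense set of full measure $\hat{\mathcal B}_N\subset\mathcal B_N$ such that if $f\in\hat{\mathcal B}_N$ then $$d_{\rm top}(f)=mq+np>\lambda_1(f).$$
   Context: $\mathbb D$ is the open unit disc in $\mathbb C$ and $\mathbb P^2$ is the complex projective plane. $\mathcal B_N$ is the set of all Blaschke products $$f(z,w)=\left(\theta_1\prod_{i=1}^m\frac{z-a_i}{1-\bar a_i z}\prod_{i=1}^n\frac{w-b_i}{1-\bar b_i w},\ \theta_2\prod_{i=1}^p\frac{z-c_i}{1-\bar c_i z}\prod_{i=1}^q\frac{w-d_i}{1-\bar d_i w}\right)$$ with $|\theta_1|=|\theta_2|=1$ and all zeros $a_i,b_i,c_i,d_i\in\mathbb D$. Such an $f$ is regarded as a rational map $\mathbb P^2\dashrightarrow\mathbb P^2$ through the affine chart $(z,w)\mapsto[z:w:1]$. The set $\mathcal B_N$ is identified with the parameter space $\mathbb D^{m+n+p+q}\times\mathbb T^2$ (zeros and rotations $(\theta_1,\theta_2)$, where $\mathbb T^2=\{|\theta_1|=|\theta_2|=1\}$), and "open", "dense" and "full measure" (complement of measure zero for the natural Lebesgue/Haar product measure) refer to this identification. For a rational map $g:\mathbb P^2\dashrightarrow\mathbb P^2$, $d_{\rm alg}(g)$ is the common degree of three homogeneous polynomials without common factor representing $g$; $\lambda_1(g)=\lim_{k\to\infty}(d_{\rm alg}(g^k))^{1/k}$ is the first dynamical degree;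 and the topological degree $d_{\rm top}(g)$ is the number of preimages under $g$ of a generic point of $\mathbb P^2$. *)

theory Defs
  imports "HOL-Analysis.Analysis" "HOL-Computational_Algebra.Computational_Algebra"
begin

section \<open>The complex projective plane\<close>

definition proj_rel :: "complex ^ 3 \<Rightarrow> complex ^ 3 \<Rightarrow> bool" where
  "proj_rel x y \<longleftrightarrow> x \<noteq> 0 \<and> y \<noteq> 0 \<and> (\<exists>c. c \<noteq> 0 \<and> y = c *s x)"

quotient_type proj_plane = "complex ^ 3" / partial: proj_rel
proof (rule part_equivpI)
  have "proj_rel (axis 1 1) (axis 1 1)"
    by (auto simp: proj_rel_def axis_eq_0_iff intro!: exI[of _ 1])
  then show "\<exists>x. proj_rel x x" ..
  show "symp proj_rel"
  proof (rule sympI)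
    fix x y assume xy: "proj_rel x y"
    then obtain c where c: "c \<noteq> 0" "y = c *s x" by (auto simp: proj_rel_def)
    then have "x = inverse c *s y" by (simp add: vec_eq_iff)
    with c xy show "proj_rel y x"
      unfolding proj_rel_def using nonzero_imp_inverse_nonzero by blast
  qed
  show "transp proj_rel"
  proof (rule transpI)
    fix x y z assume "proj_rel x y" "proj_rel y z"
    then obtain c e where "c \<noteq> 0" "y = c *s x" "e \<noteq> 0" "z = e *s y" "x \<noteq> 0" "z \<noteq> 0"
      by (auto simp: proj_rel_def)
    then show "proj_rel x z"
      unfolding proj_rel_def by (auto intro!: exI[of _ "e * c"])
  qed
qed

text \<open>\<open>hpoint x\<close> is the point with homogeneous coordinates \<open>x\<close>; meaningful for \<open>x \<noteq> 0\<close> only.\<close>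

abbreviation hpoint :: "complex ^ 3 \<Rightarrow> proj_plane" where
  "hpoint \<equiv> abs_proj_plane"


section \<open>Homogeneous polynomials in three variables\<close>

text \<open>
  Polynomials in the homogeneous coordinates \<open>[z : w : t]\<close> are nested univariate polynomials:
  \<open>z\<close> is the outermost variable, \<open>t\<close> the innermost one.
\<close>

type_synonym 'a poly3 = "'a poly poly poly"

definition const3 :: "'a::comm_ring_1 \<Rightarrow> 'a poly3" where "const3 c = [:[:[:c:]:]:]"
definition varZ :: "'a::comm_ring_1 poly3" where "varZ = [:0, 1:]"
definition varW :: "'a::comm_ring_1 poly3" where "varW = [:[:0, 1:]:]"
definition varT :: "'a::comm_ring_1 poly3" where "varT = [:[:[:0, 1:]:]:]"

definition eval3 :: "'a::comm_ring_1 poly3 \<Rightarrow> 'a ^ 3 \<Rightarrow> 'a" where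
  "eval3 P x = poly (poly (poly P [:[:x $ 1:]:]) [:x $ 2:]) (x $ 3)"

definition homogeneous :: "nat \<Rightarrow> complex poly3 \<Rightarrow> bool" where
  "homogeneous d P \<longleftrightarrow> (\<forall>i j k. coeff (coeff (coeff P i) j) k \<noteq> 0 \<longrightarrow> i + j + k = d)"

definition homogeneous_triple :: "nat \<Rightarrow> complex poly3 ^ 3 \<Rightarrow> bool" where
  "homogeneous_triple d F \<longleftrightarrow> (\<forall>i. homogeneous d (F $ i))"

definition no_common_factor :: "complex poly3 ^ 3 \<Rightarrow> bool" where
  "no_common_factor F \<longleftrightarrow> (\<forall>D. (\<forall>i. D dvd F $ i) \<longrightarrow> is_unit D)"

definition eval_triple :: "complex poly3 ^ 3 \<Rightarrow> complex ^ 3 \<Rightarrow> complex ^ 3" where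
  "eval_triple F x = (\<chi> i. eval3 (F $ i) x)"

text \<open>
  Substitution \<open>G(F\<^sub>1, F\<^sub>2, F\<^sub>3)\<close>: the coefficients of \<open>G\<close> are first viewed as constant
  polynomials, and the result is evaluated at the point \<open>F\<close> over the polynomial ring.
\<close>

definition subst3 :: "complex poly3 \<Rightarrow> complex poly3 ^ 3 \<Rightarrow> complex poly3" where
  "subst3 G F = eval3 (map_poly (map_poly (map_poly const3)) G) F"

definition subst_triple :: "complex poly3 ^ 3 \<Rightarrow> complex poly3 ^ 3 \<Rightarrow> complex poly3 ^ 3" where
  "subst_triple G F = (\<chi> i. subst3 (G $ i) F)"


section \<open>Rational self-maps of the projective plane\<close>

definition rat_rep :: "complex poly3 ^ 3 \<Rightarrow> bool" where
  "rat_rep F \<longleftrightarrow> F \<noteq> 0 \<and> (\<exists>d. homogeneous_triple d F)"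

text \<open>Two triples define the same rational map iff they are proportional over the field of
  fractions.\<close>

definition rat_rel :: "complex poly3 ^ 3 \<Rightarrow> complex poly3 ^ 3 \<Rightarrow> bool" where
  "rat_rel F G \<longleftrightarrow> rat_rep F \<and> rat_rep G \<and> (\<forall>i j. F $ i * G $ j = F $ j * G $ i)"

quotient_type rat_map = "complex poly3 ^ 3" / partial: rat_rel
proof (rule part_equivpI)
  have hom: "homogeneous 0 (1 :: complex poly3)"
    by (auto simp: homogeneous_def coeff_1 split: if_splits)
  have "rat_rep (\<chi> i. 1)"
    unfolding rat_rep_def homogeneous_triple_def using hom by (auto simp: vec_eq_iff)
  then have "rat_rel (\<chi> i. 1) (\<chi> i. 1)" by (simp add: rat_rel_def)
  then show "\<exists>x. rat_rel x x" ..
  show "symp rat_rel" by (rule sympI) (auto simp: rat_rel_def mult.commute)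
  show "transp rat_rel"
  proof (rule transpI)
    fix F G H assume FG: "rat_rel F G" and GH: "rat_rel G H"
    from FG have "G \<noteq> 0" by (simp add: rat_rel_def rat_rep_def)
    then obtain k where k: "G $ k \<noteq> 0" by (auto simp: vec_eq_iff)
    have "F $ i * H $ j = F $ j * H $ i" for i j
    proof -
      have 1: "F $ i * G $ k = F $ k * G $ i" "F $ j * G $ k = F $ k * G $ j"
        using FG unfolding rat_rel_def by blast+
      have 2: "G $ i * H $ j = G $ j * H $ i"
        using GH unfolding rat_rel_def by blast
      have "G $ k * (F $ i * H $ j) = (F $ i * G $ k) * H $ j" by (simp add: mult_ac)
      also have "\<dots> = F $ k * (G $ i * H $ j)" by (simp add: 1 mult_ac)
      also have "\<dots> = (F $ k * G $ j) * H $ i" by (simp add: 2 mult_ac)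
      also have "\<dots> = G $ k * (F $ j * H $ i)" by (simp add: 1 [symmetric] mult_ac)
      finally show ?thesis using k by simp
    qed
    with FG GH show "rat_rel F H" by (simp add: rat_rel_def)
  qed
qed

definition represents :: "complex poly3 ^ 3 \<Rightarrow> rat_map \<Rightarrow> bool" where
  "represents F g \<longleftrightarrow> rat_rep F \<and> abs_rat_map F = g"

text \<open>\<open>g\<close> is defined at the point \<open>x\<close> (i.e. \<open>x\<close> is not indeterminate) and takes the value \<open>y\<close>.\<close>

definition maps_to :: "rat_map \<Rightarrow> proj_plane \<Rightarrow> proj_plane \<Rightarrow> bool" where
  "maps_to g x y \<longleftrightarrow>
     (\<exists>F v. represents F g \<and> v \<noteq> 0 \<and> eval_triple F v \<noteq> 0 \<and>
            x = hpoint v \<and> y = hpoint (eval_triple F v))"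

text \<open>
  The composite \<open>g \<circ> f\<close>. It is independent of the representatives; it exists
  unless the image of \<open>f\<close> lies in the indeterminacy locus of \<open>g\<close>, which never happens for
  dominant \<open>f\<close>.
\<close>

definition rat_comp :: "rat_map \<Rightarrow> rat_map \<Rightarrow> rat_map" where
  "rat_comp g f =
     (THE h. \<exists>G F. represents G g \<and> represents F f \<and> represents (subst_triple G F) h)"

definition rat_id :: rat_map where
  "rat_id = abs_rat_map (vector [varZ, varW, varT])"

definition rat_iterate :: "nat \<Rightarrow> rat_map \<Rightarrow> rat_map" where
  "rat_iterate k g = (rat_comp g ^^ k) rat_id"

definition d_alg :: "rat_map \<Rightarrow> nat" where
  "d_alg g = (THE d. \<exists>F. represents F g \<and> homogeneous_triple d F \<and> no_common_factor F)"

definition lambda1 :: "rat_map \<Rightarrow> real" where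
  "lambda1 g = lim (\<lambda>k. root k (real (d_alg (rat_iterate k g))))"

text \<open>A property of points is generic if it holds off a proper algebraic subset, equivalently
  off the zero locus of some nonzero homogeneous polynomial.\<close>

definition generically :: "(proj_plane \<Rightarrow> bool) \<Rightarrow> bool" where
  "generically P \<longleftrightarrow>
     (\<exists>H d. H \<noteq> 0 \<and> homogeneous d H \<and> (\<forall>v. v \<noteq> 0 \<and> eval3 H v \<noteq> 0 \<longrightarrow> P (hpoint v)))"

definition d_top :: "rat_map \<Rightarrow> nat" where
  "d_top g = (THE n. generically (\<lambda>y. finite {x. maps_to g x y} \<and> card {x. maps_to g x y} = n))"


section \<open>Blaschke products and their parameter space\<close>

text \<open>Zeros \<open>a, b, c, d\<close> (used at indices below \<open>m, n, p, q\<close> respectively) and rotations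
  \<open>\<theta>\<^sub>1, \<theta>\<^sub>2\<close>.\<close>

type_synonym blaschke_params =
  "(nat \<Rightarrow> complex) \<times> (nat \<Rightarrow> complex) \<times> (nat \<Rightarrow> complex) \<times> (nat \<Rightarrow> complex) \<times> complex \<times> complex"

definition blaschke1 ::
  "complex \<Rightarrow> nat \<Rightarrow> (nat \<Rightarrow> complex) \<Rightarrow> nat \<Rightarrow> (nat \<Rightarrow> complex) \<Rightarrow> complex \<Rightarrow> complex \<Rightarrow> complex" where
  "blaschke1 \<theta> m a n b z w =
     \<theta> * (\<Prod>i<m. (z - a i) / (1 - cnj (a i) * z)) * (\<Prod>i<n. (w - b i) / (1 - cnj (b i) * w))"

fun blaschke_fun ::
  "nat \<Rightarrow> nat \<Rightarrow> nat \<Rightarrow> nat \<Rightarrow> blaschke_params \<Rightarrow> complex \<times> complex \<Rightarrow> complex \<times> complex" where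
  "blaschke_fun m n p q (a, b, c, d, \<theta>\<^sub>1, \<theta>\<^sub>2) (z, w) =
     (blaschke1 \<theta>\<^sub>1 m a n b z w, blaschke1 \<theta>\<^sub>2 p c q d z w)"

text \<open>Homogenised numerator and denominator, both of degree \<open>m + n\<close>.\<close>

definition blaschke_num ::
  "complex \<Rightarrow> nat \<Rightarrow> (nat \<Rightarrow> complex) \<Rightarrow> nat \<Rightarrow> (nat \<Rightarrow> complex) \<Rightarrow> complex poly3" where
  "blaschke_num \<theta> m a n b =
     const3 \<theta> * (\<Prod>i<m. varZ - const3 (a i) * varT) * (\<Prod>i<n. varW - const3 (b i) * varT)"

definition blaschke_den ::
  "nat \<Rightarrow> (nat \<Rightarrow> complex) \<Rightarrow> nat \<Rightarrow> (nat \<Rightarrow> complex) \<Rightarrow> complex poly3" where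
  "blaschke_den m a n b =
     (\<Prod>i<m. varT - const3 (cnj (a i)) * varZ) * (\<Prod>i<n. varT - const3 (cnj (b i)) * varW)"

fun blaschke_triple :: "nat \<Rightarrow> nat \<Rightarrow> nat \<Rightarrow> nat \<Rightarrow> blaschke_params \<Rightarrow> complex poly3 ^ 3" where
  "blaschke_triple m n p q (a, b, c, d, \<theta>\<^sub>1, \<theta>\<^sub>2) =
     vector [blaschke_num \<theta>\<^sub>1 m a n b * blaschke_den p c q d,
             blaschke_num \<theta>\<^sub>2 p c q d * blaschke_den m a n b,
             blaschke_den m a n b * blaschke_den p c q d]"

text \<open>\<open>blaschke_fun\<close> as a rational self-map of the plane through the chart
  \<open>(z, w) \<mapsto> [z : w : 1]\<close>; see \<open>blaschke_map_affine\<close> below.\<close>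

definition blaschke_map :: "nat \<Rightarrow> nat \<Rightarrow> nat \<Rightarrow> nat \<Rightarrow> blaschke_params \<Rightarrow> rat_map" where
  "blaschke_map m n p q s = abs_rat_map (blaschke_triple m n p q s)"

text \<open>The space \<open>\<D>\<^bsup>m+n+p+q\<^esup> \<times> \<T>\<^sup>2\<close>. Its topology is the subspace topology from the product
  topology on the ambient type: outside the index range the zeros are \<open>undefined\<close>, so this is
  the usual topology.\<close>

definition blaschke_space :: "nat \<Rightarrow> nat \<Rightarrow> nat \<Rightarrow> nat \<Rightarrow> blaschke_params set" where
  "blaschke_space m n p q =
     ({..<m} \<rightarrow>\<^sub>E ball 0 1) \<times> ({..<n} \<rightarrow>\<^sub>E ball 0 1) \<times> ({..<p} \<rightarrow>\<^sub>E ball 0 1) \<times> ({..<q} \<rightarrow>\<^sub>E ball 0 1)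
       \<times> sphere 0 1 \<times> sphere 0 1"

definition disc_measure :: "complex measure" where
  "disc_measure = restrict_space lborel (ball 0 1)"

text \<open>Haar measure on the unit circle, normalised as arc length.\<close>

definition circle_measure :: "complex measure" where
  "circle_measure =
     distr (restrict_space lborel {0..<2 * pi}) (restrict_space borel (sphere 0 1)) cis"

definition blaschke_measure :: "nat \<Rightarrow> nat \<Rightarrow> nat \<Rightarrow> nat \<Rightarrow> blaschke_params measure" where
  "blaschke_measure m n p q =
     (\<Pi>\<^sub>M i\<in>{..<m}. disc_measure) \<Otimes>\<^sub>M (\<Pi>\<^sub>M i\<in>{..<n}. disc_measure) \<Otimes>\<^sub>M
     (\<Pi>\<^sub>M i\<in>{..<p}. disc_measure) \<Otimes>\<^sub>M (\<Pi>\<^sub>M i\<in>{..<q}. disc_measure) \<Otimes>\<^sub>M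
     circle_measure \<Otimes>\<^sub>M circle_measure"

lemma space_blaschke_measure: "space (blaschke_measure m n p q) = blaschke_space m n p q"
  by (simp add: blaschke_measure_def blaschke_space_def space_pair_measure space_PiM
      disc_measure_def circle_measure_def space_restrict_space)


section \<open>The rational map extends the Blaschke product\<close>

lemma eval3_simps [simp]:
  "eval3 (P * Q) x = eval3 P x * eval3 Q x"
  "eval3 (P - Q) x = eval3 P x - eval3 Q x"
  "eval3 (const3 c) x = c"
  "eval3 varZ x = x $ 1" "eval3 varW x = x $ 2" "eval3 varT x = x $ 3"
  by (simp_all add: eval3_def const3_def varZ_def varW_def varT_def)

lemma eval3_prod [simp]: "eval3 (\<Prod>i\<in>I. f i) x = (\<Prod>i\<in>I. eval3 (f i) x)"
  by (simp add: eval3_def poly_prod)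

lemma homogeneous_mult:
  assumes "homogeneous d P" "homogeneous e Q"
  shows "homogeneous (d + e) (P * Q)"
  unfolding homogeneous_def
proof (intro allI impI)
  fix i j k assume "coeff (coeff (coeff (P * Q) i) j) k \<noteq> 0"
  then have "(\<Sum>i'\<le>i. \<Sum>j'\<le>j. \<Sum>k'\<le>k. coeff (coeff (coeff P i') j') k' *
      coeff (coeff (coeff Q (i - i')) (j - j')) (k - k')) \<noteq> 0"
    by (simp add: coeff_mult coeff_sum)
  then obtain i' j' k' where le: "i' \<le> i" "j' \<le> j" "k' \<le> k"
    and nz: "coeff (coeff (coeff P i') j') k' * coeff (coeff (coeff Q (i - i')) (j - j')) (k - k') \<noteq> 0"
    by (metis (no_types, lifting) atMost_iff sum.neutral)
  then have "i' + j' + k' = d" "(i - i') + (j - j') + (k - k') = e"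
    using assms unfolding homogeneous_def by (metis mult_eq_0_iff)+
  with le show "i + j + k = d + e" by linarith
qed

lemma homogeneous_diff: "homogeneous d P \<Longrightarrow> homogeneous d Q \<Longrightarrow> homogeneous d (P - Q)"
  unfolding homogeneous_def by (metis coeff_diff diff_0_right)

lemma homogeneous_const3: "homogeneous 0 (const3 c)"
  by (auto simp: homogeneous_def const3_def coeff_pCons split: nat.splits)

lemma homogeneous_vars: "homogeneous 1 varZ" "homogeneous 1 varW" "homogeneous 1 varT"
  by (auto simp: homogeneous_def varZ_def varW_def varT_def coeff_pCons split: nat.splits)

lemma homogeneous_prod:
  "(\<And>i. i < m \<Longrightarrow> homogeneous 1 (f i)) \<Longrightarrow> homogeneous m (\<Prod>i<m. f i)"
proof (induction m)
  case 0
  show ?case using homogeneous_const3[of 1] by (simp add: const3_def flip: one_pCons)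
next
  case (Suc m)
  then show ?case using homogeneous_mult[of m "\<Prod>i<m. f i" 1 "f m"] by simp
qed

lemma homogeneous_linear:
  "homogeneous 1 P \<Longrightarrow> homogeneous 1 Q \<Longrightarrow> homogeneous 1 (P - const3 c * Q)"
  using homogeneous_mult[OF homogeneous_const3] homogeneous_diff by fastforce

lemma homogeneous_blaschke_num: "homogeneous (m + n) (blaschke_num \<theta> m a n b)"
  unfolding blaschke_num_def
  using homogeneous_mult[OF homogeneous_mult[OF homogeneous_const3 homogeneous_prod] homogeneous_prod]
    homogeneous_linear homogeneous_vars by fastforce

lemma homogeneous_blaschke_den: "homogeneous (m + n) (blaschke_den m a n b)"
  unfolding blaschke_den_def
  by (intro homogeneous_mult homogeneous_prod homogeneous_linear homogeneous_vars)

lemma rat_rep_blaschke_triple: "rat_rep (blaschke_triple m n p q s)"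
proof -
  obtain a b c d \<theta>1 \<theta>2 where s: "s = (a, b, c, d, \<theta>1, \<theta>2)" by (cases s) auto
  have "eval3 (blaschke_triple m n p q s $ 3) (vector [0, 0, 1]) \<noteq> 0"
    by (simp add: s vector_3 blaschke_den_def)
  then have "blaschke_triple m n p q s \<noteq> 0" by (auto simp: eval3_def)
  moreover have "homogeneous_triple ((m + n) + (p + q)) (blaschke_triple m n p q s)"
    unfolding homogeneous_triple_def forall_3 s
    using homogeneous_mult[OF homogeneous_blaschke_num[of m n \<theta>1 a b] homogeneous_blaschke_den[of p q c d]]
      homogeneous_mult[OF homogeneous_blaschke_num[of p q \<theta>2 c d] homogeneous_blaschke_den[of m n a b]]
      homogeneous_mult[OF homogeneous_blaschke_den[of m n a b] homogeneous_blaschke_den[of p q c d]]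
    by (simp add: vector_3 add_ac)
  ultimately show ?thesis unfolding rat_rep_def by blast
qed

lemma blaschke_num_div_den:
  "eval3 (blaschke_num \<theta> m a n b) (vector [z, w, 1]) / eval3 (blaschke_den m a n b) (vector [z, w, 1])
   = blaschke1 \<theta> m a n b z w"
  by (simp add: blaschke_num_def blaschke_den_def blaschke1_def vector_3 prod_dividef)

lemma blaschke_map_affine:
  assumes "s = (a, b, c, d, \<theta>\<^sub>1, \<theta>\<^sub>2)"
    and "\<forall>i<m. cnj (a i) * z \<noteq> 1" "\<forall>i<n. cnj (b i) * w \<noteq> 1"
    and "\<forall>i<p. cnj (c i) * z \<noteq> 1" "\<forall>i<q. cnj (d i) * w \<noteq> 1"
    and "blaschke_fun m n p q s (z, w) = (z', w')"
  shows "maps_to (blaschke_map m n p q s) (hpoint (vector [z, w, 1])) (hpoint (vector [z', w', 1]))"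
proof -
  let ?v = "vector [z, w, 1] :: complex ^ 3" and ?u = "vector [z', w', 1] :: complex ^ 3"
  let ?F = "blaschke_triple m n p q s"
  define D1 where "D1 = eval3 (blaschke_den m a n b) ?v"
  define D2 where "D2 = eval3 (blaschke_den p c q d) ?v"
  have D: "D1 \<noteq> 0" "D2 \<noteq> 0"
    using assms(2-5) by (auto simp: D1_def D2_def blaschke_den_def vector_3)
  have z': "eval3 (blaschke_num \<theta>\<^sub>1 m a n b) ?v = z' * D1"
    using assms(1,6) D blaschke_num_div_den[of \<theta>\<^sub>1 m a n b z w] by (simp add: D1_def field_simps)
  have w': "eval3 (blaschke_num \<theta>\<^sub>2 p c q d) ?v = w' * D2"
    using assms(1,6) D blaschke_num_div_den[of \<theta>\<^sub>2 p c q d z w] by (simp add: D2_def field_simps)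
  have ev: "eval_triple ?F ?v = (D1 * D2) *s ?u"
    unfolding vec_eq_iff forall_3 eval_triple_def
    by (simp add: assms(1) vector_3 z' w' flip: D1_def D2_def)
  have nz: "?v \<noteq> 0" "?u \<noteq> 0" by (auto simp: vec_eq_iff forall_3 vector_3)
  with ev D have ev0: "eval_triple ?F ?v \<noteq> 0" by simp
  have "proj_rel ?u (eval_triple ?F ?v)"
    unfolding proj_rel_def using nz ev0 ev D by (auto intro!: exI[of _ "D1 * D2"])
  then have "hpoint ?u = hpoint (eval_triple ?F ?v)"
    using Quotient3_rel[OF Quotient3_proj_plane] by (metis)
  then show ?thesis
    unfolding maps_to_def represents_def blaschke_map_def
    using rat_rep_blaschke_triple nz ev0 by blast
qed

end

theory Submission
  imports Defs "HOL-Computational_Algebra.Field_as_Ring"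
begin

text \<open>
  The good parameters are those for which the zeros \<open>a\<^sub>i\<close>, \<open>c\<^sub>j\<close> of the two components in the
  variable \<open>z\<close> are pairwise distinct, and likewise the zeros \<open>b\<^sub>i\<close>, \<open>d\<^sub>j\<close> in the variable \<open>w\<close>.
  Each of these finitely many conditions excludes a closed null set, and moving the zeros
  by small generic amounts achieves all of them (\<open>separated_params_openin\<close>,
  \<open>separated_params_dense\<close>, \<open>separated_params_AE\<close>).

  \<^bold>\<open>The dynamical degree.\<close> The algebraic degree is submultiplicative under composition
  (\<open>d_alg_comp_le\<close>), so the limit defining \<open>lambda1\<close> exists and is bounded by every geometric rate that
  bounds the degrees of the iterates. The two coordinates of the \<open>k\<close>-th iterate are quotients of forms
  whose degrees \<open>e\<^sub>k\<close>, \<open>e'\<^sub>k\<close> are multiplied by the exponent matrix in every step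
  (\<open>iterate_split\<close>). By Cayley-Hamilton, \<open>e\<^sub>k + e'\<^sub>k\<close> grows at most like the powers of
  \<open>T - 1 / T\<close> with \<open>T = m + q\<close>, because the determinant is at least \<open>1\<close>. Finally
  \<open>T \<le> m * q + 1 \<le> m * q + n * p\<close>.

  \<^bold>\<open>The topological degree.\<close> The preimages of \<open>(u, v)\<close> are common points of two curves in
  \<open>P\<^sup>1 \<times> P\<^sup>1\<close>, given by \<open>f\<^sub>1 = u\<close> and \<open>f\<^sub>2 = v\<close>. Call the value \<open>(u, v)\<close> good if all common points
  of the two curves are finite, are not poles, and have nonzero Jacobian.
  Near a good value the number of preimages is constant, since \<open>P\<^sup>1 \<times> P\<^sup>1\<close> is compact and the map is
  locally injective at every preimage (\<open>fibre_card_near_good\<close>). The origin is good; its preimages are the points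
  \<open>(a\<^sub>i, d\<^sub>j)\<close> and \<open>(c\<^sub>i, b\<^sub>j)\<close>, and there are \<open>m * q + n * p\<close> of them. The values that are not good lie on
  finitely many lines, which come from the points of indeterminacy and from the pair of points at infinity, and in the
  images of finitely many curves. Together these lie on one algebraic curve: this is where
  \<open>curve_image_algebraic\<close> enters, which shows by counting dimensions that a rational map sends a plane curve into
  a plane curve. So the complex line from the origin to a generic value consists of good
  values up to a finite set. The complement of that set in the line is connected, and therefore
  the number of preimages of a generic value is the same as at the origin (\<open>generic_fibre_card\<close>).
  It remains to compare preimages in \<open>P\<^sup>1 \<times> P\<^sup>1\<close> with preimages in \<open>P\<^sup>2\<close> (\<open>preimages_generic\<close>).
\<close>

section \<open>Ternary polynomials as functions\<close>

(* The dollar sign is reserved for components of vectors. *)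
no_notation fps_nth (infixl "$" 75)

lemma eval3_sum:
  fixes P :: "'a::comm_ring_1 poly3"
  assumes "degree P \<le> n" "\<And>i. degree (coeff P i) \<le> n" "\<And>i j. degree (coeff (coeff P i) j) \<le> n"
  shows "eval3 P x = (\<Sum>i\<le>n. \<Sum>j\<le>n. \<Sum>k\<le>n. coeff (coeff (coeff P i) j) k * (x $ 1 ^ i * x $ 2 ^ j * x $ 3 ^ k))"
proof -
  have altdef: "poly p x = (\<Sum>i\<le>n. coeff p i * x ^ i)" if "degree p \<le> n" for p :: "'b::comm_ring_1 poly" and x
  proof -
    have "p = (\<Sum>i\<le>n. monom (coeff p i) i)" by (rule poly_as_sum_of_monoms'[OF that, symmetric])
    then have "poly p x = poly (\<Sum>i\<le>n. monom (coeff p i) i) x" by simp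
    then show ?thesis by (simp add: poly_sum poly_monom)
  qed
  have "eval3 P x = (\<Sum>i\<le>n. poly (poly (coeff P i) [:x $ 2:]) (x $ 3) * x $ 1 ^ i)"
    unfolding eval3_def altdef[OF assms(1)] by (simp add: poly_sum poly_const_pow mult_ac)
  also have "\<dots> = (\<Sum>i\<le>n. (\<Sum>j\<le>n. poly (coeff (coeff P i) j) (x $ 3) * x $ 2 ^ j) * x $ 1 ^ i)"
    unfolding altdef[OF assms(2)] by (simp add: poly_sum poly_const_pow mult_ac)
  also have "\<dots> = (\<Sum>i\<le>n. (\<Sum>j\<le>n. (\<Sum>k\<le>n. coeff (coeff (coeff P i) j) k * x $ 3 ^ k) * x $ 2 ^ j) * x $ 1 ^ i)"
    unfolding altdef[OF assms(3)] by simp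
  finally show ?thesis by (simp add: sum_distrib_right sum_distrib_left mult_ac)
qed

lemma poly3_degree_bound:
  fixes P :: "'a::comm_ring_1 poly3"
  obtains n where "degree P \<le> n" "\<And>i. degree (coeff P i) \<le> n" "\<And>i j. degree (coeff (coeff P i) j) \<le> n"
proof -
  define A where "A = insert (degree P) (\<Union>i\<le>degree P. insert (degree (coeff P i))
    ((\<lambda>j. degree (coeff (coeff P i) j)) ` {..degree (coeff P i)}))"
  have fin: "finite A" unfolding A_def by auto
  have le: "a \<le> Max A" if "a \<in> A" for a using Max_ge[OF fin that] .
  have 1: "degree (coeff P i) \<le> Max A" for i
  proof (cases "i \<le> degree P")
    case True then show ?thesis by (intro le) (auto simp: A_def)
  qed (simp add: coeff_eq_0)
  have 2: "degree (coeff (coeff P i) j) \<le> Max A" for i j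
  proof (cases "i \<le> degree P \<and> j \<le> degree (coeff P i)")
    case True then show ?thesis by (intro le) (auto simp: A_def)
  next
    case False then show ?thesis by (cases "i \<le> degree P") (simp_all add: coeff_eq_0)
  qed
  show ?thesis
  proof (rule that[of "Max A"])
    show "degree P \<le> Max A" by (intro le) (simp add: A_def)
  qed (rule 1 2)+
qed

lemma eval3_0 [simp]: "eval3 0 x = 0" and eval3_1 [simp]: "eval3 1 x = 1"
  and eval3_add [simp]: "eval3 (P + Q) x = eval3 P x + eval3 Q x"
  and eval3_power [simp]: "eval3 (P ^ n) x = eval3 P x ^ n"
  by (simp_all add: eval3_def poly_power)

lemma eval3_setsum [simp]: "eval3 (\<Sum>i\<in>I. f i) x = (\<Sum>i\<in>I. eval3 (f i) x)"
  by (induction I rule: infinite_finite_induct) auto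

lemma const3_0 [simp]: "const3 0 = 0" by (simp add: const3_def)

text \<open>
  The field is infinite, so a polynomial is determined by its values. Identities between ternary
  polynomials are verified pointwise throughout, which avoids nested coefficients.
\<close>

lemma eval3_eq_0_imp:
  fixes P :: "complex poly3"
  assumes "\<And>x. eval3 P x = 0"
  shows "P = 0"
proof -
  have inf: "infinite (range (\<lambda>x::complex. [:[:x:]:]))" "infinite (range (\<lambda>x::complex. [:x:]))"
    by (auto dest!: finite_imageD simp: inj_on_def infinite_UNIV_char_0)
  have "poly P [:[:x:]:] = 0" for x
  proof -
    have "poly (poly P [:[:x:]:]) [:y:] = 0" for y
    proof -
      have "poly (poly (poly P [:[:x:]:]) [:y:]) z = 0" for z
        using assms[of "vector [x, y, z]"] by (simp add: eval3_def)
      then show ?thesis using poly_all_0_iff_0 by blast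
    qed
    then have "range (\<lambda>y. [:y:]) \<subseteq> {y. poly (poly P [:[:x:]:]) y = 0}" by auto
    with inf show ?thesis using poly_roots_finite finite_subset by metis
  qed
  then have "range (\<lambda>x. [:[:x:]:]) \<subseteq> {x. poly P x = 0}" by auto
  with inf show ?thesis using poly_roots_finite finite_subset by metis
qed

lemma poly3_eqI:
  fixes P Q :: "complex poly3"
  assumes "\<And>x. eval3 P x = eval3 Q x"
  shows "P = Q"
  using eval3_eq_0_imp[of "P - Q"] assms by simp

lemma eval3_subst3: "eval3 (subst3 G F) v = eval3 G (eval_triple F v)"
proof -
  obtain n where n: "degree G \<le> n" "\<And>i. degree (coeff G i) \<le> n" "\<And>i j. degree (coeff (coeff G i) j) \<le> n"
    using poly3_degree_bound[of G] by metis
  let ?G = "map_poly (map_poly (map_poly const3)) G"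
  have c: "coeff (coeff (coeff ?G i) j) k = const3 (coeff (coeff (coeff G i) j) k)" for i j k
    by (simp add: coeff_map_poly)
  have "subst3 G F = (\<Sum>i\<le>n. \<Sum>j\<le>n. \<Sum>k\<le>n. const3 (coeff (coeff (coeff G i) j) k) * (F $ 1 ^ i * F $ 2 ^ j * F $ 3 ^ k))"
    unfolding subst3_def using n
    by (subst eval3_sum[where n = n])
      (auto simp: c coeff_map_poly map_poly_degree_leq intro!: order_trans[OF map_poly_degree_leq])
  then show ?thesis
    by (simp add: eval3_sum[OF n] eval_triple_def)
qed

lemma eval_subst_triple: "eval_triple (subst_triple G F) v = eval_triple G (eval_triple F v)"
  by (simp add: vec_eq_iff eval_triple_def[of "subst_triple G F"] eval_triple_def[of "\<chi> i. subst3 (G $ i) F"] eval_triple_def[of G] subst_triple_def eval3_subst3)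

lemma eval3_homogeneous:
  assumes "homogeneous d P"
  shows "eval3 P (c *s v) = c ^ d * eval3 P v"
proof -
  obtain n where n: "degree P \<le> n" "\<And>i. degree (coeff P i) \<le> n" "\<And>i j. degree (coeff (coeff P i) j) \<le> n"
    using poly3_degree_bound[of P] by metis
  have *: "coeff (coeff (coeff P i) j) k * ((c * v $ 1) ^ i * (c * v $ 2) ^ j * (c * v $ 3) ^ k) =
     c ^ d * (coeff (coeff (coeff P i) j) k * (v $ 1 ^ i * v $ 2 ^ j * v $ 3 ^ k))" for i j k
  proof (cases "coeff (coeff (coeff P i) j) k = 0")
    case False
    then have "i + j + k = d" using assms by (auto simp: homogeneous_def)
    then show ?thesis by (auto simp: power_mult_distrib power_add)
  qed simp
  show ?thesis
    by (simp add: eval3_sum[OF n] * sum_distrib_left)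
qed

text \<open>
  The substitution \<open>x \<mapsto> 2 x\<close>. Since \<open>2 ^ i = 2 ^ d\<close> only for \<open>i = d\<close>, scaling by this single
  number already detects the total degree of every monomial.
\<close>

definition double3 :: "complex poly3 \<Rightarrow> complex poly3" where
  "double3 P = map_poly (\<lambda>A. map_poly (\<lambda>B. pcompose B [:0, 2:]) (pcompose A [:0, [:2:]:])) (pcompose P [:0, [:[:2:]:]:])"

lemma coeff_double3:
  "coeff (coeff (coeff (double3 P) i) j) k = 2 ^ (i + j + k) * coeff (coeff (coeff P i) j) k"
proof -
  have two: "[:2:] ^ n = ([:2 ^ n:] :: 'b::comm_ring_1 poly)" for n by (simp add: poly_const_pow)
  have three: "[:[:2:]:] ^ n = ([:[:2 ^ n:]:] :: complex poly poly)" for n by (simp add: poly_const_pow)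
  show ?thesis
    by (simp add: double3_def coeff_map_poly coeff_pcompose_linear two three power_add mult_ac)
qed

lemma eval3_double3: "eval3 (double3 P) v = eval3 P (2 *s v)"
proof -
  obtain n where n: "degree P \<le> n" "\<And>i. degree (coeff P i) \<le> n" "\<And>i j. degree (coeff (coeff P i) j) \<le> n"
    using poly3_degree_bound[of P] by metis
  have z: "coeff (coeff (coeff P i) j) k = 0" if "i > n \<or> j > n \<or> k > n" for i j k
    using that n by (metis coeff_0 coeff_eq_0 le_less_trans)
  have n': "degree (double3 P) \<le> n" "degree (coeff (double3 P) i) \<le> n" "degree (coeff (coeff (double3 P) i) j) \<le> n" for i j
    by (intro degree_le allI impI poly_eqI; simp add: coeff_double3 z)+
  show ?thesis
    by (simp add: eval3_sum[OF n] eval3_sum[OF n'] coeff_double3 power_mult_distrib power_add mult_ac)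
qed

lemma homogeneous_iff_eval_double:
  "homogeneous d P \<longleftrightarrow> (\<forall>v. eval3 P (2 *s v) = 2 ^ d * eval3 P v)"
proof
  assume "\<forall>v. eval3 P (2 *s v) = 2 ^ d * eval3 P v"
  then have "double3 P = const3 (2 ^ d) * P"
    by (intro poly3_eqI) (simp add: eval3_double3)
  then have "2 ^ (i + j + k) * coeff (coeff (coeff P i) j) k = 2 ^ d * coeff (coeff (coeff P i) j) k" for i j k
    by (subst coeff_double3[symmetric]) (simp add: const3_def)
  then have "coeff (coeff (coeff P i) j) k = 0 \<or> (2::complex) ^ (i + j + k) = 2 ^ d" for i j k
    by (metis mult_right_cancel)
  moreover have "i = j" if "(2::complex) ^ i = 2 ^ j" for i j
  proof -
    have "norm ((2::complex) ^ i) = norm ((2::complex) ^ j)" using that by simp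
    then have "(2::real) ^ i = 2 ^ j" by (simp add: norm_power)
    then show ?thesis by simp
  qed
  ultimately show "homogeneous d P" unfolding homogeneous_def by blast
qed (simp add: eval3_homogeneous)


lemma eval3_curve:
  fixes P :: "complex poly3" and f g h :: "complex poly"
  shows "\<exists>p. \<forall>t. poly p t = eval3 P (vector [poly f t, poly g t, poly h t])"
proof -
  obtain n where n: "degree P \<le> n" "\<And>i. degree (coeff P i) \<le> n" "\<And>i j. degree (coeff (coeff P i) j) \<le> n"
    using poly3_degree_bound[of P] by metis
  show ?thesis
    by (rule exI[of _ "\<Sum>i\<le>n. \<Sum>j\<le>n. \<Sum>k\<le>n. smult (coeff (coeff (coeff P i) j) k) (f ^ i * g ^ j * h ^ k)"])
      (simp add: eval3_sum[OF n] poly_sum)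
qed

lemma eval3_on_line: "\<exists>p. \<forall>s. poly p s = eval3 (P :: complex poly3) (s *s v)"
proof -
  have "s *s v = vector [poly [:0, v $ 1:] s, poly [:0, v $ 2:] s, poly [:0, v $ 3:] s]" for s
    by (simp add: vec_eq_iff forall_3)
  then show ?thesis
    using eval3_curve[of P "[:0, v $ 1:]" "[:0, v $ 2:]" "[:0, v $ 3:]"] by simp
qed

text \<open>
  The variable is the only prime factor of a monomial.
\<close>

lemma monom_factor:
  fixes p r :: "complex poly"
  assumes "p * r = monom c d" "c \<noteq> 0"
  obtains e where "e \<le> d" "p = monom (poly p 1) e"
proof -
  have "p dvd monom c d" using assms(1) by (metis dvd_triv_left)
  then have "p dvd [:0, 1:] ^ d"
    using assms(2) by (metis dvd_smult_iff monom_altdef)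
  moreover have "prime ([:0, 1:] :: complex poly)"
    using prime_elem_linear_field_poly[of 1 0] by (simp add: prime_def normalize_poly_def flip: one_pCons)
  ultimately obtain e where e: "e \<le> d" "normalize p = normalize ([:0, 1:] ^ e)"
    using divides_primepow_weak by metis
  then obtain u where u: "p = u * [:0, 1:] ^ e" "is_unit u"
    by (metis associatedE1 mult.commute)
  then obtain c' where "u = [:c':]" by (metis is_unit_polyE)
  with u have p: "p = monom c' e" by (simp add: monom_altdef)
  then show ?thesis by (intro that[of e]) (use e p in \<open>auto simp: poly_monom\<close>)
qed

text \<open>
  On a line through the origin where \<open>D * E\<close> is not identically zero, this product restricts to a monomial of degree
  \<open>d\<close>, so \<open>D\<close> restricts to a monomial of some degree \<open>e \<le> d\<close>. The degree \<open>e\<close> could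
  depend on the line, but in any case the product of the polynomials \<open>D (2 x) - 2 ^ e D x\<close> over all \<open>e \<le> d\<close>, times
  \<open>D * E\<close>, vanishes identically. There are no zero divisors, hence one \<open>e\<close> works everywhere.
\<close>

lemma homogeneous_factor:
  assumes "homogeneous d (D * E)" "D * E \<noteq> 0"
  obtains e where "e \<le> d" "homogeneous e D"
proof -
  have "(\<Prod>e\<le>d. (double3 D - const3 (2 ^ e) * D)) * (D * E) = 0"
  proof (rule poly3_eqI)
    fix v
    show "eval3 ((\<Prod>e\<le>d. (double3 D - const3 (2 ^ e) * D)) * (D * E)) v = eval3 0 v"
    proof (cases "eval3 (D * E) v = 0")
      case False
      obtain p where p: "\<And>s. poly p s = eval3 D (s *s v)" using eval3_on_line by blast
      obtain r where r: "\<And>s. poly r s = eval3 E (s *s v)" using eval3_on_line by blast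
      have "p * r = monom (eval3 (D * E) v) d"
        unfolding poly_eq_poly_eq_iff[symmetric]
        by (simp add: fun_eq_iff p r poly_monom eval3_homogeneous[OF assms(1), unfolded eval3_simps] mult_ac)
      then obtain e where "e \<le> d" "p = monom (poly p 1) e"
        using False by (rule monom_factor)
      then have "poly p 2 = 2 ^ e * poly p 1" by (metis mult.commute poly_monom)
      then show ?thesis using \<open>e \<le> d\<close> p[of 1] p[of 2] by (auto simp: eval3_double3 prod_zero_iff)
    qed simp
  qed
  then obtain e where e: "e \<le> d" "double3 D = const3 (2 ^ e) * D"
    using assms by (auto simp: prod_zero_iff)
  have "eval3 D (2 *s v) = 2 ^ e * eval3 D v" for v
    unfolding eval3_double3[symmetric] e by simp
  then show ?thesis using e that homogeneous_iff_eval_double by blast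
qed

lemma homogeneous_unique:
  assumes "homogeneous d P" "homogeneous e P" "P \<noteq> 0"
  shows "d = e"
proof -
  obtain i j k where "coeff (coeff (coeff P i) j) k \<noteq> 0"
    using assms(3) by (metis leading_coeff_0_iff)
  then show ?thesis using assms unfolding homogeneous_def by metis
qed


section \<open>Representatives of a rational map\<close>

lemma represents_proportional:
  assumes "represents F g" "represents G g"
  shows "F $ i * G $ j = F $ j * G $ i"
proof -
  have "rat_rel F F" "rat_rel G G" using assms by (auto simp: represents_def rat_rel_def mult.commute)
  then have "rat_rel F G"
    using assms Quotient3_rel[OF Quotient3_rat_map, of F G] by (simp add: represents_def)
  then show ?thesis by (simp add: rat_rel_def)
qed

lemma represents_cong:
  assumes "represents F g" "rat_rep G" "\<And>i j. F $ i * G $ j = F $ j * G $ i"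
  shows "represents G g"
proof -
  have "rat_rel F G" using assms by (simp add: represents_def rat_rel_def)
  then have "abs_rat_map F = abs_rat_map G"
    using Quotient3_rel[OF Quotient3_rat_map, of F G] by simp
  then show ?thesis using assms by (simp add: represents_def)
qed

text \<open>
  A nonzero entry \<open>G\<^sub>k\<close> divides \<open>F\<^sub>k * G\<^sub>j\<close> for all \<open>j\<close>, hence divides \<open>F\<^sub>k\<close> times the greatest common divisor of
  the entries of \<open>G\<close>, which is a unit. The quotient of \<open>F\<^sub>k\<close> by \<open>G\<^sub>k\<close> is the factor \<open>c\<close>.
\<close>

lemma reduced_divides:
  assumes "no_common_factor G" "G \<noteq> 0" "\<And>i j. F $ i * G $ j = F $ j * G $ i"
  obtains c where "\<And>i. F $ i = c * G $ i"
proof -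
  obtain k where k: "G $ k \<noteq> 0" using assms(2) by (auto simp: vec_eq_iff)
  have u: "is_unit (gcd (G $ 1) (gcd (G $ 2) (G $ 3)))"
    using assms(1) unfolding no_common_factor_def forall_3 by (meson dvd_trans gcd_dvd1 gcd_dvd2)
  have d: "G $ k dvd F $ k * G $ j" for j by (metis assms(3) dvd_triv_right)
  have g: "x dvd y * gcd a b" if "x dvd y * a" "x dvd y * b" for x y a b :: "complex poly3"
  proof -
    have "x dvd gcd (y * a) (y * b)" using that by simp
    then show ?thesis by (metis dvd_normalize_iff gcd_mult_left)
  qed
  have "G $ k dvd F $ k * gcd (G $ 1) (gcd (G $ 2) (G $ 3))"
    by (intro g d)
  then have "G $ k dvd F $ k" using u by (simp add: dvd_mult_unit_iff)
  then obtain c where c: "F $ k = c * G $ k" by (metis dvd_def mult.commute)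
  show ?thesis
  proof (rule that)
    fix j
    have "F $ j * G $ k = (c * G $ j) * G $ k"
      unfolding assms(3)[of j k] c by (simp only: mult_ac)
    then show "F $ j = c * G $ j" using k by (metis mult_right_cancel)
  qed
qed

text \<open>
  Dividing by the greatest common divisor keeps the entries homogeneous, because factors of homogeneous
  polynomials are homogeneous.
\<close>

lemma reduced_representative:
  assumes "represents F g" "homogeneous_triple d F"
  obtains G e where "e \<le> d" "represents G g" "homogeneous_triple e G" "no_common_factor G"
proof -
  define D where "D = gcd (F $ 1) (gcd (F $ 2) (F $ 3))"
  define G where "G = (\<chi> i. F $ i div D)"
  have F0: "F \<noteq> 0" using assms by (simp add: represents_def rat_rep_def)
  then obtain k where k: "F $ k \<noteq> 0" by (auto simp: vec_eq_iff)
  have DF: "D dvd F $ i" for i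
    using exhaust_3[of i] unfolding D_def by (auto intro: dvd_trans)
  have F: "F $ i = D * G $ i" for i using DF by (simp add: G_def)
  have D0: "D \<noteq> 0" using k F[of k] by auto
  have hom: "homogeneous d (D * G $ i)" for i using assms(2) F by (simp add: homogeneous_triple_def)
  obtain e where e: "homogeneous e D" "e \<le> d"
    using homogeneous_factor[OF hom[of k]] k F by metis
  have homG: "homogeneous (d - e) (G $ i)" for i
  proof (cases "G $ i = 0")
    case False
    then obtain e' where e': "homogeneous e' (G $ i)"
      using homogeneous_factor[of d "G $ i" D] hom[of i] D0 by (metis mult.commute mult_eq_0_iff)
    have "e + e' = d"
      using homogeneous_unique[OF homogeneous_mult[OF e(1) e'] hom[of i]] D0 False by simp
    then show ?thesis using e' by auto
  qed (simp add: homogeneous_def)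
  have ncf: "no_common_factor G"
    unfolding no_common_factor_def
  proof (intro allI impI)
    fix E assume "\<forall>i. E dvd G $ i"
    then have "D * E dvd F $ i" for i using F by (simp add: mult_dvd_mono)
    then have "D * E dvd D" unfolding D_def by simp
    then show "is_unit E" using D0 by (metis dvd_mult_cancel_left mult_1_right)
  qed
  have "G \<noteq> 0" using F0 F by (auto simp: vec_eq_iff)
  then have "represents G g"
    using assms(1) homG by (intro represents_cong[OF assms(1)]) (auto simp: rat_rep_def homogeneous_triple_def F mult_ac)
  then show ?thesis using homG ncf that[of "d - e"] by (auto simp: homogeneous_triple_def)
qed

text \<open>
  Reduced triples representing the same map differ by a unit, so they have the same degree.
\<close>

lemma d_alg_eqI:
  assumes "represents G g" "homogeneous_triple e G" "no_common_factor G"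
  shows "d_alg g = e"
  unfolding d_alg_def
proof (rule the_equality)
  show "\<exists>F. represents F g \<and> homogeneous_triple e F \<and> no_common_factor F" using assms by blast
next
  fix d assume "\<exists>F. represents F g \<and> homogeneous_triple d F \<and> no_common_factor F"
  then obtain F where F: "represents F g" "homogeneous_triple d F" "no_common_factor F" by blast
  have F0: "F \<noteq> 0" "G \<noteq> 0" using F assms by (simp_all add: represents_def rat_rep_def)
  obtain c where c: "\<And>i. F $ i = c * G $ i"
    using reduced_divides[OF assms(3) F0(2) represents_proportional[OF F(1) assms(1)]] by blast
  have "c dvd F $ i" for i using c by simp
  then have "is_unit c" using F(3) unfolding no_common_factor_def by blast
  then obtain c' where c': "c' * c = 1" by (metis dvd_def mult.commute)
  obtain k where k: "F $ k \<noteq> 0" using F0 by (auto simp: vec_eq_iff)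
  have "homogeneous 0 (c' * c)" unfolding c' using homogeneous_const3[of 1] by (simp add: const3_def flip: one_pCons)
  moreover have "c' * c \<noteq> 0" using c' by simp
  ultimately have "homogeneous 0 c" using homogeneous_factor[of 0 c c'] by (metis le_zero_eq mult.commute)
  then have "homogeneous (0 + e) (F $ k)" unfolding c using assms(2) by (intro homogeneous_mult) (auto simp: homogeneous_triple_def)
  then show "d = e" using F(2) k homogeneous_unique[of d "F $ k"] by (auto simp: homogeneous_triple_def)
qed

lemma d_alg_representative:
  assumes "represents F g"
  obtains G where "represents G g" "homogeneous_triple (d_alg g) G" "no_common_factor G"
proof -
  obtain d where "homogeneous_triple d F" using assms by (auto simp: represents_def rat_rep_def)
  then obtain G e where "represents G g" "homogeneous_triple e G" "no_common_factor G"
    using reduced_representative[OF assms] by metis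
  then show ?thesis using that d_alg_eqI by blast
qed

lemma d_alg_le:
  assumes "represents F g" "homogeneous_triple d F"
  shows "d_alg g \<le> d"
proof -
  obtain G e where "e \<le> d" "represents G g" "homogeneous_triple e G" "no_common_factor G"
    using reduced_representative[OF assms] .
  then show ?thesis using d_alg_eqI[of G g e] by simp
qed

lemma eval_triple_homogeneous:
  "homogeneous_triple d F \<Longrightarrow> eval_triple F (c *s v) = c ^ d *s eval_triple F v"
  by (simp add: vec_eq_iff eval_triple_def homogeneous_triple_def eval3_homogeneous)

lemma homogeneous_subst_triple:
  assumes "homogeneous_triple d G" "homogeneous_triple e F"
  shows "homogeneous_triple (d * e) (subst_triple G F)"
  unfolding homogeneous_triple_def homogeneous_iff_eval_double
proof (intro allI)
  fix i v
  have "homogeneous d (G $ i)" using assms(1) by (simp add: homogeneous_triple_def)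
  then show "eval3 (subst_triple G F $ i) (2 *s v) = 2 ^ (d * e) * eval3 (subst_triple G F $ i) v"
    by (simp add: subst_triple_def eval3_subst3 eval_triple_homogeneous[OF assms(2)] eval3_homogeneous
      power_mult[symmetric] mult.commute)
qed

lemma rat_rep_subst:
  assumes "rat_rep G" "rat_rep F" "subst_triple G F \<noteq> 0"
  shows "rat_rep (subst_triple G F)"
  using assms homogeneous_subst_triple unfolding rat_rep_def by blast

lemma triple_nonzero_iff: "F \<noteq> 0 \<longleftrightarrow> (\<exists>v. eval_triple F v \<noteq> 0)"
proof -
  have "F = 0" if "\<And>v. eval_triple F v = 0"
    using that eval3_eq_0_imp by (simp add: vec_eq_iff eval_triple_def)
  moreover have "eval_triple 0 v = 0" for v by (simp add: eval_triple_def vec_eq_iff)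
  ultimately show ?thesis by metis
qed

text \<open>
  Composition does not depend on the representatives: from \<open>F'\<^sub>k F = F\<^sub>k F'\<close> and the homogeneity of \<open>G\<close> one gets
  \<open>(F'\<^sub>k) ^ d G(F) = (F\<^sub>k) ^ d G(F')\<close>.
\<close>

lemma subst_proportional:
  assumes "\<And>i j. F $ i * F' $ j = F $ j * F' $ i" "homogeneous_triple d G" "F \<noteq> 0" "F' \<noteq> 0"
    and "\<And>i j. G $ i * G' $ j = G $ j * G' $ i"
  shows "subst_triple G F $ i * subst_triple G' F' $ j = subst_triple G F $ j * subst_triple G' F' $ i"
proof -
  obtain k where k: "F $ k \<noteq> 0" using assms(3) by (auto simp: vec_eq_iff)
  have k': "F' $ k \<noteq> 0"
  proof
    assume *: "F' $ k = 0"
    obtain l where "F' $ l \<noteq> 0" using assms(4) by (auto simp: vec_eq_iff)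
    then show False using assms(1)[of k l] k * by simp
  qed
  let ?D = "subst_triple G F $ i * subst_triple G' F' $ j - subst_triple G F $ j * subst_triple G' F' $ i"
  have "F' $ k ^ d * ?D = 0"
  proof (rule poly3_eqI)
    fix v
    let ?x = "eval_triple F v" and ?y = "eval_triple F' v"
    have "eval3 (F $ i * F' $ k) v = eval3 (F $ k * F' $ i) v" for i using assms(1) by metis
    then have e: "?y $ k *s ?x = ?x $ k *s ?y"
      by (simp add: vec_eq_iff eval_triple_def mult.commute)
    have G: "?y $ k ^ d * eval3 (G $ l) ?x = ?x $ k ^ d * eval3 (G $ l) ?y" for l
      using e assms(2) by (metis eval3_homogeneous homogeneous_triple_def)
    have "eval3 (G $ i * G' $ j) ?y = eval3 (G $ j * G' $ i) ?y" using assms(5) by metis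
    then have GG: "eval3 (G $ i) ?y * eval3 (G' $ j) ?y = eval3 (G $ j) ?y * eval3 (G' $ i) ?y" by simp
    have "?y $ k ^ d * (eval3 (G $ i) ?x * eval3 (G' $ j) ?y - eval3 (G $ j) ?x * eval3 (G' $ i) ?y) = 0"
    proof -
      have "?y $ k ^ d * (eval3 (G $ i) ?x * eval3 (G' $ j) ?y - eval3 (G $ j) ?x * eval3 (G' $ i) ?y)
        = ?x $ k ^ d * (eval3 (G $ i) ?y * eval3 (G' $ j) ?y - eval3 (G $ j) ?y * eval3 (G' $ i) ?y)"
        using G[of i] G[of j] by (metis (no_types, lifting) mult.assoc right_diff_distrib)
      then show ?thesis using GG by simp
    qed
    then show "eval3 (F' $ k ^ d * ?D) v = eval3 0 v"
      by (simp add: subst_triple_def eval3_subst3) (simp add: eval_triple_def)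
  qed
  then show ?thesis using k' by simp
qed

lemma represents_comp:
  assumes "represents G g" "represents F f" "subst_triple G F \<noteq> 0"
  shows "represents (subst_triple G F) (rat_comp g f)"
proof -
  let ?h = "abs_rat_map (subst_triple G F)"
  have rep: "rat_rep G" "rat_rep F" "F \<noteq> 0" using assms by (auto simp: represents_def rat_rep_def)
  have rS: "rat_rep (subst_triple G F)" using rat_rep_subst[OF rep(1,2) assms(3)] .
  have "rat_comp g f = ?h"
    unfolding rat_comp_def
  proof (rule the_equality)
    show "\<exists>G F. represents G g \<and> represents F f \<and> represents (subst_triple G F) ?h"
      using assms rS by (auto simp: represents_def)
  next
    fix h assume "\<exists>G F. represents G g \<and> represents F f \<and> represents (subst_triple G F) h"
    then obtain G' F' where h: "represents G' g" "represents F' f" "represents (subst_triple G' F') h" by blast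
    obtain d where d: "homogeneous_triple d G" using rep by (auto simp: rat_rep_def)
    have "F' \<noteq> 0" using h by (simp add: represents_def rat_rep_def)
    then have "represents (subst_triple G' F') ?h"
      using h rS rep d represents_proportional[OF assms(1) h(1)] represents_proportional[OF assms(2) h(2)]
      by (intro represents_cong[OF _ _ subst_proportional[of F F' d G G']]) (simp_all add: represents_def)
    then show "h = ?h" using h by (simp add: represents_def)
  qed
  then show ?thesis using rS by (simp add: represents_def)
qed

text \<open>
  Cancelling common factors of \<open>G\<close> and \<open>F\<close> cannot make a nonzero composite vanish. This is the substitute for
  dominance of the maps: one nonvanishing composite is enough.
\<close>

lemma subst_reduced_nonzero:
  assumes "subst_triple G F \<noteq> 0" "homogeneous_triple d G'"
    and G: "\<And>i. G $ i = c * G' $ i" and F: "\<And>i. F $ i = e * F' $ i"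
  shows "subst_triple G' F' \<noteq> 0"
proof -
  obtain v where v: "eval_triple G (eval_triple F v) \<noteq> 0"
    using assms(1) by (auto simp: triple_nonzero_iff eval_subst_triple)
  have 1: "eval_triple F v = eval3 e v *s eval_triple F' v"
    by (simp add: vec_eq_iff eval_triple_def F)
  have 2: "eval_triple G x = eval3 c x *s eval_triple G' x" for x
    by (simp add: vec_eq_iff eval_triple_def G)
  have "eval_triple G' (eval_triple F' v) \<noteq> 0"
    using v by (auto simp: 1 2 eval_triple_homogeneous[OF assms(2)])
  then show ?thesis by (auto simp: triple_nonzero_iff eval_subst_triple)
qed

lemma d_alg_comp_le:
  assumes "represents G g" "represents F f" "subst_triple G F \<noteq> 0"
  shows "d_alg (rat_comp g f) \<le> d_alg g * d_alg f"
proof -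
  obtain G' where G': "represents G' g" "homogeneous_triple (d_alg g) G'" "no_common_factor G'"
    using d_alg_representative[OF assms(1)] by blast
  obtain F' where F': "represents F' f" "homogeneous_triple (d_alg f) F'" "no_common_factor F'"
    using d_alg_representative[OF assms(2)] by blast
  have n: "G' \<noteq> 0" "F' \<noteq> 0" using G' F' by (auto simp: represents_def rat_rep_def)
  obtain c where c: "\<And>i. G $ i = c * G' $ i"
    using reduced_divides[OF G'(3) n(1) represents_proportional[OF assms(1) G'(1)]] by blast
  obtain e where e: "\<And>i. F $ i = e * F' $ i"
    using reduced_divides[OF F'(3) n(2) represents_proportional[OF assms(2) F'(1)]] by blast
  have "subst_triple G' F' \<noteq> 0" using subst_reduced_nonzero[OF assms(3) G'(2) c e] .
  from represents_comp[OF G'(1) F'(1) this] show ?thesis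
    using homogeneous_subst_triple[OF G'(2) F'(2)] by (rule d_alg_le)
qed

section \<open>Roots of submultiplicative sequences\<close>

text \<open>
  Fekete's lemma in multiplicative form: the roots converge to their infimum \<open>L\<close>. If one root, of index \<open>k\<close>, is
  below \<open>x\<close>, then division with remainder by \<open>k\<close> gives \<open>a n \<le> M * x ^ n\<close> for all \<open>n\<close>, and the roots of \<open>M\<close>
  tend to \<open>1\<close>.
\<close>

lemma submultiplicative_root_converges:
  fixes a :: "nat \<Rightarrow> real"
  assumes nonneg: "\<And>k. a k \<ge> 0" and sub: "\<And>k l. a (k + l) \<le> a k * a l"
    and bound: "\<And>k. a k \<le> C * \<tau> ^ k" and "\<tau> > 0"
  obtains L where "(\<lambda>k. root k (a k)) \<longlonglongrightarrow> L" "L \<le> \<tau>"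
proof -
  define L where "L = (INF k\<in>{1..}. root k (a k))"
  have bdd: "bdd_below ((\<lambda>k. root k (a k)) ` {1..})"
    by (rule bdd_belowI2[of _ 0]) (simp add: nonneg)
  have L_le: "L \<le> root k (a k)" if "k \<ge> 1" for k
    unfolding L_def using that by (intro cINF_lower bdd) auto
  have L0: "L \<ge> 0" unfolding L_def by (intro cINF_greatest) (auto simp: nonneg)
  have pow: "a (k * l + r) \<le> a k ^ l * a r" for k l r
  proof (induction l)
    case (Suc l)
    have "a (k * Suc l + r) = a (k + (k * l + r))" by (simp add: algebra_simps)
    also have "\<dots> \<le> a k * a (k * l + r)" by (rule sub)
    also have "\<dots> \<le> a k * (a k ^ l * a r)" by (intro mult_left_mono Suc.IH nonneg)
    finally show ?case by (simp add: mult.assoc)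
  qed simp
  have lim: "(\<lambda>k. root k (a k)) \<longlonglongrightarrow> L"
  proof (rule LIMSEQ_I)
    fix e :: real assume "e > 0"
    define x where "x = L + e / 2"
    have x: "x > 0" "L < x" "x < L + e" using L0 \<open>e > 0\<close> by (auto simp: x_def)
    have "\<exists>k\<in>{1..}. root k (a k) < x"
      using x(2) unfolding L_def by (subst (asm) cINF_less_iff[OF _ bdd]) auto
    then obtain k where k: "k \<ge> 1" "root k (a k) < x" by auto
    have ak: "a k \<le> x ^ k"
    proof -
      have "root k (a k) ^ k \<le> x ^ k" using k nonneg by (intro power_mono) auto
      then show ?thesis using k nonneg by (simp add: real_root_pow_pos2)
    qed
    \<comment> \<open>\<open>M\<close> bounds the contribution of the remainder modulo \<open>k\<close>.\<close>
    define M where "M = 1 + (\<Sum>r<k. a r / x ^ r)"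
    have M: "M \<ge> 1" "\<And>r. r < k \<Longrightarrow> a r \<le> M * x ^ r"
    proof -
      show "M \<ge> 1" unfolding M_def using nonneg x by (simp add: sum_nonneg)
      fix r assume "r < k"
      then have "a r / x ^ r \<le> (\<Sum>r<k. a r / x ^ r)"
        using nonneg x by (intro member_le_sum) auto
      then have "a r / x ^ r \<le> M" by (simp add: M_def)
      then show "a r \<le> M * x ^ r" using x by (simp add: pos_divide_le_eq)
    qed
    have aM: "a n \<le> M * x ^ n" for n
    proof -
      have "a n = a (k * (n div k) + n mod k)" by simp
      also have "\<dots> \<le> a k ^ (n div k) * a (n mod k)" by (rule pow)
      also have "\<dots> \<le> (x ^ k) ^ (n div k) * (M * x ^ (n mod k))"
        using k M ak nonneg x by (intro mult_mono power_mono) auto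
      also have "\<dots> = M * x ^ n"
        by (simp add: power_mult[symmetric] power_add[symmetric] mult.left_commute)
      finally show ?thesis .
    qed
    have "(\<lambda>n. root n M * x) \<longlonglongrightarrow> 1 * x"
      using M(1) by (intro tendsto_intros LIMSEQ_root_const) auto
    then have "eventually (\<lambda>n. root n M * x < L + e) sequentially"
      using x by (intro order_tendstoD) auto
    then have "eventually (\<lambda>n. norm (root n (a n) - L) < e) sequentially"
      using eventually_ge_at_top[of 1]
    proof eventually_elim
      case (elim n)
      have "root n (a n) \<le> root n (M * x ^ n)" using elim aM by (intro real_root_le_mono) auto
      also have "\<dots> = root n M * x" using elim x by (simp add: real_root_mult real_root_power_cancel)
      finally show ?case using elim L_le[of n] by simp
    qed
    then show "\<exists>no. \<forall>n\<ge>no. norm (root n (a n) - L) < e" by (simp add: eventually_sequentially)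
  qed
  have C: "C \<ge> 0" using bound[of 0] nonneg[of 0] by simp
  define C' where "C' = max C 1"
  have "(\<lambda>k. root k C' * \<tau>) \<longlonglongrightarrow> 1 * \<tau>"
    by (intro tendsto_intros LIMSEQ_root_const) (auto simp: C'_def)
  moreover have "eventually (\<lambda>k. root k (a k) \<le> root k C' * \<tau>) sequentially"
    using eventually_ge_at_top[of 1]
  proof eventually_elim
    case (elim k)
    have "a k \<le> C * \<tau> ^ k" by (rule bound)
    also have "\<dots> \<le> C' * \<tau> ^ k" using \<open>\<tau> > 0\<close> by (intro mult_right_mono) (auto simp: C'_def)
    finally have "root k (a k) \<le> root k (C' * \<tau> ^ k)" using elim by (intro real_root_le_mono) auto
    also have "\<dots> = root k C' * \<tau>" using elim \<open>\<tau> > 0\<close> by (simp add: real_root_mult real_root_power_cancel)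
    finally show ?case .
  qed
  ultimately have "L \<le> 1 * \<tau>" using lim by (intro tendsto_le[OF _ _ lim]) auto
  then show ?thesis using that lim by simp
qed

section \<open>Degree growth of the iterates\<close>

text \<open>
  Iterated substitution without cancelling common factors: the degrees are far too large, but exponents add up
  exactly under composition.
\<close>

primrec iter_triple :: "complex poly3 ^ 3 \<Rightarrow> nat \<Rightarrow> complex poly3 ^ 3" where
  "iter_triple F 0 = vector [varZ, varW, varT]"
| "iter_triple F (Suc k) = subst_triple F (iter_triple F k)"

lemma triple_eqI:
  assumes "\<And>v. eval_triple F v = eval_triple G v"
  shows "F = G"
  using assms by (auto simp: vec_eq_iff eval_triple_def intro!: poly3_eqI)

lemma eval_iter_triple: "eval_triple (iter_triple F k) v = (eval_triple F ^^ k) v"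
  by (induction k) (simp_all add: eval_subst_triple, simp add: eval_triple_def vec_eq_iff forall_3)

lemma subst_iter_triple: "subst_triple (iter_triple F k) (iter_triple F l) = iter_triple F (k + l)"
  by (rule triple_eqI) (simp add: eval_subst_triple eval_iter_triple funpow_add)

lemma represents_iterate:
  assumes "represents F g" "\<And>k. iter_triple F k \<noteq> 0"
  shows "represents (iter_triple F k) (rat_iterate k g)"
proof (induction k)
  case 0
  have "homogeneous_triple 1 (vector [varZ, varW, varT])"
    by (simp add: homogeneous_triple_def forall_3 homogeneous_vars[simplified])
  then show ?case using assms(2)[of 0]
    by (auto simp: represents_def rat_rep_def rat_iterate_def rat_id_def)
next
  case (Suc k)
  have "represents (subst_triple F (iter_triple F k)) (rat_comp g (rat_iterate k g))"
    using assms(2)[of "Suc k"] by (intro represents_comp assms Suc.IH) simp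
  then show ?case by (simp add: rat_iterate_def)
qed

text \<open>
  The definition of \<open>lambda1\<close> by \<open>lim\<close> is meaningful only for a convergent sequence; submultiplicativity of
  the degrees provides convergence.
\<close>

lemma lambda1_le:
  assumes "represents F g" "\<And>k. iter_triple F k \<noteq> 0"
    and "\<And>k. real (d_alg (rat_iterate k g)) \<le> C * \<tau> ^ k" "\<tau> > 0"
  shows "lambda1 g \<le> \<tau>"
proof -
  let ?a = "\<lambda>k. d_alg (rat_iterate k g)"
  have rep: "represents (iter_triple F k) (rat_iterate k g)" for k
    by (rule represents_iterate[OF assms(1,2)])
  have sub: "?a (k + l) \<le> ?a k * ?a l" for k l
  proof -
    have nz: "subst_triple (iter_triple F k) (iter_triple F l) \<noteq> 0"
      by (simp add: subst_iter_triple assms(2))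
    have "rat_comp (rat_iterate k g) (rat_iterate l g) = rat_iterate (k + l) g"
      using represents_comp[OF rep rep nz] rep[of "k + l"] by (simp add: represents_def subst_iter_triple)
    then show ?thesis using d_alg_comp_le[OF rep rep nz] by simp
  qed
  obtain L where "(\<lambda>k. root k (?a k)) \<longlonglongrightarrow> L" "L \<le> \<tau>"
  proof (rule submultiplicative_root_converges[of "\<lambda>k. real (?a k)" C \<tau>])
    show "real (?a (k + l)) \<le> real (?a k) * real (?a l)" for k l
      using sub[of k l] by (metis of_nat_mono of_nat_mult)
  qed (use assms(3,4) in auto)
  then show ?thesis by (simp add: lambda1_def limI)
qed

lemma homogeneous_prod_const:
  "(\<And>i. i < m \<Longrightarrow> homogeneous e (f i)) \<Longrightarrow> homogeneous (m * e) (\<Prod>i<m. f i)"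
proof (induction m)
  case 0
  show ?case using homogeneous_const3[of 1] by (simp add: const3_def flip: one_pCons)
next
  case (Suc m)
  then show ?case using homogeneous_mult[of "m * e" "\<Prod>i<m. f i" e "f m"] by (simp add: add.commute)
qed

text \<open>
  A Blaschke factor maps the unit disc into itself. The homogeneous form shows at the same time that its
  denominator is nonzero on the disc.
\<close>

lemma moebius_norm_less:
  fixes x y a :: complex
  assumes "norm x < norm y" "norm a < 1"
  shows "norm (x - a * y) < norm (y - cnj a * x)"
proof -
  have "(norm (y - cnj a * x))\<^sup>2 - (norm (x - a * y))\<^sup>2 = (1 - (norm a)\<^sup>2) * ((norm y)\<^sup>2 - (norm x)\<^sup>2)"
    unfolding cmod_power2 by (simp add: power2_eq_square algebra_simps)
  moreover have "(1 - (norm a)\<^sup>2) * ((norm y)\<^sup>2 - (norm x)\<^sup>2) > 0"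
    using assms by (intro mult_pos_pos) (auto simp: power_strict_mono power_less_one_iff)
  ultimately have "(norm (x - a * y))\<^sup>2 < (norm (y - cnj a * x))\<^sup>2" by simp
  then show ?thesis by (rule power_less_imp_less_base) simp
qed

lemma blaschke_num_less_den:
  assumes "norm x < norm t" "norm y < norm t" "m \<ge> 1" "norm \<theta> = 1"
    and "\<And>i. i < m \<Longrightarrow> norm (a i) < 1" "\<And>i. i < n \<Longrightarrow> norm (b i) < 1"
  shows "norm (eval3 (blaschke_num \<theta> m a n b) (vector [x, y, t]))
       < norm (eval3 (blaschke_den m a n b) (vector [x, y, t]))"
proof -
  have 1: "norm (x - a i * t) < norm (t - cnj (a i) * x)" if "i < m" for i
    using assms that by (intro moebius_norm_less) auto
  have 2: "norm (y - b i * t) < norm (t - cnj (b i) * y)" if "i < n" for i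
    using assms that by (intro moebius_norm_less) auto
  have "(\<Prod>i<m. norm (x - a i * t)) < (\<Prod>i<m. norm (t - cnj (a i) * x))"
    using assms(3) le_less_trans[OF norm_ge_zero 1]
    by (intro prod_mono_strict[where i = 0]) (auto intro: less_imp_le[OF 1] 1)
  moreover have "(\<Prod>i<n. norm (y - b i * t)) \<le> (\<Prod>i<n. norm (t - cnj (b i) * y))"
    using 2 by (intro prod_mono) (auto simp: less_imp_le)
  moreover have "0 < (\<Prod>i<n. norm (t - cnj (b i) * y))"
    using 2 by (intro prod_pos) (metis le_less_trans norm_ge_zero lessThan_iff)
  ultimately have "(\<Prod>i<m. norm (x - a i * t)) * (\<Prod>i<n. norm (y - b i * t))
     < (\<Prod>i<m. norm (t - cnj (a i) * x)) * (\<Prod>i<n. norm (t - cnj (b i) * y))"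
    by (intro le_less_trans[OF mult_left_mono mult_strict_right_mono]) (auto intro: prod_nonneg)
  then show ?thesis
    using assms(4) by (simp add: blaschke_num_def blaschke_den_def norm_mult prod_norm[symmetric])
qed


lemma eval_blaschke_triple:
  "eval_triple (blaschke_triple m n p q (a, b, c, d, \<theta>\<^sub>1, \<theta>\<^sub>2)) v = vector
    [eval3 (blaschke_num \<theta>\<^sub>1 m a n b) v * eval3 (blaschke_den p c q d) v,
     eval3 (blaschke_num \<theta>\<^sub>2 p c q d) v * eval3 (blaschke_den m a n b) v,
     eval3 (blaschke_den m a n b) v * eval3 (blaschke_den p c q d) v]"
  by (simp add: blaschke_triple.simps eval_triple_def vec_eq_iff forall_3)

declare blaschke_triple.simps [simp del]

locale blaschke =
  fixes m n p q :: nat and a b c d :: "nat \<Rightarrow> complex" and \<theta>\<^sub>1 \<theta>\<^sub>2 :: complex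
  assumes pos: "m \<ge> 1" "n \<ge> 1" "p \<ge> 1" "q \<ge> 1"
    and a: "\<And>i. i < m \<Longrightarrow> norm (a i) < 1" and b: "\<And>i. i < n \<Longrightarrow> norm (b i) < 1"
    and c: "\<And>i. i < p \<Longrightarrow> norm (c i) < 1" and d: "\<And>i. i < q \<Longrightarrow> norm (d i) < 1"
    and \<theta>: "norm \<theta>\<^sub>1 = 1" "norm \<theta>\<^sub>2 = 1"
begin

abbreviation "F \<equiv> blaschke_triple m n p q (a, b, c, d, \<theta>\<^sub>1, \<theta>\<^sub>2)"
abbreviation "f \<equiv> blaschke_map m n p q (a, b, c, d, \<theta>\<^sub>1, \<theta>\<^sub>2)"

text \<open>
  The cone over the unit bidisc. It is invariant, and the third coordinate has no zeros on it, so the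
  iterated triples do not vanish identically.
\<close>

definition bidisc :: "(complex ^ 3) set" where
  "bidisc = {v. norm (v $ 1) < norm (v $ 3) \<and> norm (v $ 2) < norm (v $ 3)}"

lemma represents_F: "represents F f"
  by (simp add: represents_def blaschke_map_def rat_rep_blaschke_triple)

lemma bidisc_less:
  assumes "v \<in> bidisc"
  shows "norm (eval3 (blaschke_num \<theta>\<^sub>1 m a n b) v) < norm (eval3 (blaschke_den m a n b) v)"
    and "norm (eval3 (blaschke_num \<theta>\<^sub>2 p c q d) v) < norm (eval3 (blaschke_den p c q d) v)"
proof -
  have "v = vector [v $ 1, v $ 2, v $ 3]" by (simp add: vec_eq_iff forall_3)
  then show "norm (eval3 (blaschke_num \<theta>\<^sub>1 m a n b) v) < norm (eval3 (blaschke_den m a n b) v)"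
    and "norm (eval3 (blaschke_num \<theta>\<^sub>2 p c q d) v) < norm (eval3 (blaschke_den p c q d) v)"
    using blaschke_num_less_den[of "v $ 1" "v $ 3" "v $ 2" m \<theta>\<^sub>1 a n b]
      blaschke_num_less_den[of "v $ 1" "v $ 3" "v $ 2" p \<theta>\<^sub>2 c q d] assms pos a b c d \<theta>
    by (auto simp: bidisc_def)
qed

lemma bidisc_invariant: "v \<in> bidisc \<Longrightarrow> eval_triple F v \<in> bidisc"
  using bidisc_less[of v] le_less_trans[OF norm_ge_zero bidisc_less(1)[of v]]
    le_less_trans[OF norm_ge_zero bidisc_less(2)[of v]]
  by (simp add: eval_blaschke_triple bidisc_def norm_mult mult.commute[of "norm (eval3 (blaschke_den m a n b) v)"])

lemma iter_bidisc: "v \<in> bidisc \<Longrightarrow> eval_triple (iter_triple F k) v \<in> bidisc"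
  unfolding eval_iter_triple by (induction k) (auto simp: bidisc_invariant)

lemma origin_bidisc: "vector [0, 0, 1] \<in> bidisc"
  by (simp add: bidisc_def)

lemma iter_F_nonzero: "iter_triple F k \<noteq> 0"
  using iter_bidisc[OF origin_bidisc, of k]
  by (auto simp: triple_nonzero_iff bidisc_def intro!: exI[of _ "vector [0, 0, 1]"])

text \<open>
  The common degrees of numerator and denominator in the two coordinates of the iterates.
\<close>

fun degrees :: "nat \<Rightarrow> nat \<times> nat" where
  "degrees 0 = (1, 1)"
| "degrees (Suc k) = (case degrees k of (e, e') \<Rightarrow> (m * e + n * e', p * e + q * e'))"

text \<open>
  If the coordinates of an iterate are \<open>X / X'\<close> and \<open>Y / Y'\<close>, then a Blaschke factor of the first one is
  \<open>(X - a X') / (X' - cnj a X)\<close>. No further denominator has to be cleared, so the degrees grow by the exponent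
  matrix only. The nonvanishing at the origin of the bidisc shows that no denominator is the zero polynomial.
\<close>

lemma iterate_split:
  "\<exists>X X' Y Y'. homogeneous (fst (degrees k)) X \<and> homogeneous (fst (degrees k)) X' \<and>
     homogeneous (snd (degrees k)) Y \<and> homogeneous (snd (degrees k)) Y' \<and>
     eval3 X' (vector [0, 0, 1]) \<noteq> 0 \<and> eval3 Y' (vector [0, 0, 1]) \<noteq> 0 \<and>
     iter_triple F k $ 1 * X' = iter_triple F k $ 3 * X \<and> iter_triple F k $ 2 * Y' = iter_triple F k $ 3 * Y"
proof (induction k)
  case 0
  show ?case
    by (intro exI[of _ varZ] exI[of _ varT] exI[of _ varW]) (simp add: homogeneous_vars[simplified])
next
  case (Suc k)
  obtain e e' where e: "degrees k = (e, e')" by fastforce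
  obtain X X' Y Y' where h: "homogeneous e X" "homogeneous e X'" "homogeneous e' Y" "homogeneous e' Y'"
    and nz: "eval3 X' (vector [0, 0, 1]) \<noteq> 0" "eval3 Y' (vector [0, 0, 1]) \<noteq> 0"
    and pr: "iter_triple F k $ 1 * X' = iter_triple F k $ 3 * X" "iter_triple F k $ 2 * Y' = iter_triple F k $ 3 * Y"
    using Suc.IH unfolding e by auto
  let ?G = "iter_triple F k"
  define num where "num \<theta> m a n b = const3 \<theta> * (\<Prod>i<m. X - const3 (a i) * X') * (\<Prod>i<n. Y - const3 (b i) * Y')"
    for \<theta> and m n :: nat and a b
  define den where "den m a n b = (\<Prod>i<m. X' - const3 (cnj (a i)) * X) * (\<Prod>i<n. Y' - const3 (cnj (b i)) * Y)"
    for m n :: nat and a b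
  have lin: "homogeneous e (P - const3 u * Q)" if "homogeneous e P" "homogeneous e Q" for P Q e u
    using homogeneous_diff[OF that(1)] homogeneous_mult[OF homogeneous_const3 that(2)] by simp
  have hnum: "homogeneous (m * e + n * e') (num \<theta> m a n b)" for \<theta> m a n b
    unfolding num_def using h
    by (intro homogeneous_mult[of "0 + m * e", simplified] homogeneous_mult[OF homogeneous_const3, simplified]
        homogeneous_prod_const lin)
  have hden: "homogeneous (m * e + n * e') (den m a n b)" for m a n b
    unfolding den_def using h by (intro homogeneous_mult homogeneous_prod_const lin)
  have eq: "subst3 (blaschke_num \<theta> m a n b) ?G * den m a n b = subst3 (blaschke_den m a n b) ?G * num \<theta> m a n b"
    for \<theta> m a n b
  proof (rule poly3_eqI)
    fix v
    define g where "g i = eval3 (?G $ i) v" for i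
    define x x' y y' where "x = eval3 X v" and "x' = eval3 X' v" and "y = eval3 Y v" and "y' = eval3 Y' v"
    have pr': "g 1 * x' = g 3 * x" "g 2 * y' = g 3 * y"
      using arg_cong[OF pr(1), of "\<lambda>P. eval3 P v"] arg_cong[OF pr(2), of "\<lambda>P. eval3 P v"]
      by (simp_all add: g_def x_def x'_def y_def y'_def)
    have f: "(u - s * g 3) * (z' - cnj s * z) = (g 3 - cnj s * u) * (z - s * z')"
      if "u * z' = g 3 * z" for u z z' s
      using that by (simp add: algebra_simps)
    have 1: "(\<Prod>i<m. g 1 - a i * g 3) * (\<Prod>i<m. x' - cnj (a i) * x) = (\<Prod>i<m. g 3 - cnj (a i) * g 1) * (\<Prod>i<m. x - a i * x')"
      unfolding prod.distrib[symmetric] by (intro prod.cong f pr' refl)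
    have 2: "(\<Prod>i<n. g 2 - b i * g 3) * (\<Prod>i<n. y' - cnj (b i) * y) = (\<Prod>i<n. g 3 - cnj (b i) * g 2) * (\<Prod>i<n. y - b i * y')"
      unfolding prod.distrib[symmetric] by (intro prod.cong f pr' refl)
    have "\<theta> * (\<Prod>i<m. g 1 - a i * g 3) * (\<Prod>i<n. g 2 - b i * g 3) * ((\<Prod>i<m. x' - cnj (a i) * x) * (\<Prod>i<n. y' - cnj (b i) * y))
       = \<theta> * ((\<Prod>i<m. g 1 - a i * g 3) * (\<Prod>i<m. x' - cnj (a i) * x)) * ((\<Prod>i<n. g 2 - b i * g 3) * (\<Prod>i<n. y' - cnj (b i) * y))"
      by (simp only: mult_ac)
    also have "\<dots> = (\<Prod>i<m. g 3 - cnj (a i) * g 1) * (\<Prod>i<n. g 3 - cnj (b i) * g 2) * (\<theta> * (\<Prod>i<m. x - a i * x') * (\<Prod>i<n. y - b i * y'))"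
      unfolding 1 2 by (simp only: mult_ac)
    finally show "eval3 (subst3 (blaschke_num \<theta> m a n b) ?G * den m a n b) v
        = eval3 (subst3 (blaschke_den m a n b) ?G * num \<theta> m a n b) v"
      by (simp add: eval3_subst3 num_def den_def blaschke_num_def blaschke_den_def eval_triple_def
          flip: g_def x_def x'_def y_def y'_def)
  qed
  have comp: "iter_triple F (Suc k) = vector
    [subst3 (blaschke_num \<theta>\<^sub>1 m a n b) ?G * subst3 (blaschke_den p c q d) ?G,
     subst3 (blaschke_num \<theta>\<^sub>2 p c q d) ?G * subst3 (blaschke_den m a n b) ?G,
     subst3 (blaschke_den m a n b) ?G * subst3 (blaschke_den p c q d) ?G]"
    by (rule triple_eqI) (simp add: eval_subst_triple eval_blaschke_triple,
      simp add: eval_triple_def vec_eq_iff forall_3 eval3_subst3)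
  let ?o = "vector [0, 0, 1] :: complex ^ 3"
  have den_nz: "eval3 (den m a n b) ?o \<noteq> 0"
    if "\<And>i. i < m \<Longrightarrow> norm (a i) < 1" "\<And>i. i < n \<Longrightarrow> norm (b i) < 1" for m a n b
  proof -
    define g where "g i = eval3 (?G $ i) ?o" for i
    have g: "norm (g 1) < norm (g 3)" "norm (g 2) < norm (g 3)"
      using iter_bidisc[OF origin_bidisc, of k] by (auto simp: bidisc_def g_def eval_triple_def)
    have less: "norm z < norm z'" if "u * z' = g 3 * z" "norm u < norm (g 3)" "z' \<noteq> 0" for u z z'
    proof -
      have "norm (g 3) * norm z = norm u * norm z'" using that(1) by (metis norm_mult)
      also have "\<dots> < norm (g 3) * norm z'" using that by (intro mult_strict_right_mono) auto
      finally show ?thesis using that(2) by (meson mult_less_cancel_left_pos norm_ge_zero le_less_trans)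
    qed
    have lx: "norm (eval3 X ?o) < norm (eval3 X' ?o)"
    proof (rule less)
      show "g 1 * eval3 X' ?o = g 3 * eval3 X ?o"
        using arg_cong[OF pr(1), of "\<lambda>P. eval3 P ?o"] unfolding g_def eval3_simps .
    qed (rule g nz)+
    have ly: "norm (eval3 Y ?o) < norm (eval3 Y' ?o)"
    proof (rule less)
      show "g 2 * eval3 Y' ?o = g 3 * eval3 Y ?o"
        using arg_cong[OF pr(2), of "\<lambda>P. eval3 P ?o"] unfolding g_def eval3_simps .
    qed (rule g nz)+
    have "eval3 X' ?o - cnj (a i) * eval3 X ?o \<noteq> 0" if "i < m" for i
      using moebius_norm_less[OF lx] \<open>\<And>i. i < m \<Longrightarrow> norm (a i) < 1\<close> that by fastforce
    moreover have "eval3 Y' ?o - cnj (b i) * eval3 Y ?o \<noteq> 0" if "i < n" for i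
      using moebius_norm_less[OF ly] \<open>\<And>i. i < n \<Longrightarrow> norm (b i) < 1\<close> that by fastforce
    ultimately show ?thesis by (simp add: den_def)
  qed
  show ?case
  proof (intro exI conjI)
    show "homogeneous (fst (degrees (Suc k))) (num \<theta>\<^sub>1 m a n b)" "homogeneous (fst (degrees (Suc k))) (den m a n b)"
      "homogeneous (snd (degrees (Suc k))) (num \<theta>\<^sub>2 p c q d)" "homogeneous (snd (degrees (Suc k))) (den p c q d)"
      by (simp_all add: e hnum hden)
    show "eval3 (den m a n b) ?o \<noteq> 0" "eval3 (den p c q d) ?o \<noteq> 0"
      using a b c d by (intro den_nz; simp)+
    show "iter_triple F (Suc k) $ 1 * den m a n b = iter_triple F (Suc k) $ 3 * num \<theta>\<^sub>1 m a n b"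
      using eq[of \<theta>\<^sub>1 m a n b] unfolding comp by (simp add: mult_ac)
    show "iter_triple F (Suc k) $ 2 * den p c q d = iter_triple F (Suc k) $ 3 * num \<theta>\<^sub>2 p c q d"
      using eq[of \<theta>\<^sub>2 p c q d] unfolding comp by (simp add: mult_ac)
  qed
qed

text \<open>
  The triple \<open>[X Y' : Y X' : X' Y']\<close> represents the iterate.
\<close>

lemma d_alg_iterate_le: "d_alg (rat_iterate k f) \<le> fst (degrees k) + snd (degrees k)"
proof -
  let ?G = "iter_triple F k" and ?e = "fst (degrees k)" and ?e' = "snd (degrees k)"
  obtain X X' Y Y' where h: "homogeneous ?e X" "homogeneous ?e X'" "homogeneous ?e' Y" "homogeneous ?e' Y'"
    and nz: "eval3 X' (vector [0, 0, 1]) \<noteq> 0" "eval3 Y' (vector [0, 0, 1]) \<noteq> 0"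
    and pr: "?G $ 1 * X' = ?G $ 3 * X" "?G $ 2 * Y' = ?G $ 3 * Y"
    using iterate_split[of k] by blast
  define T where "T = (vector [X * Y', Y * X', X' * Y'] :: complex poly3 ^ 3)"
  have hom: "homogeneous_triple (?e + ?e') T"
    using homogeneous_mult[OF h(1,4)] homogeneous_mult[OF h(3,2)] homogeneous_mult[OF h(2,4)]
    by (simp add: homogeneous_triple_def forall_3 T_def add.commute)
  have "eval3 (T $ 3) (vector [0, 0, 1]) \<noteq> 0" using nz by (simp add: T_def)
  then have "T \<noteq> 0" by auto
  then have "rat_rep T" using hom by (auto simp: rat_rep_def)
  moreover have "?G $ i * T $ j = ?G $ j * T $ i" for i j
  proof -
    let ?g = "\<lambda>i. ?G $ i"
    have p: "?g 3 * T $ j = ?g j * T $ 3" for j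
      using exhaust_3[of j] pr by (auto simp: T_def)
    have g3: "?g 3 \<noteq> 0"
      using iter_bidisc[OF origin_bidisc, of k] by (auto simp: bidisc_def eval_triple_def)
    have "?g 3 * (?g i * T $ j) = ?g i * (?g 3 * T $ j)" by (simp only: mult_ac)
    also have "\<dots> = ?g j * (?g 3 * T $ i)" unfolding p by (simp only: mult_ac)
    also have "\<dots> = ?g 3 * (?g j * T $ i)" by (simp only: mult_ac)
    finally show ?thesis using g3 by simp
  qed
  ultimately have "represents T (rat_iterate k f)"
    using represents_cong[OF represents_iterate[OF represents_F iter_F_nonzero]] by blast
  then show ?thesis using hom by (rule d_alg_le)
qed

text \<open>
  The degree sums satisfy \<open>s (k + 2) = T * s (k + 1) - \<Delta> * s k\<close> with the trace \<open>T\<close> and the determinant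
  \<open>\<Delta> \<ge> 1\<close> of the exponent matrix. Dropping the last term gives the rate \<open>T\<close>, that is \<open>s k \<ge> s (k + 1) / T\<close>;
  inserting this into the recursion improves the rate to \<open>T - 1 / T\<close>. The improvement matters because \<open>T\<close> can be equal to
  \<open>m * q + n * p\<close>, for example for \<open>m = 2\<close> and \<open>n = p = q = 1\<close>.
\<close>

lemma degrees_growth:
  assumes "m * q > n * p"
  shows "\<exists>C. \<forall>k. real (fst (degrees k) + snd (degrees k)) \<le> C * (real (m + q) - 1 / real (m + q)) ^ k"
proof -
  define s where "s k = real (fst (degrees k) + snd (degrees k))" for k
  define T where "T = real (m + q)"
  define \<Delta> where "\<Delta> = real (m * q) - real (n * p)"
  have T: "T \<ge> 2" using pos by (simp add: T_def)
  have "real (n * p) + 1 \<le> real (m * q)" using assms by linarith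
  then have \<Delta>: "\<Delta> \<ge> 1" by (simp add: \<Delta>_def)
  have rec: "s (Suc (Suc k)) = T * s (Suc k) - \<Delta> * s k" for k
    by (simp add: s_def T_def \<Delta>_def split: prod.split) (simp add: algebra_simps)
  have s0: "s k \<ge> 0" for k by (simp add: s_def)
  let ?t = "T - 1 / T"
  have "1 / T \<le> 1" using T by simp
  then have t: "?t \<ge> 1" using T by linarith
  have step: "s (Suc (Suc (Suc k))) \<le> ?t * s (Suc (Suc k))" for k
  proof -
    have "s (Suc (Suc k)) \<le> T * s (Suc k)" using rec[of k] \<Delta> s0[of k] by simp
    then have "s (Suc (Suc k)) / T \<le> 1 * s (Suc k)" using T by (simp add: divide_le_eq mult.commute)
    also have "\<dots> \<le> \<Delta> * s (Suc k)" using \<Delta> s0 by (intro mult_right_mono) auto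
    finally show ?thesis using rec[of "Suc k"] by (simp add: algebra_simps)
  qed
  define C where "C = s 0 + s 1 + s 2"
  have le: "s (Suc (Suc k)) \<le> C * ?t ^ Suc (Suc k)" for k
  proof (induction k)
    case 0
    have "s (Suc (Suc 0)) \<le> C * 1" using s0 by (simp add: C_def numeral_2_eq_2)
    also have "\<dots> \<le> C * ?t ^ Suc (Suc 0)" using t s0 by (intro mult_left_mono one_le_power) (auto simp: C_def)
    finally show ?case .
  next
    case (Suc k)
    have "s (Suc (Suc (Suc k))) \<le> ?t * s (Suc (Suc k))" by (rule step)
    also have "\<dots> \<le> ?t * (C * ?t ^ Suc (Suc k))" using t Suc.IH by (intro mult_left_mono) auto
    finally show ?case by (simp add: mult_ac)
  qed
  have "s k \<le> C * ?t ^ k" for k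
  proof -
    have "C * 1 \<le> C * ?t ^ k" using t s0 by (intro mult_left_mono one_le_power) (auto simp: C_def)
    moreover have "s 0 \<le> C" "s (Suc 0) \<le> C" using s0 by (simp_all add: C_def)
    ultimately show ?thesis using le[of "k - 2"] by (cases k; cases "k - 1") auto
  qed
  then show ?thesis unfolding s_def T_def by blast
qed

lemma lambda1_less:
  assumes "m * q > n * p"
  shows "lambda1 f < real (m * q + n * p)"
proof -
  let ?t = "real (m + q) - 1 / real (m + q)"
  obtain C where C: "\<And>k. real (fst (degrees k) + snd (degrees k)) \<le> C * ?t ^ k"
    using degrees_growth[OF assms] by blast
  have mq: "m + q \<ge> 2" using pos by simp
  then have "real (m + q) \<ge> real 2" by (simp only: of_nat_le_iff)
  then have "real (m + q) \<ge> 2" by simp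
  moreover from this have "1 / real (m + q) \<le> 1" by (subst divide_le_eq_1) linarith
  ultimately have t: "?t > 0" by linarith
  have "lambda1 f \<le> ?t"
    using represents_F iter_F_nonzero order_trans[OF of_nat_mono[OF d_alg_iterate_le] C] t
    by (rule lambda1_le)
  also have "?t < real (m + q)" using mq by (simp add: add_nonneg_pos)
  also have "m + q \<le> m * q + n * p"
  proof -
    have "n * p \<ge> 1" using pos by simp
    moreover have "m + q \<le> m * q + 1" using pos by (cases m; cases q) simp_all
    ultimately show ?thesis by linarith
  qed
  finally show ?thesis by simp
qed

end

section \<open>Images of plane curves\<close>

text \<open>
  Gaussian elimination, removing one equation and one unknown at a time.
\<close>

lemma underdetermined_system:
  fixes M :: "'x \<Rightarrow> 'y \<Rightarrow> 'a::field"
  assumes "finite Y" "finite X" "card Y < card X"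
  shows "\<exists>c. (\<exists>x\<in>X. c x \<noteq> 0) \<and> (\<forall>y\<in>Y. (\<Sum>x\<in>X. c x * M x y) = 0)"
  using assms
proof (induction Y arbitrary: X M rule: finite_induct)
  case empty
  then have "X \<noteq> {}" by auto
  then show ?case by (intro exI[of _ "\<lambda>_. 1"]) auto
next
  case (insert y Y)
  show ?case
  proof (cases "\<forall>x\<in>X. M x y = 0")
    case True
    obtain c where "\<exists>x\<in>X. c x \<noteq> 0" "\<forall>y\<in>Y. (\<Sum>x\<in>X. c x * M x y) = 0"
      using insert.IH[of X M] insert.prems insert.hyps by auto
    then show ?thesis using True by (intro exI[of _ c]) auto
  next
    case False
    then obtain x0 where x0: "x0 \<in> X" "M x0 y \<noteq> 0" by blast
    define X' where "X' = X - {x0}"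
    have X: "X = insert x0 X'" "x0 \<notin> X'" "finite X'" using x0 insert.prems by (auto simp: X'_def)
    define M' where "M' x z = M x z - M x y / M x0 y * M x0 z" for x z
    have "card Y < card X'" using insert.prems insert.hyps X by simp
    then obtain c where c: "\<exists>x\<in>X'. c x \<noteq> 0" "\<forall>z\<in>Y. (\<Sum>x\<in>X'. c x * M' x z) = 0"
      using insert.IH[of X' M'] X by auto
    define c' where "c' = c(x0 := - (\<Sum>x\<in>X'. c x * M x y) / M x0 y)"
    have sum: "(\<Sum>x\<in>X. c' x * M x z) = (\<Sum>x\<in>X'. c x * M' x z)" for z
    proof -
      have "(\<Sum>x\<in>X. c' x * M x z) = c' x0 * M x0 z + (\<Sum>x\<in>X'. c x * M x z)"
        using X by (auto simp: c'_def intro!: sum.cong)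
      also have "\<dots> = (\<Sum>x\<in>X'. c x * M x z) - (\<Sum>x\<in>X'. c x * (M x y / M x0 y * M x0 z))"
        by (simp add: c'_def sum_distrib_right sum_divide_distrib mult.assoc)
      also have "\<dots> = (\<Sum>x\<in>X'. c x * M' x z)"
        by (simp add: M'_def right_diff_distrib sum_subtractf)
      finally show ?thesis .
    qed
    have "M' x y = 0" for x using x0 by (simp add: M'_def)
    then have "\<forall>z\<in>insert y Y. (\<Sum>x\<in>X. c' x * M x z) = 0" using c sum by auto
    moreover have "\<exists>x\<in>X. c' x \<noteq> 0" using c X by (auto simp: c'_def)
    ultimately show ?thesis by blast
  qed
qed

definition eval2 :: "complex poly poly \<Rightarrow> complex \<Rightarrow> complex \<Rightarrow> complex" where
  "eval2 P z w = poly (poly P [:z:]) w"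

lemma eval2_simps [simp]:
  "eval2 0 z w = 0" "eval2 1 z w = 1" "eval2 (P + Q) z w = eval2 P z w + eval2 Q z w" "eval2 (P - Q) z w = eval2 P z w - eval2 Q z w"
  "eval2 (P * Q) z w = eval2 P z w * eval2 Q z w" "eval2 (P ^ k) z w = eval2 P z w ^ k"
  "eval2 [:[:c:]:] z w = c" "eval2 (smult r P) z w = poly r w * eval2 P z w"
  by (simp_all add: eval2_def poly_power)

lemma eval2_sum [simp]: "eval2 (\<Sum>i\<in>I. f i) z w = (\<Sum>i\<in>I. eval2 (f i) z w)"
  by (simp add: eval2_def poly_sum)

definition bidegree_le :: "nat \<Rightarrow> complex poly poly \<Rightarrow> bool" where
  "bidegree_le n P \<longleftrightarrow> degree P \<le> n \<and> (\<forall>i. degree (coeff P i) \<le> n)"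

lemma bidegree_le_mult:
  assumes "bidegree_le k P" "bidegree_le l Q"
  shows "bidegree_le (k + l) (P * Q)"
proof -
  have "degree (coeff (P * Q) i) \<le> k + l" for i
    unfolding coeff_mult using assms
    by (intro degree_sum_le order_trans[OF degree_mult_le] add_mono) (auto simp: bidegree_le_def)
  moreover have "degree (P * Q) \<le> k + l"
    using assms by (intro order_trans[OF degree_mult_le] add_mono) (auto simp: bidegree_le_def)
  ultimately show ?thesis by (simp add: bidegree_le_def)
qed

lemma bidegree_le_power: "bidegree_le k P \<Longrightarrow> bidegree_le (k * l) (P ^ l)"
proof (induction l)
  case 0
  then show ?case by (auto simp: bidegree_le_def coeff_1)
next
  case (Suc l)
  then show ?case using bidegree_le_mult[of k P "k * l" "P ^ l"] by simp
qed

lemma bidegree_le_mono: "bidegree_le k P \<Longrightarrow> k \<le> l \<Longrightarrow> bidegree_le l P"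
  by (auto simp: bidegree_le_def intro: order_trans)

lemma bidegree_le_exists: "\<exists>n. bidegree_le n P"
proof -
  let ?A = "insert (degree P) ((\<lambda>i. degree (coeff P i)) ` {..degree P})"
  have "degree (coeff P i) \<le> Max ?A" for i
    by (cases "i \<le> degree P") (auto simp: coeff_eq_0 simp del: Max_insert intro!: Max_ge)
  then show ?thesis by (intro exI[of _ "Max ?A"]) (auto simp: bidegree_le_def simp del: Max_insert intro!: Max_ge)
qed

lemma eval3_monom: "eval3 (monom (monom (monom c k) j) i) x = c * (x $ 1 ^ i * x $ 2 ^ j * x $ 3 ^ k)"
  by (simp add: eval3_def poly_monom poly_const_pow mult_ac)

text \<open>
  The three functions \<open>U = N1 / D1\<close>, \<open>V = N2 / D2\<close> and \<open>K\<close> of two variables are algebraically dependent: after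
  multiplication by \<open>(D1 D2) ^ k\<close>, the \<open>(k + 1) ^ 3\<close> monomials \<open>U ^ i V ^ j K ^ l\<close> with exponents at most \<open>k\<close> lie in a
  space of polynomials whose dimension grows only quadratically in \<open>k\<close>. Dividing a relation by the largest possible power of \<open>K\<close> and then
  setting \<open>K = 0\<close> leaves a nontrivial relation between \<open>U\<close> and \<open>V\<close> on the curve. Its homogenisation is \<open>H\<close>; the values
  \<open>y\<close> are homogeneous coordinates of \<open>(U, V)\<close>.
\<close>

lemma curve_image_algebraic:
  assumes K: "K \<noteq> 0"
  obtains H d where "H \<noteq> 0" "homogeneous d H"
    "\<And>z w y. \<lbrakk>eval2 K z w = 0; eval2 D1 z w \<noteq> 0; eval2 D2 z w \<noteq> 0;
       eval2 N1 z w * y $ 3 = y $ 1 * eval2 D1 z w; eval2 N2 z w * y $ 3 = y $ 2 * eval2 D2 z w\<rbrakk>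
       \<Longrightarrow> eval3 H y = 0"
proof -
  obtain k1 k2 k3 k4 k5 where ks: "bidegree_le k1 K" "bidegree_le k2 N1" "bidegree_le k3 D1"
      "bidegree_le k4 N2" "bidegree_le k5 D2"
    using bidegree_le_exists by meson
  define r where "r = Suc (k1 + k2 + k3 + k4 + k5)"
  have r: "bidegree_le r K" "bidegree_le r N1" "bidegree_le r D1" "bidegree_le r N2" "bidegree_le r D2"
    using ks[THEN bidegree_le_mono, of r] by (auto simp: r_def)
  define s where "s = 3 * r"
  \<comment> \<open>With this choice \<open>(k + 1) ^ 3 = (s\<^sup>2 + 1) ^ 3\<close> exceeds \<open>(s * k + 1)\<^sup>2 = (s ^ 3 + 1)\<^sup>2\<close>.\<close>
  define k where "k = s\<^sup>2"
  define A where "A i j = N1 ^ i * D1 ^ (k - i) * (N2 ^ j * D2 ^ (k - j))" for i j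
  define E where "E = (\<lambda>(i, j, l). A i j * K ^ l)"
  have bd: "bidegree_le (s * k) (E (i, j, l))" if "i \<le> k" "j \<le> k" "l \<le> k" for i j l
  proof -
    have "bidegree_le ((r * i + r * (k - i)) + (r * j + r * (k - j)) + r * l) (E (i, j, l))"
      unfolding E_def A_def split by (intro bidegree_le_mult bidegree_le_power r)
    moreover have "(r * i + r * (k - i)) + (r * j + r * (k - j)) + r * l \<le> s * k"
    proof -
      have "r * i + r * (k - i) = r * k" "r * j + r * (k - j) = r * k"
        using that by (simp_all flip: distrib_left)
      moreover have "r * l \<le> r * k" using that by simp
      ultimately show ?thesis by (simp add: s_def)
    qed
    ultimately show ?thesis by (rule bidegree_le_mono)
  qed
  define X where "X = {..k} \<times> {..k} \<times> {..k}"
  define Y where "Y = {..s * k} \<times> {..s * k}"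
  have "card Y < card X"
  proof -
    have "s \<ge> 1" by (simp add: s_def r_def)
    then have "s ^ 3 \<le> s ^ 4" by (intro power_increasing) auto
    moreover have "(s * s\<^sup>2 + 1) * (s * s\<^sup>2 + 1) = s ^ 6 + 2 * s ^ 3 + 1"
      by (simp add: power2_eq_square power3_eq_cube eval_nat_numeral algebra_simps)
    moreover have "(s\<^sup>2 + 1) * ((s\<^sup>2 + 1) * (s\<^sup>2 + 1)) = s ^ 6 + 3 * s ^ 4 + 3 * s\<^sup>2 + 1"
      by (simp add: eval_nat_numeral algebra_simps)
    moreover have "s\<^sup>2 > 0" using \<open>s \<ge> 1\<close> by simp
    ultimately have "(s * s\<^sup>2 + 1) * (s * s\<^sup>2 + 1) < (s\<^sup>2 + 1) * ((s\<^sup>2 + 1) * (s\<^sup>2 + 1))" by linarith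
    then show ?thesis by (simp add: X_def Y_def card_cartesian_product k_def)
  qed
  then obtain h where h: "\<exists>x\<in>X. h x \<noteq> 0" "\<forall>y\<in>Y. (\<Sum>x\<in>X. h x * (case y of (\<alpha>, \<beta>) \<Rightarrow> coeff (coeff (E x) \<alpha>) \<beta>)) = 0"
    using underdetermined_system[of Y X "\<lambda>x y. case y of (\<alpha>, \<beta>) \<Rightarrow> coeff (coeff (E x) \<alpha>) \<beta>"]
    by (auto simp: X_def Y_def)
  have dep: "(\<Sum>x\<in>X. [:[:h x:]:] * E x) = 0"
  proof (intro poly_eqI)
    fix \<alpha> \<beta>
    have "coeff (coeff (\<Sum>x\<in>X. [:[:h x:]:] * E x) \<alpha>) \<beta> = (\<Sum>x\<in>X. h x * coeff (coeff (E x) \<alpha>) \<beta>)"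
      by (simp add: coeff_sum)
    also have "\<dots> = 0"
    proof (cases "\<alpha> \<le> s * k \<and> \<beta> \<le> s * k")
      case True
      then show ?thesis using h(2)[rule_format, of "(\<alpha>, \<beta>)"] by (simp add: Y_def)
    next
      case False
      have "coeff (coeff (E x) \<alpha>) \<beta> = 0" if x: "x \<in> X" for x
      proof -
        obtain i j l where [simp]: "x = (i, j, l)" by (metis prod.exhaust)
        have "degree (E x) \<le> s * k" "degree (coeff (E x) \<alpha>) \<le> s * k"
          using bd[of i j l] x by (auto simp: X_def bidegree_le_def)
        then show ?thesis using False by (metis coeff_0 coeff_eq_0 le_less_trans not_le)
      qed
      then show ?thesis by simp
    qed
    finally show "coeff (coeff (\<Sum>x\<in>X. [:[:h x:]:] * E x) \<alpha>) \<beta> = coeff (coeff 0 \<alpha>) \<beta>" by simp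
  qed
  define nz where "nz l \<longleftrightarrow> (\<exists>i\<le>k. \<exists>j\<le>k. l \<le> k \<and> h (i, j, l) \<noteq> 0)" for l
  \<comment> \<open>the smallest exponent of \<open>K\<close> that occurs in the relation\<close>
  define l0 where "l0 = (LEAST l. nz l)"
  have "\<exists>l. nz l" using h(1) by (auto simp: X_def nz_def)
  then have nz0: "nz l0" unfolding l0_def by (rule LeastI_ex)
  have below: "h (i, j, l) = 0" if "l < l0" "(i, j, l) \<in> X" for i j l
    using not_less_Least[of l nz] that unfolding l0_def[symmetric] by (auto simp: nz_def X_def)
  define R where "R = (\<Sum>(i, j, l)\<in>X. [:[:h (i, j, l):]:] * (A i j * K ^ (l - l0)))"
  have "K ^ l0 * R = (\<Sum>x\<in>X. [:[:h x:]:] * E x)"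
    unfolding R_def sum_distrib_left
  proof (intro sum.cong refl)
    fix x assume "x \<in> X"
    obtain i j l where x [simp]: "x = (i, j, l)" by (metis prod.exhaust)
    show "K ^ l0 * (case x of (i, j, l) \<Rightarrow> [:[:h (i, j, l):]:] * (A i j * K ^ (l - l0))) = [:[:h x:]:] * E x"
    proof (cases "l < l0")
      case True
      then show ?thesis using below \<open>x \<in> X\<close> by simp
    next
      case False
      then have "K ^ l0 * K ^ (l - l0) = K ^ l" by (simp flip: power_add)
      then show ?thesis unfolding x E_def split by (metis mult.assoc mult.left_commute)
    qed
  qed
  then have R0: "R = 0" using dep K by simp
  define H where "H = (\<Sum>i\<le>k. \<Sum>j\<le>k. monom (monom (monom (h (i, j, l0)) ((k - i) + (k - j))) j) i)"
  have coeffH: "coeff (coeff (coeff H i) j) e = (if i \<le> k \<and> j \<le> k \<and> e = (k - i) + (k - j) then h (i, j, l0) else 0)" for i j e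
  proof -
    have "coeff (coeff (coeff H i) j) e = (\<Sum>i'\<le>k. \<Sum>j'\<le>k. if i' = i then if j' = j then if e = (k - i) + (k - j) then h (i, j, l0) else 0 else 0 else 0)"
      unfolding H_def coeff_sum by (intro sum.cong refl) (auto simp: coeff_monom)
    also have "\<dots> = (\<Sum>i'\<le>k. if i' = i then \<Sum>j'\<le>k. if j' = j then if e = (k - i) + (k - j) then h (i, j, l0) else 0 else 0 else 0)"
      by (intro sum.cong refl) auto
    finally show ?thesis by (simp add: sum.delta)
  qed
  show ?thesis
  proof
    show "H \<noteq> 0" using nz0 coeffH by (metis coeff_0 nz_def)
    show "homogeneous (2 * k) H" by (auto simp: homogeneous_def coeffH split: if_splits)
    fix z w and y :: "complex ^ 3"
    assume 0: "eval2 K z w = 0" and D: "eval2 D1 z w \<noteq> 0" "eval2 D2 z w \<noteq> 0"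
      and y: "eval2 N1 z w * y $ 3 = y $ 1 * eval2 D1 z w" "eval2 N2 z w * y $ 3 = y $ 2 * eval2 D2 z w"
    define n1 d1 n2 d2 where "n1 = eval2 N1 z w" and "d1 = eval2 D1 z w" and "n2 = eval2 N2 z w" and "d2 = eval2 D2 z w"
    define B where "B i j = n1 ^ i * d1 ^ (k - i) * (n2 ^ j * d2 ^ (k - j))" for i j
    have "0 = eval2 R z w" using R0 by simp
    also have "\<dots> = (\<Sum>(i, j, l)\<in>X. h (i, j, l) * (B i j * 0 ^ (l - l0)))"
      unfolding R_def eval2_sum
      by (intro sum.cong refl) (auto simp: A_def B_def n1_def d1_def n2_def d2_def 0)
    also have "\<dots> = (\<Sum>(i, j, l)\<in>X. if l = l0 then h (i, j, l0) * B i j else 0)"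
    proof (intro sum.cong refl)
      fix x assume "x \<in> X"
      obtain i j l where x [simp]: "x = (i, j, l)" by (metis prod.exhaust)
      show "(case x of (i, j, l) \<Rightarrow> h (i, j, l) * (B i j * 0 ^ (l - l0))) = (case x of (i, j, l) \<Rightarrow> if l = l0 then h (i, j, l0) * B i j else 0)"
        using below[of l i j] \<open>x \<in> X\<close> by (cases l l0 rule: linorder_cases) auto
    qed
    also have "\<dots> = (\<Sum>i\<le>k. \<Sum>j\<le>k. h (i, j, l0) * B i j)"
    proof -
      have "l0 \<le> k" using nz0 by (auto simp: nz_def)
      then show ?thesis by (simp add: X_def sum.cartesian_product[symmetric] sum.delta)
    qed
    finally have S: "(\<Sum>i\<le>k. \<Sum>j\<le>k. h (i, j, l0) * B i j) = 0" by simp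
    have one: "d ^ k * (u ^ i * t ^ (k - i)) = t ^ k * (n ^ i * d ^ (k - i))" if "n * t = u * d" "i \<le> k" for n d u t :: complex and i
    proof -
      have "d ^ k = d ^ i * d ^ (k - i)" "t ^ k = t ^ i * t ^ (k - i)" using that(2) by (simp_all flip: power_add)
      moreover have "(n * t) ^ i = (u * d) ^ i" using that(1) by simp
      ultimately show ?thesis by (simp add: power_mult_distrib mult_ac)
    qed
    have "d1 ^ k * d2 ^ k * eval3 H y = (\<Sum>i\<le>k. \<Sum>j\<le>k. h (i, j, l0) * ((d1 ^ k * (y $ 1 ^ i * y $ 3 ^ (k - i))) * (d2 ^ k * (y $ 2 ^ j * y $ 3 ^ (k - j)))))"
      unfolding H_def eval3_setsum sum_distrib_left
      by (intro sum.cong refl) (simp only: eval3_monom power_add mult_ac)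
    also have "\<dots> = (\<Sum>i\<le>k. \<Sum>j\<le>k. (y $ 3 ^ k * y $ 3 ^ k) * (h (i, j, l0) * B i j))"
      using one[of n1 "y $ 3" "y $ 1" d1] one[of n2 "y $ 3" "y $ 2" d2] y
      by (intro sum.cong refl) (simp add: B_def n1_def d1_def n2_def d2_def mult_ac)
    also have "\<dots> = 0" using S by (simp flip: sum_distrib_left)
    finally show "eval3 H y = 0" using D by (simp add: d1_def d2_def)
  qed
qed

section \<open>Counting the points of a fibre\<close>

text \<open>
  The assumption \<open>proper\<close> is properness over the single value \<open>y0\<close>: points whose images converge to \<open>y0\<close> accumulate in
  \<open>S\<close>. An infinite fibre would accumulate at one of its own points, against local injectivity.
\<close>

lemma fibre_finite:
  fixes f :: "'a::euclidean_space \<Rightarrow> 'a"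
  assumes cont: "continuous_on S f" and S: "open S"
    and inj: "\<And>x. x \<in> S \<Longrightarrow> f x = y0 \<Longrightarrow> \<exists>U. open U \<and> x \<in> U \<and> U \<subseteq> S \<and> inj_on f U"
    and proper: "\<And>X. (\<And>k::nat. X k \<in> S) \<Longrightarrow> (\<lambda>k. f (X k)) \<longlonglongrightarrow> y0 \<Longrightarrow> \<exists>r l. strict_mono r \<and> l \<in> S \<and> (X \<circ> r) \<longlonglongrightarrow> l"
  shows "finite {x \<in> S. f x = y0}"
proof (rule ccontr)
  assume "infinite {x \<in> S. f x = y0}"
  then obtain X :: "nat \<Rightarrow> 'a" where X: "inj X" "range X \<subseteq> {x \<in> S. f x = y0}"
    using infinite_countable_subset by blast
  have "(\<lambda>k. f (X k)) \<longlonglongrightarrow> y0" using X by (auto simp: image_subset_iff)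
  then obtain r l where rl: "strict_mono r" "l \<in> S" "(X \<circ> r) \<longlonglongrightarrow> l"
    using proper[of X] X by (auto simp: image_subset_iff)
  have "isCont f l" using cont S rl(2) by (simp add: continuous_on_eq_continuous_at)
  then have "(\<lambda>k. f ((X \<circ> r) k)) \<longlonglongrightarrow> f l" using rl(3) by (rule isCont_tendsto_compose)
  then have "f l = y0" using X by (simp add: image_subset_iff LIMSEQ_const_iff)
  then obtain U where U: "open U" "l \<in> U" "U \<subseteq> S" "inj_on f U" using inj rl(2) by blast
  have "eventually (\<lambda>k. (X \<circ> r) k \<in> U) sequentially" using rl(3) U(1,2) by (rule topological_tendstoD)
  then obtain k where "\<And>j. j \<ge> k \<Longrightarrow> X (r j) \<in> U" by (auto simp: eventually_sequentially)
  then have "X (r k) \<in> U" "X (r (Suc k)) \<in> U" by simp_all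
  moreover have "f (X (r k)) = f (X (r (Suc k)))" using X(2) by (simp add: image_subset_iff)
  ultimately have "X (r k) = X (r (Suc k))" using U(4) by (meson inj_onD)
  then have "r k = r (Suc k)" using X(1) by (simp add: inj_eq)
  then show False using rl(1) by (simp add: strict_mono_eq)
qed

text \<open>
  Choose disjoint neighbourhoods of the finitely many preimages of \<open>y0\<close> on which \<open>f\<close> is injective. By invariance of domain their
  images are open, so a value near \<open>y0\<close> has exactly one preimage in each of them; by properness it has no other preimage.
\<close>

lemma fibre_card_locally_constant:
  fixes f :: "'a::euclidean_space \<Rightarrow> 'a"
  assumes cont: "continuous_on S f" and S: "open S"
    and inj: "\<And>x. x \<in> S \<Longrightarrow> f x = y0 \<Longrightarrow> \<exists>U. open U \<and> x \<in> U \<and> U \<subseteq> S \<and> inj_on f U"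
    and proper: "\<And>X. (\<And>k::nat. X k \<in> S) \<Longrightarrow> (\<lambda>k. f (X k)) \<longlonglongrightarrow> y0 \<Longrightarrow> \<exists>r l. strict_mono r \<and> l \<in> S \<and> (X \<circ> r) \<longlonglongrightarrow> l"
  shows "eventually (\<lambda>y. card {x \<in> S. f x = y} = card {x \<in> S. f x = y0}) (nhds y0)"
proof -
  define Z where "Z = {x \<in> S. f x = y0}"
  have fin: "finite Z" unfolding Z_def by (rule fibre_finite[OF assms])
  obtain e where e: "e > 0" "\<And>x y. x \<in> Z \<Longrightarrow> y \<in> Z \<Longrightarrow> x \<noteq> y \<Longrightarrow> e \<le> dist x y"
  proof -
    define M where "M = insert 1 ((\<lambda>(x, y). dist x y) ` {(x, y) \<in> Z \<times> Z. x \<noteq> y})"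
    have "finite {(x, y) \<in> Z \<times> Z. x \<noteq> y}" by (rule finite_subset[of _ "Z \<times> Z"]) (use fin in auto)
    then have M: "finite M" "M \<noteq> {}" unfolding M_def by simp_all
    show ?thesis
    proof (rule that[of "Min M"])
      show "Min M > 0" unfolding Min_gr_iff[OF M] by (auto simp: M_def)
      show "Min M \<le> dist x y" if "x \<in> Z" "y \<in> Z" "x \<noteq> y" for x y
        using that by (intro Min_le M) (auto simp: M_def image_iff)
    qed
  qed
  obtain U0 where U0: "\<And>x. x \<in> Z \<Longrightarrow> open (U0 x) \<and> x \<in> U0 x \<and> U0 x \<subseteq> S \<and> inj_on f (U0 x)"
    using inj unfolding Z_def by simp metis
  define U where "U x = U0 x \<inter> ball x (e / 2)" for x
  have U: "open (U x)" "x \<in> U x" "U x \<subseteq> S" "inj_on f (U x)" if "x \<in> Z" for x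
    using U0[OF that] e(1) by (auto simp: U_def intro: inj_on_subset)
  have disj: "x = y" if "x \<in> Z" "y \<in> Z" "u \<in> U x" "u \<in> U y" for x y u
  proof (rule ccontr)
    assume "x \<noteq> y"
    have "dist x y \<le> dist x u + dist y u" by (metis dist_commute dist_triangle)
    also have "\<dots> < e" using that by (simp add: U_def)
    finally show False using e(2) that \<open>x \<noteq> y\<close> by fastforce
  qed
  have ev1: "eventually (\<lambda>y. \<forall>x\<in>Z. y \<in> f ` U x) (nhds y0)"
  proof (intro eventually_ball_finite fin ballI)
    fix x assume x: "x \<in> Z"
    have "open (f ` U x)"
      using U[OF x] cont by (intro invariance_of_domain) (auto intro: continuous_on_subset)
    moreover have "y0 \<in> f ` U x" using U[OF x] x by (auto simp: Z_def)
    ultimately show "eventually (\<lambda>y. y \<in> f ` U x) (nhds y0)" by (rule eventually_nhds_in_open)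
  qed
  have ev2: "eventually (\<lambda>y. \<forall>u\<in>S. f u = y \<longrightarrow> (\<exists>x\<in>Z. u \<in> U x)) (nhds y0)"
  proof (rule ccontr)
    assume neg: "\<not> ?thesis"
    have "\<exists>u\<in>S. dist (f u) y0 < inverse (real (Suc k)) \<and> (\<forall>x\<in>Z. u \<notin> U x)" for k
      using neg unfolding eventually_nhds_metric by (metis inverse_positive_iff_positive of_nat_0_less_iff zero_less_Suc)
    then obtain X where X: "\<And>k. X k \<in> S" "\<And>k. dist (f (X k)) y0 < inverse (real (Suc k))" "\<And>k x. x \<in> Z \<Longrightarrow> X k \<notin> U x"
      by metis
    have "(\<lambda>k. dist (f (X k)) y0) \<longlonglongrightarrow> 0"
      by (rule tendsto_sandwich[OF _ _ tendsto_const LIMSEQ_inverse_real_of_nat])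
        (use X(2) in \<open>auto intro!: always_eventually less_imp_le\<close>)
    then have lim: "(\<lambda>k. f (X k)) \<longlonglongrightarrow> y0" by (subst tendsto_dist_iff)
    then obtain r l where rl: "strict_mono r" "l \<in> S" "(X \<circ> r) \<longlonglongrightarrow> l"
      using proper[OF X(1) lim] by blast
    have "isCont f l" using cont S rl(2) by (simp add: continuous_on_eq_continuous_at)
    then have "(\<lambda>k. f ((X \<circ> r) k)) \<longlonglongrightarrow> f l" using rl(3) by (rule isCont_tendsto_compose)
    moreover have "(\<lambda>k. f ((X \<circ> r) k)) \<longlonglongrightarrow> y0"
      using LIMSEQ_subseq_LIMSEQ[OF lim rl(1)] by (simp add: o_def)
    ultimately have "l \<in> Z" using rl(2) by (auto simp: Z_def intro: LIMSEQ_unique)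
    then have "eventually (\<lambda>k. (X \<circ> r) k \<in> U l) sequentially"
      using topological_tendstoD[OF rl(3) U(1,2)] by simp
    then obtain k where "X (r k) \<in> U l" by (auto simp: eventually_sequentially)
    then show False using X(3) \<open>l \<in> Z\<close> by blast
  qed
  show ?thesis
    using ev1 ev2
  proof eventually_elim
    case (elim y)
    have "\<forall>x\<in>Z. \<exists>u. u \<in> U x \<and> f u = y" using elim(1) by auto
    then obtain \<phi> where \<phi>: "\<And>x. x \<in> Z \<Longrightarrow> \<phi> x \<in> U x \<and> f (\<phi> x) = y"
      using bchoice[of Z "\<lambda>x u. u \<in> U x \<and> f u = y"] by auto
    have "bij_betw \<phi> Z {x \<in> S. f x = y}"
      unfolding bij_betw_def
    proof
      show "inj_on \<phi> Z"
      proof (rule inj_onI)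
        fix x x' assume "x \<in> Z" "x' \<in> Z" "\<phi> x = \<phi> x'"
        then show "x = x'" using disj[of x x' "\<phi> x"] \<phi>[of x] \<phi>[of x'] by simp
      qed
      show "\<phi> ` Z = {x \<in> S. f x = y}"
      proof (intro equalityI subsetI)
        fix u assume "u \<in> {x \<in> S. f x = y}"
        then obtain x where x: "x \<in> Z" "u \<in> U x" "f u = y" using elim(2) by auto
        then have "\<phi> x = u" using \<phi>[OF x(1)] U(4)[OF x(1)] by (auto dest: inj_onD)
        then show "u \<in> \<phi> ` Z" using x by blast
      qed (use \<phi> U(3) in \<open>fastforce\<close>)
    qed
    then show ?case by (simp add: bij_betw_same_card Z_def)
  qed
qed

section \<open>Local injectivity\<close>

text \<open>
  Difference quotients extend continuously to the diagonal. They serve instead of derivatives in the proof of local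
  injectivity.
\<close>

lemma poly_difference_quotient:
  fixes P :: "complex poly"
  obtains g where "continuous_on UNIV (\<lambda>(x, y). g x y)"
    "\<And>x y. poly P x - poly P y = (x - y) * g x y" "\<And>x. g x x = poly (pderiv P) x"
proof (induction P arbitrary: thesis)
  case 0
  show ?case by (rule 0[of "\<lambda>_ _. 0"]) auto
next
  case (pCons c P)
  obtain g where g: "continuous_on UNIV (\<lambda>(x, y). g x y)"
    "\<And>x y. poly P x - poly P y = (x - y) * g x y" "\<And>x. g x x = poly (pderiv P) x"
    using pCons.IH by blast
  show ?case
  proof (rule pCons.prems[of "\<lambda>x y. poly P x + y * g x y"])
    show "continuous_on UNIV (\<lambda>(x, y). poly P x + y * g x y)"
      using g(1) by (auto simp: case_prod_beta intro!: continuous_intros)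
    show "poly (pCons c P) x - poly (pCons c P) y = (x - y) * (poly P x + y * g x y)" for x y
      using arg_cong[OF g(2)[of x y], of "\<lambda>t. y * t"] by (simp add: algebra_simps)
    show "poly P x + x * g x x = poly (pderiv (pCons c P)) x" for x
      by (simp add: g(3) pderiv_pCons)
  qed
qed

definition wronskian :: "complex poly \<Rightarrow> complex poly \<Rightarrow> complex poly" where
  "wronskian P Q = pderiv P * Q - P * pderiv Q"

lemma quotient_difference_quotient:
  fixes P Q :: "complex poly"
  obtains g where "continuous_on ({x. poly Q x \<noteq> 0} \<times> {x. poly Q x \<noteq> 0}) (\<lambda>(x, y). g x y)"
    "\<And>x y. poly Q x \<noteq> 0 \<Longrightarrow> poly Q y \<noteq> 0 \<Longrightarrow> poly P x / poly Q x - poly P y / poly Q y = (x - y) * g x y"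
    "\<And>x. g x x = poly (wronskian P Q) x / (poly Q x)\<^sup>2"
proof -
  obtain g where g: "continuous_on UNIV (\<lambda>(x, y). g x y)"
    "\<And>x y. poly P x - poly P y = (x - y) * g x y" "\<And>x. g x x = poly (pderiv P) x"
    using poly_difference_quotient[where P = P] by blast
  obtain h where h: "continuous_on UNIV (\<lambda>(x, y). h x y)"
    "\<And>x y. poly Q x - poly Q y = (x - y) * h x y" "\<And>x. h x x = poly (pderiv Q) x"
    using poly_difference_quotient[where P = Q] by blast
  show ?thesis
  proof (rule that[of "\<lambda>x y. (g x y * poly Q y - poly P y * h x y) / (poly Q x * poly Q y)"])
    show "continuous_on ({x. poly Q x \<noteq> 0} \<times> {x. poly Q x \<noteq> 0})
       (\<lambda>(x, y). (g x y * poly Q y - poly P y * h x y) / (poly Q x * poly Q y))"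
      using continuous_on_subset[OF g(1) subset_UNIV, of "{x. poly Q x \<noteq> 0} \<times> {x. poly Q x \<noteq> 0}"]
        continuous_on_subset[OF h(1) subset_UNIV, of "{x. poly Q x \<noteq> 0} \<times> {x. poly Q x \<noteq> 0}"]
      by (auto simp: case_prod_beta intro!: continuous_intros)
    fix x y assume nz: "poly Q x \<noteq> 0" "poly Q y \<noteq> 0"
    have "poly P x * poly Q y - poly P y * poly Q x = (poly P x - poly P y) * poly Q y - poly P y * (poly Q x - poly Q y)"
      by (simp add: algebra_simps)
    also have "\<dots> = (x - y) * (g x y * poly Q y - poly P y * h x y)"
      unfolding g h by (simp add: algebra_simps)
    finally show "poly P x / poly Q x - poly P y / poly Q y
        = (x - y) * ((g x y * poly Q y - poly P y * h x y) / (poly Q x * poly Q y))"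
      using nz by (simp add: diff_frac_eq)
  qed (simp add: g h wronskian_def power2_eq_square)
qed

text \<open>
  The Jacobian determinant of \<open>(z, w) \<mapsto> (P1 Q1 / (P1' Q1'), P2 Q2 / (P2' Q2'))\<close>, where the \<open>P\<close> are evaluated
  at \<open>z\<close> and the \<open>Q\<close> at \<open>w\<close>, multiplied by the square of all denominators. The Wronskians are the numerators of
  the derivatives of the quotients.
\<close>

definition jacobian_num ::
  "complex poly \<Rightarrow> complex poly \<Rightarrow> complex poly \<Rightarrow> complex poly \<Rightarrow> complex poly \<Rightarrow> complex poly \<Rightarrow> complex poly \<Rightarrow> complex poly
    \<Rightarrow> complex \<Rightarrow> complex \<Rightarrow> complex" where
  "jacobian_num P1 P1' Q1 Q1' P2 P2' Q2 Q2' z w =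
     poly (wronskian P1 P1' * P2 * P2') z * poly (Q1 * Q1' * wronskian Q2 Q2') w
   - poly (P1 * P1' * wronskian P2 P2') z * poly (wronskian Q1 Q1' * Q2 * Q2') w"

text \<open>
  For two points with the same image, the differences of their coordinates solve a homogeneous linear system whose coefficients are
  difference quotients. Its determinant is continuous and on the diagonal is a nonzero multiple of the
  Jacobian numerator, so for points close to \<open>(z0, w0)\<close> the differences are zero.
\<close>

lemma locally_injective:
  fixes P1 P1' Q1 Q1' P2 P2' Q2 Q2' :: "complex poly"
  defines "S \<equiv> {z. poly P1' z \<noteq> 0 \<and> poly P2' z \<noteq> 0} \<times> {w. poly Q1' w \<noteq> 0 \<and> poly Q2' w \<noteq> 0}"
  assumes x0: "(z0, w0) \<in> S" and jac: "jacobian_num P1 P1' Q1 Q1' P2 P2' Q2 Q2' z0 w0 \<noteq> 0"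
  shows "\<exists>U. open U \<and> (z0, w0) \<in> U \<and> U \<subseteq> S \<and>
    inj_on (\<lambda>(z, w). ((poly P1 z / poly P1' z) * (poly Q1 w / poly Q1' w), (poly P2 z / poly P2' z) * (poly Q2 w / poly Q2' w))) U"
proof -
  let ?D = "\<lambda>Q::complex poly. {x. poly Q x \<noteq> 0}"
  obtain g1 where g1: "continuous_on (?D P1' \<times> ?D P1') (\<lambda>(x, y). g1 x y)"
    "\<And>x y. poly P1' x \<noteq> 0 \<Longrightarrow> poly P1' y \<noteq> 0 \<Longrightarrow> poly P1 x / poly P1' x - poly P1 y / poly P1' y = (x - y) * g1 x y"
    "\<And>x. g1 x x = poly (wronskian P1 P1') x / (poly P1' x)\<^sup>2" using quotient_difference_quotient[where P = P1 and Q = P1'] by blast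
  obtain g2 where g2: "continuous_on (?D P2' \<times> ?D P2') (\<lambda>(x, y). g2 x y)"
    "\<And>x y. poly P2' x \<noteq> 0 \<Longrightarrow> poly P2' y \<noteq> 0 \<Longrightarrow> poly P2 x / poly P2' x - poly P2 y / poly P2' y = (x - y) * g2 x y"
    "\<And>x. g2 x x = poly (wronskian P2 P2') x / (poly P2' x)\<^sup>2" using quotient_difference_quotient[where P = P2 and Q = P2'] by blast
  obtain h1 where h1: "continuous_on (?D Q1' \<times> ?D Q1') (\<lambda>(x, y). h1 x y)"
    "\<And>x y. poly Q1' x \<noteq> 0 \<Longrightarrow> poly Q1' y \<noteq> 0 \<Longrightarrow> poly Q1 x / poly Q1' x - poly Q1 y / poly Q1' y = (x - y) * h1 x y"
    "\<And>x. h1 x x = poly (wronskian Q1 Q1') x / (poly Q1' x)\<^sup>2" using quotient_difference_quotient[where P = Q1 and Q = Q1'] by blast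
  obtain h2 where h2: "continuous_on (?D Q2' \<times> ?D Q2') (\<lambda>(x, y). h2 x y)"
    "\<And>x y. poly Q2' x \<noteq> 0 \<Longrightarrow> poly Q2' y \<noteq> 0 \<Longrightarrow> poly Q2 x / poly Q2' x - poly Q2 y / poly Q2' y = (x - y) * h2 x y"
    "\<And>x. h2 x x = poly (wronskian Q2 Q2') x / (poly Q2' x)\<^sup>2" using quotient_difference_quotient[where P = Q2 and Q = Q2'] by blast
  define A1 where "A1 z = poly P1 z / poly P1' z" for z
  define A2 where "A2 z = poly P2 z / poly P2' z" for z
  define B1 where "B1 z = poly Q1 z / poly Q1' z" for z
  define B2 where "B2 z = poly Q2 z / poly Q2' z" for z
  \<comment> \<open>the determinant of the linear system\<close>
  define \<delta> where "\<delta> = (\<lambda>x. case x of ((z, w), (z', w')) \<Rightarrow>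
     g1 z z' * B1 w * (A2 z' * h2 w w') - A1 z' * h1 w w' * (g2 z z' * B2 w))"
  have openD: "open (?D Q)" for Q :: "complex poly"
    by (intro open_Collect_neq continuous_intros)
  have S: "S = (?D P1' \<inter> ?D P2') \<times> (?D Q1' \<inter> ?D Q2')" by (auto simp: S_def)
  have openS: "open S" unfolding S by (intro open_Times open_Int openD)
  have cg: "continuous_on (S \<times> S) (\<lambda>x. g (fst (fst x)) (fst (snd x)))"
    if "continuous_on (?D Q \<times> ?D Q) (\<lambda>(x, y). g x y)" "Q = P1' \<or> Q = P2'" for g and Q
    using that(2)
    by (intro continuous_on_compose2[OF that(1), of _ "\<lambda>x. (fst (fst x), fst (snd x))", simplified case_prod_beta fst_conv snd_conv])
      (auto simp: S_def intro!: continuous_intros)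
  have ch: "continuous_on (S \<times> S) (\<lambda>x. g (snd (fst x)) (snd (snd x)))"
    if "continuous_on (?D Q \<times> ?D Q) (\<lambda>(x, y). g x y)" "Q = Q1' \<or> Q = Q2'" for g and Q
    using that(2)
    by (intro continuous_on_compose2[OF that(1), of _ "\<lambda>x. (snd (fst x), snd (snd x))", simplified case_prod_beta fst_conv snd_conv])
      (auto simp: S_def intro!: continuous_intros)
  have "continuous_on (S \<times> S) \<delta>"
    unfolding \<delta>_def case_prod_beta A1_def A2_def B1_def B2_def
    by (intro continuous_intros cg[OF g1(1)] cg[OF g2(1)] ch[OF h1(1)] ch[OF h2(1)]) (auto simp: S_def)
  then have "open (S \<times> S \<inter> \<delta> -` (- {0}))"
    by (intro continuous_open_preimage open_Times openS) auto
  moreover have "((z0, w0), (z0, w0)) \<in> S \<times> S \<inter> \<delta> -` (- {0})"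
  proof -
    have nz: "poly P1' z0 \<noteq> 0" "poly P2' z0 \<noteq> 0" "poly Q1' w0 \<noteq> 0" "poly Q2' w0 \<noteq> 0" using x0 by (auto simp: S_def)
    have "\<delta> ((z0, w0), (z0, w0)) * (poly P1' z0 * poly P2' z0 * poly Q1' w0 * poly Q2' w0)\<^sup>2 = jacobian_num P1 P1' Q1 Q1' P2 P2' Q2 Q2' z0 w0"
      using nz unfolding \<delta>_def jacobian_num_def
      by (simp add: g1(3) g2(3) h1(3) h2(3) A1_def A2_def B1_def B2_def field_simps power2_eq_square)
    then show ?thesis using jac x0 by auto
  qed
  ultimately obtain V W where "open V" "open W" "((z0, w0), (z0, w0)) \<in> V \<times> W" "V \<times> W \<subseteq> S \<times> S \<inter> \<delta> -` (- {0})"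
    by (rule open_prod_elim)
  then have VW: "open V" "open W" "(z0, w0) \<in> V" "(z0, w0) \<in> W" "V \<times> W \<subseteq> S \<times> S \<inter> \<delta> -` (- {0})" by simp_all
  show ?thesis
  proof (intro exI[of _ "V \<inter> W"] conjI)
    show "open (V \<inter> W)" "(z0, w0) \<in> V \<inter> W" using VW by auto
    show "V \<inter> W \<subseteq> S" using VW by auto
    show "inj_on (\<lambda>(z, w). ((poly P1 z / poly P1' z) * (poly Q1 w / poly Q1' w), (poly P2 z / poly P2' z) * (poly Q2 w / poly Q2' w))) (V \<inter> W)"
      unfolding A1_def[symmetric] A2_def[symmetric] B1_def[symmetric] B2_def[symmetric]
    proof (rule inj_onI, clarify)
      fix z w z' w'
      assume U: "(z, w) \<in> V" "(z, w) \<in> W" "(z', w') \<in> V" "(z', w') \<in> W"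
        and eq: "A1 z * B1 w = A1 z' * B1 w'" "A2 z * B2 w = A2 z' * B2 w'"
      have mem: "((z, w), (z', w')) \<in> S \<times> S" and d: "\<delta> ((z, w), (z', w')) \<noteq> 0" using U VW(5) by auto
      have q: "A1 z - A1 z' = (z - z') * g1 z z'" "A2 z - A2 z' = (z - z') * g2 z z'"
        "B1 w - B1 w' = (w - w') * h1 w w'" "B2 w - B2 w' = (w - w') * h2 w w'"
        using mem g1(2) g2(2) h1(2) h2(2) by (auto simp: S_def A1_def A2_def B1_def B2_def)
      have "0 = (A1 z - A1 z') * B1 w + A1 z' * (B1 w - B1 w')" using eq by (simp add: algebra_simps)
      then have 1: "(z - z') * (g1 z z' * B1 w) + (w - w') * (A1 z' * h1 w w') = 0" unfolding q by (simp add: mult_ac)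
      have "0 = (A2 z - A2 z') * B2 w + A2 z' * (B2 w - B2 w')" using eq by (simp add: algebra_simps)
      then have 2: "(z - z') * (g2 z z' * B2 w) + (w - w') * (A2 z' * h2 w w') = 0" unfolding q by (simp add: mult_ac)
      have cramer: "x * (\<alpha> * \<delta>' - \<beta> * \<gamma>) = 0 \<and> y * (\<alpha> * \<delta>' - \<beta> * \<gamma>) = 0" if "x * \<alpha> + y * \<beta> = 0" "x * \<gamma> + y * \<delta>' = 0"
        for x y \<alpha> \<beta> \<gamma> \<delta>' :: complex
        using that by algebra
      from cramer[OF 1 2] d show "z = z' \<and> w = w'" by (simp add: \<delta>_def)
    qed
  qed
qed

section \<open>Thin sets\<close>

text \<open>
  Cones over subsets of proper algebraic subsets of the projective plane. A property is generic if its failures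
  form a thin set.
\<close>

definition thin :: "(complex ^ 3) set \<Rightarrow> bool" where
  "thin T \<longleftrightarrow> (\<exists>H d. H \<noteq> 0 \<and> homogeneous d H \<and> (\<forall>y\<in>T. eval3 H y = 0))"

lemma thin_empty: "thin {}"
  using homogeneous_const3[of 1] unfolding thin_def by (intro exI[of _ "const3 1"] exI[of _ 0]) (auto simp: const3_def)

lemma thin_subset: "thin T \<Longrightarrow> S \<subseteq> T \<Longrightarrow> thin S"
  unfolding thin_def by blast

lemma thin_Un: "thin S \<Longrightarrow> thin T \<Longrightarrow> thin (S \<union> T)"
proof -
  assume "thin S" "thin T"
  then obtain H d H' d' where "H \<noteq> 0" "homogeneous d H" "\<forall>y\<in>S. eval3 H y = 0"
    "H' \<noteq> 0" "homogeneous d' H'" "\<forall>y\<in>T. eval3 H' y = 0" unfolding thin_def by blast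
  then show ?thesis unfolding thin_def
    by (intro exI[of _ "H * H'"] exI[of _ "d + d'"]) (auto simp: homogeneous_mult)
qed

lemma thin_UN: "finite I \<Longrightarrow> (\<And>i. i \<in> I \<Longrightarrow> thin (T i)) \<Longrightarrow> thin (\<Union>i\<in>I. T i)"
  by (induction I rule: finite_induct) (auto intro: thin_empty thin_Un)

lemma thin_linear:
  assumes "\<alpha> \<noteq> 0 \<or> \<beta> \<noteq> 0 \<or> \<gamma> \<noteq> 0"
  shows "thin {y. \<alpha> * y $ 1 + \<beta> * y $ 2 + \<gamma> * y $ 3 = 0}"
proof -
  define H where "H = const3 \<alpha> * varZ + const3 \<beta> * varW + const3 \<gamma> * varT"
  have ev: "eval3 H y = \<alpha> * y $ 1 + \<beta> * y $ 2 + \<gamma> * y $ 3" for y by (simp add: H_def)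
  have "homogeneous 1 H" unfolding homogeneous_iff_eval_double by (simp add: ev algebra_simps)
  moreover have "H \<noteq> 0"
  proof
    assume "H = 0"
    then have "\<alpha> * y $ 1 + \<beta> * y $ 2 + \<gamma> * y $ 3 = 0" for y :: "complex ^ 3" using ev by (metis eval3_0)
    from this[of "axis 1 1"] this[of "axis 2 1"] this[of "axis 3 1"] assms show False
      by (simp add: axis_def)
  qed
  ultimately show ?thesis unfolding thin_def using ev by auto
qed

lemma thin_curve_image:
  assumes "K \<noteq> 0"
  shows "thin {y. \<exists>z w. eval2 K z w = 0 \<and> eval2 D1 z w \<noteq> 0 \<and> eval2 D2 z w \<noteq> 0 \<and>
       eval2 N1 z w * y $ 3 = y $ 1 * eval2 D1 z w \<and> eval2 N2 z w * y $ 3 = y $ 2 * eval2 D2 z w}"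
proof -
  obtain H d where "H \<noteq> 0" "homogeneous d H"
    "\<And>z w y. \<lbrakk>eval2 K z w = 0; eval2 D1 z w \<noteq> 0; eval2 D2 z w \<noteq> 0;
       eval2 N1 z w * y $ 3 = y $ 1 * eval2 D1 z w; eval2 N2 z w * y $ 3 = y $ 2 * eval2 D2 z w\<rbrakk>
       \<Longrightarrow> eval3 H y = 0"
    using curve_image_algebraic[OF assms] by blast
  then show ?thesis unfolding thin_def by (intro exI[of _ H] exI[of _ d]) auto
qed

lemma thin_rational_curve:
  fixes N1 D1 N2 D2 :: "complex poly"
  shows "thin {y. \<exists>w. poly D1 w \<noteq> 0 \<and> poly D2 w \<noteq> 0 \<and>
       poly N1 w * y $ 3 = y $ 1 * poly D1 w \<and> poly N2 w * y $ 3 = y $ 2 * poly D2 w}"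
\<comment> \<open>the line \<open>z = 0\<close>, with functions that depend on \<open>w\<close> only\<close>
proof (rule thin_subset[OF thin_curve_image[of "[:0, 1:]" "[:D1:]" "[:D2:]" "[:N1:]" "[:N2:]"]])
  show "{y. \<exists>w. poly D1 w \<noteq> 0 \<and> poly D2 w \<noteq> 0 \<and> poly N1 w * y $ 3 = y $ 1 * poly D1 w \<and> poly N2 w * y $ 3 = y $ 2 * poly D2 w}
    \<subseteq> {y. \<exists>z w. eval2 [:0, 1:] z w = 0 \<and> eval2 [:D1:] z w \<noteq> 0 \<and> eval2 [:D2:] z w \<noteq> 0 \<and>
        eval2 [:N1:] z w * y $ 3 = y $ 1 * eval2 [:D1:] z w \<and> eval2 [:N2:] z w * y $ 3 = y $ 2 * eval2 [:D2:] z w}"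
    by (auto simp: eval2_def intro!: exI[of _ 0])
qed simp

section \<open>Numerators and denominators of the one-variable factors\<close>

text \<open>
  Numerator and denominator of a Blaschke product in one variable, in homogeneous coordinates \<open>[x : x']\<close> on the
  projective line. The point at infinity is treated like any other point.
\<close>

definition zfac :: "(nat \<Rightarrow> complex) \<Rightarrow> nat \<Rightarrow> complex \<Rightarrow> complex \<Rightarrow> complex" where
  "zfac a m x x' = (\<Prod>i<m. x - a i * x')"

definition pfac :: "(nat \<Rightarrow> complex) \<Rightarrow> nat \<Rightarrow> complex \<Rightarrow> complex \<Rightarrow> complex" where
  "pfac a m x x' = (\<Prod>i<m. x' - cnj (a i) * x)"

lemma zfac_scale: "zfac a m (t * x) (t * x') = t ^ m * zfac a m x x'"
  and pfac_scale: "pfac a m (t * x) (t * x') = t ^ m * pfac a m x x'"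
proof -
  have "t * x - a i * (t * x') = t * (x - a i * x')" "t * x' - cnj (a i) * (t * x) = t * (x' - cnj (a i) * x)" for i
    by (simp_all add: algebra_simps)
  then show "zfac a m (t * x) (t * x') = t ^ m * zfac a m x x'" "pfac a m (t * x) (t * x') = t ^ m * pfac a m x x'"
    by (simp_all add: zfac_def pfac_def prod.distrib)
qed

lemma zfac_eq_0_iff: "zfac a m x x' = 0 \<longleftrightarrow> (\<exists>i<m. x = a i * x')"
  and pfac_eq_0_iff: "pfac a m x x' = 0 \<longleftrightarrow> (\<exists>i<m. x' = cnj (a i) * x)"
  by (auto simp: zfac_def pfac_def)

lemma norm_mult_less_1: "norm x < 1 \<Longrightarrow> norm y < 1 \<Longrightarrow> norm (x * y :: complex) < 1"
  unfolding norm_mult by (metis mult_le_one less_eq_real_def mult_less_cancel_right2 norm_ge_zero order_le_less_trans mult_strict_mono' mult_1)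

lemma pfac_zero_nonzero:
  assumes "\<And>i. i < m \<Longrightarrow> norm (a i) < 1" "norm z < 1" "x' \<noteq> 0"
  shows "pfac a m (z * x') x' \<noteq> 0"
proof -
  have "x' \<noteq> cnj (a i) * (z * x')" if "i < m" for i
  proof
    assume "x' = cnj (a i) * (z * x')"
    then have "cnj (a i) * z = 1" using assms(3) by simp
    then show False using norm_mult_less_1[of "cnj (a i)" z] assms that by simp
  qed
  then show ?thesis by (auto simp: pfac_eq_0_iff)
qed

lemma zfac_pole_nonzero:
  assumes "\<And>i. i < m \<Longrightarrow> norm (a i) < 1" "norm z < 1" "x \<noteq> 0"
  shows "zfac a m x (cnj z * x) \<noteq> 0"
proof -
  have "x \<noteq> a i * (cnj z * x)" if "i < m" for i
  proof
    assume "x = a i * (cnj z * x)"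
    then have "a i * cnj z = 1" using assms(3) by simp
    then show False using norm_mult_less_1[of "a i" "cnj z"] assms that by simp
  qed
  then show ?thesis by (auto simp: zfac_eq_0_iff)
qed

definition zpoly :: "(nat \<Rightarrow> complex) \<Rightarrow> nat \<Rightarrow> complex poly" where
  "zpoly a m = (\<Prod>i<m. [:- a i, 1:])"

definition ppoly :: "(nat \<Rightarrow> complex) \<Rightarrow> nat \<Rightarrow> complex poly" where
  "ppoly a m = (\<Prod>i<m. [:1, - cnj (a i):])"

lemma poly_zpoly: "poly (zpoly a m) z = zfac a m z 1" and poly_ppoly: "poly (ppoly a m) z = pfac a m z 1"
  by (simp_all add: zpoly_def ppoly_def zfac_def pfac_def poly_prod mult.commute)

lemma zfac_affine: "x' \<noteq> 0 \<Longrightarrow> zfac a m x x' = x' ^ m * zfac a m (x / x') 1"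
  and pfac_affine: "x' \<noteq> 0 \<Longrightarrow> pfac a m x x' = x' ^ m * pfac a m (x / x') 1"
  using zfac_scale[of a m x' "x / x'" 1] pfac_scale[of a m x' "x / x'" 1] by simp_all

lemma pderiv_zpoly_nonzero:
  assumes "inj_on a {..<m}" "i < m"
  shows "poly (pderiv (zpoly a m)) (a i) \<noteq> 0"
proof -
  define R where "R = (\<Prod>j\<in>{..<m} - {i}. [:- a j, 1:])"
  have "zpoly a m = [:- a i, 1:] * R"
    unfolding zpoly_def R_def using assms(2) by (intro prod.remove) auto
  then have "poly (pderiv (zpoly a m)) (a i) = poly ([:- a i, 1:] * pderiv R + R * pderiv [:- a i, 1:]) (a i)"
    by (simp only: pderiv_mult)
  also have "\<dots> = poly R (a i)" unfolding poly_add poly_mult by (simp add: pderiv_pCons)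
  also have "\<dots> = (\<Prod>j\<in>{..<m} - {i}. a i - a j)" by (simp add: R_def poly_prod)
  also have "\<dots> \<noteq> 0" using assms by (auto dest: inj_onD)
  finally show ?thesis .
qed

text \<open>
  A point where numerator and denominator of one component vanish together lies on the curve of that component for every value. There
  are finitely many such points: one coordinate is a zero, the other one a pole. Since the zeros of the two components are disjoint,
  the numerator of the other component is nonzero there, so the curve of the other component passes through the point only for values on a line.
  The index \<open>\<alpha>\<close> is the coordinate of the value that belongs to the other component.
\<close>

lemma thin_indeterminate:
  fixes a b c d :: "nat \<Rightarrow> complex" and m n p q :: nat and \<theta> :: complex and \<alpha> :: 3
  assumes norm: "\<And>i. i < m \<Longrightarrow> norm (a i) < 1" "\<And>i. i < n \<Longrightarrow> norm (b i) < 1"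
    "\<And>i. i < p \<Longrightarrow> norm (c i) < 1" "\<And>i. i < q \<Longrightarrow> norm (d i) < 1"
    and disj: "a ` {..<m} \<inter> c ` {..<p} = {}" "b ` {..<n} \<inter> d ` {..<q} = {}"
    and \<theta>: "\<theta> \<noteq> 0" and \<alpha>: "\<alpha> = 1 \<or> \<alpha> = 2"
  shows "thin {y. y $ 3 \<noteq> 0 \<and> (\<exists>X X' Y Y'. (X, X') \<noteq> (0, 0) \<and> (Y, Y') \<noteq> (0, 0) \<and> pfac a m X X' * pfac b n Y Y' = 0 \<and>
     zfac a m X X' * zfac b n Y Y' = 0 \<and> \<theta> * (zfac c p X X' * zfac d q Y Y') * y $ 3 = y $ \<alpha> * (pfac c p X X' * pfac d q Y Y'))}" (is "thin ?T")
proof -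
  define L where "L x x' y y' = {v :: complex ^ 3. (- (pfac c p x x' * pfac d q y y')) * v $ \<alpha> + \<theta> * (zfac c p x x' * zfac d q y y') * v $ 3 = 0}"
    for x x' y y'
  have nz: "zfac c p (a i) 1 \<noteq> 0" if "i < m" for i using disj(1) that by (auto simp: zfac_eq_0_iff)
  have nz': "zfac d q (b j) 1 \<noteq> 0" if "j < n" for j using disj(2) that by (auto simp: zfac_eq_0_iff)
  have thinL: "thin (L x x' y y')" if "zfac c p x x' \<noteq> 0" "zfac d q y y' \<noteq> 0" for x x' y y'
  proof -
    define \<beta> \<gamma> where "\<beta> = - (pfac c p x x' * pfac d q y y')" and "\<gamma> = \<theta> * (zfac c p x x' * zfac d q y y')"
    have "\<gamma> \<noteq> 0" using that \<theta> by (simp add: \<gamma>_def)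
    then have "thin {v. \<beta> * v $ \<alpha> + \<gamma> * v $ 3 = 0}"
      using \<alpha> thin_linear[of \<beta> 0 \<gamma>] thin_linear[of 0 \<beta> \<gamma>] by auto
    then show ?thesis by (simp add: L_def \<beta>_def \<gamma>_def)
  qed
  have thinL1: "thin (L 1 (cnj (a i)) (b j) 1)" if "i < m" "j < n" for i j
    using zfac_pole_nonzero[of p c "a i" 1] nz'[OF that(2)] norm that by (intro thinL) simp_all
  have thinL2: "thin (L (a i) 1 1 (cnj (b j)))" if "i < m" "j < n" for i j
    using zfac_pole_nonzero[of q d "b j" 1] nz[OF that(1)] norm that by (intro thinL) simp_all
  have "thin (\<Union>i<m. \<Union>j<n. L 1 (cnj (a i)) (b j) 1 \<union> L (a i) 1 1 (cnj (b j)))"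
    by (intro thin_UN thin_Un thinL1 thinL2) auto
  then show ?thesis
  proof (rule thin_subset, intro subsetI)
    fix v assume "v \<in> ?T"
    then obtain X X' Y Y' where v3: "v $ 3 \<noteq> 0" and X: "(X, X') \<noteq> (0, 0)" and Y: "(Y, Y') \<noteq> (0, 0)"
      and den: "pfac a m X X' * pfac b n Y Y' = 0"
      and e1: "zfac a m X X' * zfac b n Y Y' = 0"
      and e2: "\<theta> * (zfac c p X X' * zfac d q Y Y') * v $ 3 = v $ \<alpha> * (pfac c p X X' * pfac d q Y Y')" by blast
    have num: "zfac a m X X' = 0 \<or> zfac b n Y Y' = 0" using e1 by simp
    have L: "v \<in> L x x' y y'" if "X = s * x" "X' = s * x'" "Y = t * y" "Y' = t * y'" "s \<noteq> 0" "t \<noteq> 0" for s t x x' y y'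
    proof -
      have "s ^ p * t ^ q * (\<theta> * (zfac c p x x' * zfac d q y y') * v $ 3) = s ^ p * t ^ q * (v $ \<alpha> * (pfac c p x x' * pfac d q y y'))"
        using e2 unfolding that(1-4) zfac_scale pfac_scale by (simp only: mult_ac)
      then show ?thesis using that by (simp add: L_def)
    qed
    from den consider "pfac a m X X' = 0" | "pfac b n Y Y' = 0" by auto
    then show "v \<in> (\<Union>i<m. \<Union>j<n. L 1 (cnj (a i)) (b j) 1 \<union> L (a i) 1 1 (cnj (b j)))"
    proof cases
      case 1
      then obtain i where i: "i < m" "X' = cnj (a i) * X" by (auto simp: pfac_eq_0_iff)
      with X have "X \<noteq> 0" by auto
      then have "zfac a m X X' \<noteq> 0" using zfac_pole_nonzero[of m a "a i" X] norm i by simp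
      with num obtain j where j: "j < n" "Y = b j * Y'" by (auto simp: zfac_eq_0_iff)
      with Y have "Y' \<noteq> 0" by auto
      then have "v \<in> L 1 (cnj (a i)) (b j) 1" using L[of X 1 "cnj (a i)" Y' "b j" 1] i j \<open>X \<noteq> 0\<close> by (simp add: mult.commute)
      then show ?thesis using i j by blast
    next
      case 2
      then obtain j where j: "j < n" "Y' = cnj (b j) * Y" by (auto simp: pfac_eq_0_iff)
      with Y have "Y \<noteq> 0" by auto
      then have "zfac b n Y Y' \<noteq> 0" using zfac_pole_nonzero[of n b "b j" Y] norm j by simp
      with num obtain i where i: "i < m" "X = a i * X'" by (auto simp: zfac_eq_0_iff)
      with X have "X' \<noteq> 0" by auto
      then have "v \<in> L (a i) 1 1 (cnj (b j))" using L[of X' "a i" 1 Y 1 "cnj (b j)"] i j \<open>Y \<noteq> 0\<close> by (simp add: mult.commute)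
      then show ?thesis using i j by blast
    qed
  qed
qed

lemma eval2_lift: "eval2 (map_poly (\<lambda>c. [:c:]) P) z w = poly P z"
proof -
  have "poly (map_poly (\<lambda>c. [:c:]) P) [:z:] = [:poly P z:]"
    by (induction P) (simp_all add: map_poly_pCons)
  then show ?thesis by (simp add: eval2_def)
qed

lemma eval2_const: "eval2 [:Q:] z w = poly Q w"
  by (simp add: eval2_def)

section \<open>Good values\<close>

locale generic_blaschke = blaschke +
  assumes a_inj: "inj_on a {..<m}" and c_inj: "inj_on c {..<p}" and ac: "a ` {..<m} \<inter> c ` {..<p} = {}"
    and b_inj: "inj_on b {..<n}" and d_inj: "inj_on d {..<q}" and bd: "b ` {..<n} \<inter> d ` {..<q} = {}"
begin

text \<open>
  The curves \<open>f\<^sub>1 = u\<close> and \<open>f\<^sub>2 = u\<close> in the product of two projective lines with homogeneous coordinates \<open>[X : X']\<close> and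
  \<open>[Y : Y']\<close>, with denominators cleared.
\<close>

definition eq1 :: "complex \<Rightarrow> complex \<Rightarrow> complex \<Rightarrow> complex \<Rightarrow> complex \<Rightarrow> bool" where
  "eq1 u X X' Y Y' \<longleftrightarrow> \<theta>\<^sub>1 * (zfac a m X X' * zfac b n Y Y') = u * (pfac a m X X' * pfac b n Y Y')"

definition eq2 :: "complex \<Rightarrow> complex \<Rightarrow> complex \<Rightarrow> complex \<Rightarrow> complex \<Rightarrow> bool" where
  "eq2 u X X' Y Y' \<longleftrightarrow> \<theta>\<^sub>2 * (zfac c p X X' * zfac d q Y Y') = u * (pfac c p X X' * pfac d q Y Y')"

abbreviation "J \<equiv> jacobian_num (smult \<theta>\<^sub>1 (zpoly a m)) (ppoly a m) (zpoly b n) (ppoly b n) (smult \<theta>\<^sub>2 (zpoly c p)) (ppoly c p) (zpoly d q) (ppoly d q)"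

definition regular :: "complex \<Rightarrow> complex \<Rightarrow> complex \<Rightarrow> complex \<Rightarrow> bool" where
  "regular X X' Y Y' \<longleftrightarrow> X' \<noteq> 0 \<and> Y' \<noteq> 0 \<and> pfac a m X X' \<noteq> 0 \<and> pfac b n Y Y' \<noteq> 0 \<and> pfac c p X X' \<noteq> 0 \<and> pfac d q Y Y' \<noteq> 0
      \<and> J (X / X') (Y / Y') \<noteq> 0"

text \<open>
  Goodness quantifies over all common points of the two curves, also over those at infinity and at the poles. This is what
  makes the affine map proper over a good value.
\<close>

definition good :: "complex \<Rightarrow> complex \<Rightarrow> bool" where
  "good u v \<longleftrightarrow> (\<forall>X X' Y Y'. (X, X') \<noteq> (0, 0) \<longrightarrow> (Y, Y') \<noteq> (0, 0) \<longrightarrow> eq1 u X X' Y Y' \<longrightarrow> eq2 v X X' Y Y' \<longrightarrow> regular X X' Y Y')"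

definition dom :: "(complex \<times> complex) set" where
  "dom = {z. poly (ppoly a m) z \<noteq> 0 \<and> poly (ppoly c p) z \<noteq> 0} \<times> {w. poly (ppoly b n) w \<noteq> 0 \<and> poly (ppoly d q) w \<noteq> 0}"

definition g :: "complex \<times> complex \<Rightarrow> complex \<times> complex" where
  "g = (\<lambda>(z, w). ((poly (smult \<theta>\<^sub>1 (zpoly a m)) z / poly (ppoly a m) z) * (poly (zpoly b n) w / poly (ppoly b n) w),
                  (poly (smult \<theta>\<^sub>2 (zpoly c p)) z / poly (ppoly c p) z) * (poly (zpoly d q) w / poly (ppoly d q) w)))"

definition fibre :: "complex \<Rightarrow> complex \<Rightarrow> (complex \<times> complex) set" where
  "fibre u v = {x \<in> dom. g x = (u, v)}"

lemma theta_nonzero: "\<theta>\<^sub>1 \<noteq> 0" "\<theta>\<^sub>2 \<noteq> 0" using \<theta> by auto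

lemma dom_iff: "(z, w) \<in> dom \<longleftrightarrow> pfac a m z 1 \<noteq> 0 \<and> pfac c p z 1 \<noteq> 0 \<and> pfac b n w 1 \<noteq> 0 \<and> pfac d q w 1 \<noteq> 0"
  by (auto simp: dom_def poly_ppoly)

lemma g_eq: "g (z, w) = (\<theta>\<^sub>1 * (zfac a m z 1 * zfac b n w 1) / (pfac a m z 1 * pfac b n w 1),
                        \<theta>\<^sub>2 * (zfac c p z 1 * zfac d q w 1) / (pfac c p z 1 * pfac d q w 1))"
  by (simp add: g_def poly_zpoly poly_ppoly)

lemma fibre_iff: "(z, w) \<in> fibre u v \<longleftrightarrow> (z, w) \<in> dom \<and> eq1 u z 1 w 1 \<and> eq2 v z 1 w 1"
  by (auto simp: fibre_def g_eq dom_iff eq1_def eq2_def divide_eq_eq)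

lemma open_dom: "open dom"
  unfolding dom_def Collect_conj_eq by (intro open_Times open_Int open_Collect_neq continuous_intros)

lemma continuous_on_g: "continuous_on dom g"
  unfolding g_def case_prod_beta by (intro continuous_intros) (auto simp: dom_def)

lemma eq1_scale: "s \<noteq> 0 \<Longrightarrow> t \<noteq> 0 \<Longrightarrow> eq1 u (s * X) (s * X') (t * Y) (t * Y') \<longleftrightarrow> eq1 u X X' Y Y'"
proof -
  assume st: "s \<noteq> 0" "t \<noteq> 0"
  have "eq1 u (s * X) (s * X') (t * Y) (t * Y') \<longleftrightarrow>
      (s ^ m * t ^ n) * (\<theta>\<^sub>1 * (zfac a m X X' * zfac b n Y Y')) = (s ^ m * t ^ n) * (u * (pfac a m X X' * pfac b n Y Y'))"
    unfolding eq1_def zfac_scale pfac_scale by (simp only: mult_ac)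
  then show ?thesis using st by (simp add: eq1_def)
qed

lemma eq2_scale: "s \<noteq> 0 \<Longrightarrow> t \<noteq> 0 \<Longrightarrow> eq2 u (s * X) (s * X') (t * Y) (t * Y') \<longleftrightarrow> eq2 u X X' Y Y'"
proof -
  assume st: "s \<noteq> 0" "t \<noteq> 0"
  have "eq2 u (s * X) (s * X') (t * Y) (t * Y') \<longleftrightarrow>
      (s ^ p * t ^ q) * (\<theta>\<^sub>2 * (zfac c p X X' * zfac d q Y Y')) = (s ^ p * t ^ q) * (u * (pfac c p X X' * pfac d q Y Y'))"
    unfolding eq2_def zfac_scale pfac_scale by (simp only: mult_ac)
  then show ?thesis using st by (simp add: eq2_def)
qed

lemma regular_affine:
  assumes "regular X X' Y Y'"
  shows "(X / X', Y / Y') \<in> dom" "J (X / X') (Y / Y') \<noteq> 0"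
  using assms pfac_affine[of X'] pfac_affine[of Y'] unfolding regular_def dom_iff by (auto; metis mult_zero_right)+

lemma eq_affine:
  assumes "X' \<noteq> 0" "Y' \<noteq> 0"
  shows "eq1 u X X' Y Y' \<longleftrightarrow> eq1 u (X / X') 1 (Y / Y') 1" "eq2 u X X' Y Y' \<longleftrightarrow> eq2 u (X / X') 1 (Y / Y') 1"
  using eq1_scale[OF assms, of u "X / X'" 1 "Y / Y'" 1] eq2_scale[OF assms, of u "X / X'" 1 "Y / Y'" 1] assms by simp_all

lemma good_injective:
  assumes "good u v" "x \<in> dom" "g x = (u, v)"
  shows "\<exists>U. open U \<and> x \<in> U \<and> U \<subseteq> dom \<and> inj_on g U"
proof -
  obtain z w where x: "x = (z, w)" by fastforce
  have "(z, w) \<in> fibre u v" using assms x by (simp add: fibre_def)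
  then have "regular z 1 w 1" using assms(1) by (auto simp: fibre_iff good_def)
  then have "J z w \<noteq> 0" by (simp add: regular_def)
  then show ?thesis using assms(2) unfolding x dom_def g_def by (intro locally_injective)
qed

text \<open>
  The product of two projective lines is compact: homogeneous coordinates of norm \<open>1\<close> have a convergent subsequence. The limit
  satisfies both curve equations, and goodness of the value places it in the domain of the affine map.
\<close>

lemma good_proper:
  assumes "good u v" and X: "\<And>k::nat. X k \<in> dom" and lim: "(\<lambda>k. g (X k)) \<longlonglongrightarrow> (u, v)"
  shows "\<exists>r l. strict_mono r \<and> l \<in> dom \<and> (X \<circ> r) \<longlonglongrightarrow> l"
proof -
  \<comment> \<open>\<open>\<nu>\<close> normalises the homogeneous coordinates \<open>[z : 1]\<close>.\<close>
  define \<nu> :: "complex \<Rightarrow> complex" where "\<nu> z = of_real (inverse (norm (z, 1 :: complex)))" for z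
  have \<nu>0: "\<nu> z \<noteq> 0" for z by (simp add: \<nu>_def zero_prod_def)
  have \<nu>1: "norm (\<nu> z * z, \<nu> z) = 1" for z
  proof -
    have "(\<nu> z * z, \<nu> z) = sgn (z, 1)"
      by (simp add: \<nu>_def sgn_div_norm scaleR_conv_of_real)
    then show ?thesis by (simp only: norm_sgn) (simp add: zero_prod_def)
  qed
  define K where "K = sphere (0 :: complex \<times> complex) 1 \<times> sphere (0 :: complex \<times> complex) 1"
  define \<Phi> where "\<Phi> k = ((\<nu> (fst (X k)) * fst (X k), \<nu> (fst (X k))), (\<nu> (snd (X k)) * snd (X k), \<nu> (snd (X k))))" for k
  have "seq_compact K" unfolding K_def by (intro compact_imp_seq_compact compact_Times compact_sphere)
  moreover have "\<forall>k. \<Phi> k \<in> K" by (simp add: \<Phi>_def K_def \<nu>1)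
  ultimately obtain L r where L: "L \<in> K" "strict_mono r" "(\<Phi> \<circ> r) \<longlonglongrightarrow> L" by (rule seq_compactE)
  obtain Z Z' W W' where Lx: "L = ((Z, Z'), (W, W'))" by (metis prod.exhaust)
  have nz: "(Z, Z') \<noteq> (0, 0)" "(W, W') \<noteq> (0, 0)" using L(1) by (auto simp: Lx K_def zero_prod_def[symmetric])
  let ?z = "\<lambda>k. fst (X (r k))" and ?w = "\<lambda>k. snd (X (r k))"
  have l1: "(\<lambda>k. \<nu> (?z k) * ?z k) \<longlonglongrightarrow> Z" "(\<lambda>k. \<nu> (?z k)) \<longlonglongrightarrow> Z'"
       "(\<lambda>k. \<nu> (?w k) * ?w k) \<longlonglongrightarrow> W" "(\<lambda>k. \<nu> (?w k)) \<longlonglongrightarrow> W'"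
    using tendsto_fst[OF tendsto_fst[OF L(3)]] tendsto_snd[OF tendsto_fst[OF L(3)]]
      tendsto_fst[OF tendsto_snd[OF L(3)]] tendsto_snd[OF tendsto_snd[OF L(3)]]
    by (simp_all add: \<Phi>_def Lx o_def)
  have "(\<lambda>k. g (X (r k))) \<longlonglongrightarrow> (u, v)" using LIMSEQ_subseq_LIMSEQ[OF lim L(2)] by (simp add: o_def)
  from tendsto_fst[OF this] tendsto_snd[OF this]
  have lu: "(\<lambda>k. fst (g (X (r k)))) \<longlonglongrightarrow> u" and lv: "(\<lambda>k. snd (g (X (r k)))) \<longlonglongrightarrow> v" by simp_all
  have e: "eq1 (fst (g (X k))) (\<nu> z * z) (\<nu> z) (\<nu> w * w) (\<nu> w)" "eq2 (snd (g (X k))) (\<nu> z * z) (\<nu> z) (\<nu> w * w) (\<nu> w)"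
    if "X k = (z, w)" for k z w
  proof -
    have "(z, w) \<in> fibre (fst (g (X k))) (snd (g (X k)))" using X[of k] that by (simp add: fibre_def)
    then show "eq1 (fst (g (X k))) (\<nu> z * z) (\<nu> z) (\<nu> w * w) (\<nu> w)" "eq2 (snd (g (X k))) (\<nu> z * z) (\<nu> z) (\<nu> w * w) (\<nu> w)"
      using eq1_scale[OF \<nu>0 \<nu>0, of _ z z 1 w w 1] eq2_scale[OF \<nu>0 \<nu>0, of _ z z 1 w w 1]
      by (auto simp: fibre_iff)
  qed
  have "eq1 u Z Z' W W'"
    unfolding eq1_def
  proof (rule LIMSEQ_unique)
    show "(\<lambda>k. \<theta>\<^sub>1 * (zfac a m (\<nu> (?z k) * ?z k) (\<nu> (?z k)) * zfac b n (\<nu> (?w k) * ?w k) (\<nu> (?w k)))) \<longlonglongrightarrow> \<theta>\<^sub>1 * (zfac a m Z Z' * zfac b n W W')"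
      unfolding zfac_def by (intro tendsto_intros l1)
    have eq: "\<theta>\<^sub>1 * (zfac a m (\<nu> (?z k) * ?z k) (\<nu> (?z k)) * zfac b n (\<nu> (?w k) * ?w k) (\<nu> (?w k)))
       = fst (g (X (r k))) * (pfac a m (\<nu> (?z k) * ?z k) (\<nu> (?z k)) * pfac b n (\<nu> (?w k) * ?w k) (\<nu> (?w k)))" for k
      using e(1)[of "r k" "?z k" "?w k"] by (simp add: eq1_def)
    show "(\<lambda>k. \<theta>\<^sub>1 * (zfac a m (\<nu> (?z k) * ?z k) (\<nu> (?z k)) * zfac b n (\<nu> (?w k) * ?w k) (\<nu> (?w k)))) \<longlonglongrightarrow> u * (pfac a m Z Z' * pfac b n W W')"
      unfolding eq pfac_def by (intro tendsto_intros l1 lu)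
  qed
  moreover have "eq2 v Z Z' W W'"
    unfolding eq2_def
  proof (rule LIMSEQ_unique)
    show "(\<lambda>k. \<theta>\<^sub>2 * (zfac c p (\<nu> (?z k) * ?z k) (\<nu> (?z k)) * zfac d q (\<nu> (?w k) * ?w k) (\<nu> (?w k)))) \<longlonglongrightarrow> \<theta>\<^sub>2 * (zfac c p Z Z' * zfac d q W W')"
      unfolding zfac_def by (intro tendsto_intros l1)
    have eq: "\<theta>\<^sub>2 * (zfac c p (\<nu> (?z k) * ?z k) (\<nu> (?z k)) * zfac d q (\<nu> (?w k) * ?w k) (\<nu> (?w k)))
       = snd (g (X (r k))) * (pfac c p (\<nu> (?z k) * ?z k) (\<nu> (?z k)) * pfac d q (\<nu> (?w k) * ?w k) (\<nu> (?w k)))" for k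
      using e(2)[of "r k" "?z k" "?w k"] by (simp add: eq2_def)
    show "(\<lambda>k. \<theta>\<^sub>2 * (zfac c p (\<nu> (?z k) * ?z k) (\<nu> (?z k)) * zfac d q (\<nu> (?w k) * ?w k) (\<nu> (?w k)))) \<longlonglongrightarrow> v * (pfac c p Z Z' * pfac d q W W')"
      unfolding eq pfac_def by (intro tendsto_intros l1 lv)
  qed
  ultimately have reg: "regular Z Z' W W'" using assms(1) nz by (auto simp: good_def)
  then have Z0: "Z' \<noteq> 0" "W' \<noteq> 0" by (auto simp: regular_def)
  have "(\<lambda>k. ((\<nu> (?z k) * ?z k) / \<nu> (?z k), (\<nu> (?w k) * ?w k) / \<nu> (?w k))) \<longlonglongrightarrow> (Z / Z', W / W')"
    by (intro tendsto_intros l1 Z0)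
  then have "(X \<circ> r) \<longlonglongrightarrow> (Z / Z', W / W')" using \<nu>0 by (simp add: o_def)
  then show ?thesis using L(2) regular_affine(1)[OF reg] by blast
qed

lemma fibre_finite_good:
  assumes "good u v"
  shows "finite (fibre u v)"
  unfolding fibre_def
proof (rule fibre_finite[OF continuous_on_g open_dom])
  show "\<exists>U. open U \<and> x \<in> U \<and> U \<subseteq> dom \<and> inj_on g U" if "x \<in> dom" "g x = (u, v)" for x
    by (rule good_injective[OF assms that])
  show "\<exists>r l. strict_mono r \<and> l \<in> dom \<and> (X \<circ> r) \<longlonglongrightarrow> l" if "\<And>k::nat. X k \<in> dom" "(\<lambda>k. g (X k)) \<longlonglongrightarrow> (u, v)" for X
    by (rule good_proper[OF assms that])
qed

lemma fibre_card_near_good: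
  assumes "good u v"
  shows "eventually (\<lambda>y. card (fibre (fst y) (snd y)) = card (fibre u v)) (nhds (u, v))"
  unfolding fibre_def prod.collapse
proof (rule fibre_card_locally_constant[OF continuous_on_g open_dom])
  show "\<exists>U. open U \<and> x \<in> U \<and> U \<subseteq> dom \<and> inj_on g U" if "x \<in> dom" "g x = (u, v)" for x
    by (rule good_injective[OF assms that])
  show "\<exists>r l. strict_mono r \<and> l \<in> dom \<and> (X \<circ> r) \<longlonglongrightarrow> l" if "\<And>k::nat. X k \<in> dom" "(\<lambda>k. g (X k)) \<longlonglongrightarrow> (u, v)" for X
    by (rule good_proper[OF assms that])
qed

end

context generic_blaschke begin

text \<open>
  At such a point only the first product in the Jacobian numerator survives, and its factors are nonzero because the zeros are
  simple and the zeros of the two components are disjoint. In \<open>jacobian_at_zero_2\<close> the roles of the two products are exchanged.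
\<close>

lemma jacobian_at_zero_1:
  assumes "i < m" "j < q"
  shows "J (a i) (d j) \<noteq> 0"
proof -
  have 0: "poly (zpoly a m) (a i) = 0" "poly (zpoly d q) (d j) = 0" using assms by (auto simp: poly_zpoly zfac_eq_0_iff)
  have "poly (ppoly a m) (a i) \<noteq> 0" "poly (ppoly c p) (a i) \<noteq> 0" "poly (ppoly b n) (d j) \<noteq> 0" "poly (ppoly d q) (d j) \<noteq> 0"
    using pfac_zero_nonzero[of m a "a i" 1] pfac_zero_nonzero[of p c "a i" 1] pfac_zero_nonzero[of n b "d j" 1] pfac_zero_nonzero[of q d "d j" 1]
      assms a b c d by (simp_all add: poly_ppoly)
  moreover have "poly (zpoly c p) (a i) \<noteq> 0" "poly (zpoly b n) (d j) \<noteq> 0"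
    using ac bd assms by (auto simp: poly_zpoly zfac_eq_0_iff)
  moreover have "poly (pderiv (zpoly a m)) (a i) \<noteq> 0" "poly (pderiv (zpoly d q)) (d j) \<noteq> 0"
    using pderiv_zpoly_nonzero a_inj d_inj assms by auto
  ultimately show ?thesis using theta_nonzero by (simp add: jacobian_num_def wronskian_def pderiv_smult 0)
qed

lemma jacobian_at_zero_2:
  assumes "i < p" "j < n"
  shows "J (c i) (b j) \<noteq> 0"
proof -
  have 0: "poly (zpoly c p) (c i) = 0" "poly (zpoly b n) (b j) = 0" using assms by (auto simp: poly_zpoly zfac_eq_0_iff)
  have "poly (ppoly a m) (c i) \<noteq> 0" "poly (ppoly c p) (c i) \<noteq> 0" "poly (ppoly b n) (b j) \<noteq> 0" "poly (ppoly d q) (b j) \<noteq> 0"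
    using pfac_zero_nonzero[of m a "c i" 1] pfac_zero_nonzero[of p c "c i" 1] pfac_zero_nonzero[of n b "b j" 1] pfac_zero_nonzero[of q d "b j" 1]
      assms a b c d by (simp_all add: poly_ppoly)
  moreover have "poly (zpoly a m) (c i) \<noteq> 0" "poly (zpoly d q) (b j) \<noteq> 0"
    using ac bd assms by (auto simp: poly_zpoly zfac_eq_0_iff)
  moreover have "poly (pderiv (zpoly c p)) (c i) \<noteq> 0" "poly (pderiv (zpoly b n)) (b j) \<noteq> 0"
    using pderiv_zpoly_nonzero c_inj b_inj assms by auto
  ultimately show ?thesis using theta_nonzero by (simp add: jacobian_num_def wronskian_def pderiv_smult 0)
qed

lemma pfac_disc_nonzero:
  assumes "norm z < 1" "x' \<noteq> 0"
  shows "pfac a m (z * x') x' \<noteq> 0" "pfac b n (z * x') x' \<noteq> 0" "pfac c p (z * x') x' \<noteq> 0" "pfac d q (z * x') x' \<noteq> 0"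
  using pfac_zero_nonzero[of m a, OF a assms] pfac_zero_nonzero[of n b, OF b assms]
    pfac_zero_nonzero[of p c, OF c assms] pfac_zero_nonzero[of q d, OF d assms] by blast+

text \<open>
  Over the origin both curves are unions of lines. Lines \<open>z = a\<^sub>i\<close> and \<open>z = c\<^sub>j\<close> do not meet, nor do
  \<open>w = b\<^sub>i\<close> and \<open>w = d\<^sub>j\<close>, so the common points are the points \<open>(a\<^sub>i, d\<^sub>j)\<close> and \<open>(c\<^sub>i, b\<^sub>j)\<close> in the bidisc.
\<close>

lemma good_origin: "good 0 0"
  unfolding good_def
proof (intro allI impI)
  fix X X' Y Y'
  assume nz: "(X, X') \<noteq> (0, 0)" "(Y, Y') \<noteq> (0, 0)" and e: "eq1 0 X X' Y Y'" "eq2 0 X X' Y Y'"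
  have 1: "(\<exists>i<m. X = a i * X') \<or> (\<exists>j<n. Y = b j * Y')" and 2: "(\<exists>i<p. X = c i * X') \<or> (\<exists>j<q. Y = d j * Y')"
    using e theta_nonzero by (auto simp: eq1_def eq2_def zfac_eq_0_iff)
  have no1: False if "i < m" "X = a i * X'" "j < p" "X = c j * X'" for i j
  proof -
    have "X' \<noteq> 0" using nz that by auto
    then have "a i = c j" using that by simp
    then show False using ac that by auto
  qed
  have no2: False if "i < n" "Y = b i * Y'" "j < q" "Y = d j * Y'" for i j
  proof -
    have "Y' \<noteq> 0" using nz that by auto
    then have "b i = d j" using that by simp
    then show False using bd that by auto
  qed
  have reg: "regular X X' Y Y'" if "X = z * X'" "Y = w * Y'" "norm z < 1" "norm w < 1" "J z w \<noteq> 0" for z w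
  proof -
    have "X' \<noteq> 0" "Y' \<noteq> 0" using nz that by auto
    then show ?thesis using that pfac_disc_nonzero by (simp add: regular_def)
  qed
  from 1 2 consider i j where "i < m" "X = a i * X'" "j < q" "Y = d j * Y'" | i j where "i < p" "X = c i * X'" "j < n" "Y = b j * Y'"
    using no1 no2 by blast
  then show "regular X X' Y Y'"
  proof cases
    case 1
    then show ?thesis using reg a d jacobian_at_zero_1 by blast
  next
    case 2
    then show ?thesis using reg b c jacobian_at_zero_2 by blast
  qed
qed

lemma fibre_origin: "fibre 0 0 = (a ` {..<m} \<times> d ` {..<q}) \<union> (c ` {..<p} \<times> b ` {..<n})"
proof -
  have hz0: "zfac a' k z 1 = 0 \<longleftrightarrow> z \<in> a' ` {..<k}" for a' k z by (auto simp: zfac_eq_0_iff)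
  have dom: "(z, w) \<in> dom" if "norm z < 1" "norm w < 1" for z w
    using pfac_disc_nonzero[OF that(1), of 1] pfac_disc_nonzero[OF that(2), of 1] by (simp add: dom_iff)
  have "(z, w) \<in> fibre 0 0 \<longleftrightarrow> (z, w) \<in> (a ` {..<m} \<times> d ` {..<q}) \<union> (c ` {..<p} \<times> b ` {..<n})" for z w
  proof -
    have "(z, w) \<in> fibre 0 0 \<longleftrightarrow> (z, w) \<in> dom \<and> (z \<in> a ` {..<m} \<or> w \<in> b ` {..<n}) \<and> (z \<in> c ` {..<p} \<or> w \<in> d ` {..<q})"
      using theta_nonzero by (simp add: fibre_iff eq1_def eq2_def hz0)
    also have "\<dots> \<longleftrightarrow> (z, w) \<in> (a ` {..<m} \<times> d ` {..<q}) \<union> (c ` {..<p} \<times> b ` {..<n})"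
      using ac bd dom[of z w] a b c d by (auto simp: image_iff)
    finally show ?thesis .
  qed
  then show ?thesis by auto
qed

lemma card_fibre_origin: "card (fibre 0 0) = m * q + n * p"
proof -
  have "card (fibre 0 0) = card (a ` {..<m} \<times> d ` {..<q}) + card (c ` {..<p} \<times> b ` {..<n})"
    unfolding fibre_origin using ac by (intro card_Un_disjoint) auto
  then show ?thesis
    using a_inj b_inj c_inj d_inj by (simp add: card_cartesian_product card_image mult.commute)
qed

subsection \<open>Generic values are good\<close>

definition Jpoly :: "complex poly poly" where
  "Jpoly = (let l = map_poly (\<lambda>c. [:c:]); P1 = smult \<theta>\<^sub>1 (zpoly a m); P2 = smult \<theta>\<^sub>2 (zpoly c p) in
     l (wronskian P1 (ppoly a m) * P2 * ppoly c p) * [:zpoly b n * ppoly b n * wronskian (zpoly d q) (ppoly d q):]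
   - l (P1 * ppoly a m * wronskian P2 (ppoly c p)) * [:wronskian (zpoly b n) (ppoly b n) * zpoly d q * ppoly d q:])"

lemma eval2_Jpoly: "eval2 Jpoly z w = J z w"
  unfolding Jpoly_def Let_def jacobian_num_def eval2_simps(4,5) eval2_lift eval2_const ..

lemma Jpoly_nonzero: "Jpoly \<noteq> 0"
  using jacobian_at_zero_1[of 0 0] pos eval2_Jpoly[of "a 0" "d 0"] by auto

text \<open>
  The two curve equations for a value given by homogeneous coordinates \<open>y\<close>, that is for
  \<open>u = y $ 1 / y $ 3\<close> and \<open>v = y $ 2 / y $ 3\<close>.
\<close>

definition value_eqs :: "complex ^ 3 \<Rightarrow> complex \<Rightarrow> complex \<Rightarrow> complex \<Rightarrow> complex \<Rightarrow> bool" where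
  "value_eqs y X X' Y Y' \<longleftrightarrow>
     \<theta>\<^sub>1 * (zfac a m X X' * zfac b n Y Y') * y $ 3 = y $ 1 * (pfac a m X X' * pfac b n Y Y') \<and>
     \<theta>\<^sub>2 * (zfac c p X X' * zfac d q Y Y') * y $ 3 = y $ 2 * (pfac c p X X' * pfac d q Y Y')"

text \<open>
  A common point fails to be regular for one of the following reasons, each of which confines the value to a thin set:
  a denominator of the first or of the second component vanishes (\<open>T1\<close>, \<open>T2\<close>, finitely many points); both
  coordinates are infinite (\<open>T3\<close>, a single point); one coordinate is infinite (\<open>T4\<close>, \<open>T5\<close>, rational curves); or the Jacobian
  vanishes (\<open>T6\<close>, the image of the critical curve).
\<close>

lemma thin_not_regular:
  "thin {y. y $ 3 \<noteq> 0 \<and> (\<exists>X X' Y Y'. (X, X') \<noteq> (0, 0) \<and> (Y, Y') \<noteq> (0, 0) \<and> value_eqs y X X' Y Y' \<and> \<not> regular X X' Y Y')}"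
    (is "thin ?T")
proof -
  let ?nz = "\<lambda>X X'. (X, X') \<noteq> (0 :: complex, 0 :: complex)"
  define T1 where "T1 = {y :: complex ^ 3. y $ 3 \<noteq> 0 \<and> (\<exists>X X' Y Y'. ?nz X X' \<and> ?nz Y Y' \<and> pfac a m X X' * pfac b n Y Y' = 0 \<and>
     zfac a m X X' * zfac b n Y Y' = 0 \<and> \<theta>\<^sub>2 * (zfac c p X X' * zfac d q Y Y') * y $ 3 = y $ 2 * (pfac c p X X' * pfac d q Y Y'))}"
  define T2 where "T2 = {y :: complex ^ 3. y $ 3 \<noteq> 0 \<and> (\<exists>X X' Y Y'. ?nz X X' \<and> ?nz Y Y' \<and> pfac c p X X' * pfac d q Y Y' = 0 \<and>
     zfac c p X X' * zfac d q Y Y' = 0 \<and> \<theta>\<^sub>1 * (zfac a m X X' * zfac b n Y Y') * y $ 3 = y $ 1 * (pfac a m X X' * pfac b n Y Y'))}"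
  define T3 where "T3 = {y :: complex ^ 3. - (pfac a m 1 0 * pfac b n 1 0) * y $ 1 + 0 * y $ 2 + \<theta>\<^sub>1 * y $ 3 = 0}"
  define T4 where "T4 = {y :: complex ^ 3. \<exists>w. poly (smult (pfac a m 1 0) (ppoly b n)) w \<noteq> 0 \<and> poly (smult (pfac c p 1 0) (ppoly d q)) w \<noteq> 0 \<and>
       poly (smult \<theta>\<^sub>1 (zpoly b n)) w * y $ 3 = y $ 1 * poly (smult (pfac a m 1 0) (ppoly b n)) w \<and>
       poly (smult \<theta>\<^sub>2 (zpoly d q)) w * y $ 3 = y $ 2 * poly (smult (pfac c p 1 0) (ppoly d q)) w}"
  define T5 where "T5 = {y :: complex ^ 3. \<exists>w. poly (smult (pfac b n 1 0) (ppoly a m)) w \<noteq> 0 \<and> poly (smult (pfac d q 1 0) (ppoly c p)) w \<noteq> 0 \<and>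
       poly (smult \<theta>\<^sub>1 (zpoly a m)) w * y $ 3 = y $ 1 * poly (smult (pfac b n 1 0) (ppoly a m)) w \<and>
       poly (smult \<theta>\<^sub>2 (zpoly c p)) w * y $ 3 = y $ 2 * poly (smult (pfac d q 1 0) (ppoly c p)) w}"
  let ?l = "map_poly (\<lambda>c. [:c:])"
  define T6 where "T6 = {y :: complex ^ 3. \<exists>z w. eval2 Jpoly z w = 0 \<and> eval2 (?l (ppoly a m) * [:ppoly b n:]) z w \<noteq> 0 \<and> eval2 (?l (ppoly c p) * [:ppoly d q:]) z w \<noteq> 0 \<and>
       eval2 (?l (smult \<theta>\<^sub>1 (zpoly a m)) * [:zpoly b n:]) z w * y $ 3 = y $ 1 * eval2 (?l (ppoly a m) * [:ppoly b n:]) z w \<and>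
       eval2 (?l (smult \<theta>\<^sub>2 (zpoly c p)) * [:zpoly d q:]) z w * y $ 3 = y $ 2 * eval2 (?l (ppoly c p) * [:ppoly d q:]) z w}"
  have "thin T1" unfolding T1_def using a b c d ac bd theta_nonzero by (intro thin_indeterminate) auto
  moreover have "thin T2" unfolding T2_def using a b c d ac bd theta_nonzero by (intro thin_indeterminate) auto
  moreover have "thin T3" unfolding T3_def using theta_nonzero by (intro thin_linear) auto
  moreover have "thin T4" "thin T5" unfolding T4_def T5_def by (rule thin_rational_curve)+
  moreover have "thin T6" unfolding T6_def using Jpoly_nonzero by (rule thin_curve_image)
  ultimately have "thin (T1 \<union> T2 \<union> T3 \<union> T4 \<union> T5 \<union> T6)" by (intro thin_Un)
  then show ?thesis
  proof (rule thin_subset, intro subsetI)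
    fix y assume "y \<in> ?T"
    then obtain X X' Y Y' where y3: "y $ 3 \<noteq> 0" and nz: "?nz X X'" "?nz Y Y'" and h: "value_eqs y X X' Y Y'" and nr: "\<not> regular X X' Y Y'"
      by blast
    note e1 = h[unfolded value_eqs_def, THEN conjunct1] and e2 = h[unfolded value_eqs_def, THEN conjunct2]
    show "y \<in> T1 \<union> T2 \<union> T3 \<union> T4 \<union> T5 \<union> T6"
    proof (cases "pfac a m X X' * pfac b n Y Y' = 0 \<or> pfac c p X X' * pfac d q Y Y' = 0")
      case True
      then show ?thesis
      proof
        assume 0: "pfac a m X X' * pfac b n Y Y' = 0"
        have "zfac a m X X' * zfac b n Y Y' = 0" using e1 unfolding 0 using y3 theta_nonzero by simp
        then have "y \<in> T1" unfolding T1_def using y3 nz 0 e2 by blast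
        then show ?thesis by blast
      next
        assume 0: "pfac c p X X' * pfac d q Y Y' = 0"
        have "zfac c p X X' * zfac d q Y Y' = 0" using e2 unfolding 0 using y3 theta_nonzero by simp
        then have "y \<in> T2" unfolding T2_def using y3 nz 0 e1 by blast
        then show ?thesis by blast
      qed
    next
      case False
      then have den: "pfac a m X X' \<noteq> 0" "pfac b n Y Y' \<noteq> 0" "pfac c p X X' \<noteq> 0" "pfac d q Y Y' \<noteq> 0" by auto
      have inf: "zfac a' k x 0 = x ^ k" "pfac a' k x 0 = x ^ k * pfac a' k 1 0" for a' k x
        using pfac_scale[of a' k x 1 0] by (simp_all add: zfac_def)
      note inf' = inf(1) inf(2)[of a m X] inf(2)[of c p X] inf(2)[of b n Y] inf(2)[of d q Y]
      consider "X' = 0" "Y' = 0" | "X' = 0" "Y' \<noteq> 0" | "X' \<noteq> 0" "Y' = 0" | "X' \<noteq> 0" "Y' \<noteq> 0" by blast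
      then show ?thesis
      proof cases
        case 1
        then have "X ^ m * Y ^ n * (\<theta>\<^sub>1 * y $ 3) = X ^ m * Y ^ n * (y $ 1 * (pfac a m 1 0 * pfac b n 1 0))"
          using e1 unfolding 1 inf' by (simp only: mult_ac)
        then have "y \<in> T3" using 1 nz by (simp add: T3_def)
        then show ?thesis by blast
      next
        case 2
        have *: "zfac b n Y Y' = Y' ^ n * zfac b n (Y / Y') 1" "pfac b n Y Y' = Y' ^ n * pfac b n (Y / Y') 1"
          "zfac d q Y Y' = Y' ^ q * zfac d q (Y / Y') 1" "pfac d q Y Y' = Y' ^ q * pfac d q (Y / Y') 1"
          by (rule zfac_affine[OF 2(2)] pfac_affine[OF 2(2)])+
        have X: "X \<noteq> 0" using nz 2 by auto
        have "X ^ m * Y' ^ n * (\<theta>\<^sub>1 * zfac b n (Y / Y') 1 * y $ 3) = X ^ m * Y' ^ n * (y $ 1 * (pfac a m 1 0 * pfac b n (Y / Y') 1))"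
          using e1 unfolding 2 inf' * by (simp only: mult_ac)
        moreover have "X ^ p * Y' ^ q * (\<theta>\<^sub>2 * zfac d q (Y / Y') 1 * y $ 3) = X ^ p * Y' ^ q * (y $ 2 * (pfac c p 1 0 * pfac d q (Y / Y') 1))"
          using e2 unfolding 2 inf' * by (simp only: mult_ac)
        moreover have "pfac a m 1 0 \<noteq> 0" "pfac c p 1 0 \<noteq> 0" using den unfolding 2 inf' by auto
        moreover have "pfac b n (Y / Y') 1 \<noteq> 0" "pfac d q (Y / Y') 1 \<noteq> 0" using den unfolding * by auto
        ultimately have "y \<in> T4" using X 2 by (auto simp: T4_def poly_zpoly poly_ppoly intro!: exI[of _ "Y / Y'"])
        then show ?thesis by blast
      next
        case 3
        have *: "zfac a m X X' = X' ^ m * zfac a m (X / X') 1" "pfac a m X X' = X' ^ m * pfac a m (X / X') 1"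
          "zfac c p X X' = X' ^ p * zfac c p (X / X') 1" "pfac c p X X' = X' ^ p * pfac c p (X / X') 1"
          by (rule zfac_affine[OF 3(1)] pfac_affine[OF 3(1)])+
        have Y: "Y \<noteq> 0" using nz 3 by auto
        have "X' ^ m * Y ^ n * (\<theta>\<^sub>1 * zfac a m (X / X') 1 * y $ 3) = X' ^ m * Y ^ n * (y $ 1 * (pfac b n 1 0 * pfac a m (X / X') 1))"
          using e1 unfolding 3 inf' * by (simp only: mult_ac)
        moreover have "X' ^ p * Y ^ q * (\<theta>\<^sub>2 * zfac c p (X / X') 1 * y $ 3) = X' ^ p * Y ^ q * (y $ 2 * (pfac d q 1 0 * pfac c p (X / X') 1))"
          using e2 unfolding 3 inf' * by (simp only: mult_ac)
        moreover have "pfac b n 1 0 \<noteq> 0" "pfac d q 1 0 \<noteq> 0" using den unfolding 3 inf' by auto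
        moreover have "pfac a m (X / X') 1 \<noteq> 0" "pfac c p (X / X') 1 \<noteq> 0" using den unfolding * by auto
        ultimately have "y \<in> T5" using Y 3 by (auto simp: T5_def poly_zpoly poly_ppoly intro!: exI[of _ "X / X'"])
        then show ?thesis by blast
      next
        case 4
        have *: "zfac a m X X' = X' ^ m * zfac a m (X / X') 1" "pfac a m X X' = X' ^ m * pfac a m (X / X') 1"
          "zfac c p X X' = X' ^ p * zfac c p (X / X') 1" "pfac c p X X' = X' ^ p * pfac c p (X / X') 1"
          "zfac b n Y Y' = Y' ^ n * zfac b n (Y / Y') 1" "pfac b n Y Y' = Y' ^ n * pfac b n (Y / Y') 1"
          "zfac d q Y Y' = Y' ^ q * zfac d q (Y / Y') 1" "pfac d q Y Y' = Y' ^ q * pfac d q (Y / Y') 1"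
          by (rule zfac_affine[OF 4(1)] pfac_affine[OF 4(1)] zfac_affine[OF 4(2)] pfac_affine[OF 4(2)])+
        have J0: "J (X / X') (Y / Y') = 0" using nr den 4 by (simp add: regular_def)
        have "X' ^ m * Y' ^ n * (\<theta>\<^sub>1 * (zfac a m (X / X') 1 * zfac b n (Y / Y') 1) * y $ 3)
            = X' ^ m * Y' ^ n * (y $ 1 * (pfac a m (X / X') 1 * pfac b n (Y / Y') 1))"
          using e1 unfolding * by (simp only: mult_ac)
        moreover have "X' ^ p * Y' ^ q * (\<theta>\<^sub>2 * (zfac c p (X / X') 1 * zfac d q (Y / Y') 1) * y $ 3)
            = X' ^ p * Y' ^ q * (y $ 2 * (pfac c p (X / X') 1 * pfac d q (Y / Y') 1))"
          using e2 unfolding * by (simp only: mult_ac)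
        moreover have "pfac a m (X / X') 1 \<noteq> 0" "pfac c p (X / X') 1 \<noteq> 0" "pfac b n (Y / Y') 1 \<noteq> 0" "pfac d q (Y / Y') 1 \<noteq> 0"
          using den unfolding * by auto
        ultimately have "y \<in> T6" using 4 J0
          unfolding T6_def eval2_simps(5) eval2_lift eval2_const eval2_Jpoly
          by (intro CollectI exI[of _ "X / X'"] exI[of _ "Y / Y'"]) (simp add: poly_zpoly poly_ppoly mult.assoc)
        then show ?thesis by blast
      qed
    qed
  qed
qed

lemma generic_good:
  obtains H e where "H \<noteq> 0" "homogeneous e H" "\<And>y. y $ 3 \<noteq> 0 \<Longrightarrow> eval3 H y \<noteq> 0 \<Longrightarrow> good (y $ 1 / y $ 3) (y $ 2 / y $ 3)"
proof -
  obtain H e where H: "H \<noteq> 0" "homogeneous e H"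
    "\<And>y. y $ 3 \<noteq> 0 \<and> (\<exists>X X' Y Y'. (X, X') \<noteq> (0, 0) \<and> (Y, Y') \<noteq> (0, 0) \<and> value_eqs y X X' Y Y' \<and> \<not> regular X X' Y Y') \<Longrightarrow> eval3 H y = 0"
    using thin_not_regular unfolding thin_def mem_Collect_eq Ball_def by blast
  have "good (y $ 1 / y $ 3) (y $ 2 / y $ 3)" if "y $ 3 \<noteq> 0" "eval3 H y \<noteq> 0" for y
    unfolding good_def
  proof (intro allI impI, rule ccontr)
    fix X X' Y Y'
    assume nz: "(X, X') \<noteq> (0, 0)" "(Y, Y') \<noteq> (0, 0)" and e: "eq1 (y $ 1 / y $ 3) X X' Y Y'" "eq2 (y $ 2 / y $ 3) X X' Y Y'"
      and nr: "\<not> regular X X' Y Y'"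
    have "value_eqs y X X' Y Y'" using e that(1) by (simp add: value_eqs_def eq1_def eq2_def field_simps)
    then show False using H(3)[of y] that nz nr by blast
  qed
  then show ?thesis using that H by blast
qed

text \<open>
  On the complex line through the origin and a generic value, \<open>H\<close> is not identically zero, so all but finitely many points are good; the origin
  is good even if \<open>H\<close> vanishes there. The complement of a finite set in the line is connected and the number of preimages is locally constant on it.
\<close>

lemma generic_fibre_card:
  obtains H e where "H \<noteq> 0" "homogeneous e H"
    "\<And>y. y $ 3 \<noteq> 0 \<Longrightarrow> eval3 H y \<noteq> 0 \<Longrightarrow> good (y $ 1 / y $ 3) (y $ 2 / y $ 3) \<and> card (fibre (y $ 1 / y $ 3) (y $ 2 / y $ 3)) = m * q + n * p"
proof -
  obtain H e where H: "H \<noteq> 0" "homogeneous e H" "\<And>y. y $ 3 \<noteq> 0 \<Longrightarrow> eval3 H y \<noteq> 0 \<Longrightarrow> good (y $ 1 / y $ 3) (y $ 2 / y $ 3)"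
    using generic_good by blast
  have "card (fibre (y $ 1 / y $ 3) (y $ 2 / y $ 3)) = m * q + n * p" if y3: "y $ 3 \<noteq> 0" and y: "eval3 H y \<noteq> 0" for y
  proof -
    define u v where "u = y $ 1 / y $ 3" and "v = y $ 2 / y $ 3"
    obtain P where P: "\<And>t. poly P t = eval3 H (vector [poly [:0, u:] t, poly [:0, v:] t, poly [:1:] t])"
      using eval3_curve by metis
    have "y = y $ 3 *s vector [u, v, 1]" using y3 by (simp add: vec_eq_iff forall_3 u_def v_def)
    then have "eval3 H (vector [u, v, 1]) \<noteq> 0" using y eval3_homogeneous[OF H(2), of "y $ 3" "vector [u, v, 1]"] by auto
    then have P1: "poly P 1 \<noteq> 0" by (simp add: P)
    then have "P \<noteq> 0" by auto
    then have fin: "finite {t. poly P t = 0}" by (rule poly_roots_finite)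
    \<comment> \<open>parameters of good values on the line; \<open>0\<close> and \<open>1\<close> are the origin and the given value\<close>
    define T where "T = UNIV - ({t. poly P t = 0} - {0})"
    have conn: "connected T"
    proof -
      have "countable ({t. poly P t = 0} - {0})" using fin by (intro countable_finite) simp
      then show ?thesis unfolding T_def
        by (intro connected_open_diff_countable) auto
    qed
    have good: "good (t * u) (t * v)" if "t \<in> T" for t
    proof (cases "t = 0")
      case False
      then have "eval3 H (vector [t * u, t * v, 1]) \<noteq> 0" using that P[of t] by (simp add: T_def)
      then show ?thesis using H(3)[of "vector [t * u, t * v, 1]"] by simp
    qed (simp add: good_origin)
    have "(\<lambda>t. card (fibre (t * u) (t * v))) constant_on T"
    proof (rule locally_constant_imp_constant[OF conn])
      fix t assume t: "t \<in> T"
      have "((\<lambda>t. (t * u, t * v)) \<longlongrightarrow> (t * u, t * v)) (nhds t)"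
        by (intro tendsto_intros filterlim_ident)
      have "eventually (\<lambda>s. card (fibre (s * u) (s * v)) = card (fibre (t * u) (t * v))) (nhds t)"
        using fibre_card_near_good[OF good[OF t]] \<open>((\<lambda>t. (t * u, t * v)) \<longlongrightarrow> (t * u, t * v)) (nhds t)\<close>
        by (auto simp: filterlim_iff)
      then obtain U where U: "open U" "t \<in> U" "\<forall>s\<in>U. card (fibre (s * u) (s * v)) = card (fibre (t * u) (t * v))"
        unfolding eventually_nhds by blast
      show "\<exists>S. openin (top_of_set T) S \<and> t \<in> S \<and> (\<forall>s\<in>S. card (fibre (s * u) (s * v)) = card (fibre (t * u) (t * v)))"
      proof (intro exI conjI)
        show "openin (top_of_set T) (T \<inter> U)" using U(1) by (rule openin_open_Int)
        show "t \<in> T \<inter> U" using t U(2) by simp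
        show "\<forall>s\<in>T \<inter> U. card (fibre (s * u) (s * v)) = card (fibre (t * u) (t * v))" using U(3) by blast
      qed
    qed
    moreover have "1 \<in> T" "0 \<in> T" using P1 by (auto simp: T_def)
    ultimately have "card (fibre (1 * u) (1 * v)) = card (fibre (0 * u) (0 * v))"
      unfolding constant_on_def by metis
    then show ?thesis by (simp add: card_fibre_origin u_def v_def)
  qed
  then show ?thesis using that[of H e] H by blast
qed

end

section \<open>The topological degree\<close>

lemma hpoint_eq_iff:
  assumes "v \<noteq> 0" "w \<noteq> 0"
  shows "hpoint v = hpoint w \<longleftrightarrow> (\<exists>k. k \<noteq> 0 \<and> w = k *s v)"
proof -
  have "proj_rel v v" "proj_rel w w" using assms by (auto simp: proj_rel_def intro!: exI[of _ 1])
  then have "hpoint v = hpoint w \<longleftrightarrow> proj_rel v w"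
    using Quotient3_rel[OF Quotient3_proj_plane, of v w] by simp
  then show ?thesis using assms by (simp add: proj_rel_def)
qed

text \<open>
  Representatives of a rational map are proportional as polynomials, hence their values at a point are proportional.
\<close>

lemma maps_to_unique:
  assumes "maps_to g x y" "maps_to g x y'"
  shows "y = y'"
proof -
  obtain F v where F: "represents F g" "v \<noteq> 0" "eval_triple F v \<noteq> 0" "x = hpoint v" "y = hpoint (eval_triple F v)"
    using assms(1) by (auto simp: maps_to_def)
  obtain F' v' where F': "represents F' g" "v' \<noteq> 0" "eval_triple F' v' \<noteq> 0" "x = hpoint v'" "y' = hpoint (eval_triple F' v')"
    using assms(2) by (auto simp: maps_to_def)
  obtain k where k: "k \<noteq> 0" "v' = k *s v" using hpoint_eq_iff[of v v'] F F' by auto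
  obtain e where e: "homogeneous_triple e F'" using F'(1) by (auto simp: represents_def rat_rep_def)
  have ev: "eval_triple F' v' = k ^ e *s eval_triple F' v" using eval_triple_homogeneous[OF e] k by simp
  then have "eval_triple F' v \<noteq> 0" using F'(3) by auto
  obtain j where j: "eval_triple F v $ j \<noteq> 0" using F(3) by (auto simp: vec_eq_iff)
  have pr: "eval_triple F v $ i * eval_triple F' v $ j = eval_triple F v $ j * eval_triple F' v $ i" for i
    using arg_cong[OF represents_proportional[OF F(1) F'(1), of i j], of "\<lambda>P. eval3 P v"] by (simp add: eval_triple_def)
  define l where "l = eval_triple F' v $ j / eval_triple F v $ j"
  have l: "eval_triple F' v = l *s eval_triple F v"
    using pr j by (simp add: vec_eq_iff l_def field_simps)
  then have "l \<noteq> 0" using \<open>eval_triple F' v \<noteq> 0\<close> by auto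
  have "eval_triple F' v' = (k ^ e * l) *s eval_triple F v" unfolding ev l by simp
  then have "hpoint (eval_triple F v) = hpoint (eval_triple F' v')"
    unfolding hpoint_eq_iff[OF F(3) F'(3)] using k \<open>l \<noteq> 0\<close> by (intro exI[of _ "k ^ e * l"]) simp
  then show ?thesis using F F' by simp
qed

text \<open>
  A point has at most one image. This disposes of finitely many exceptional points of the source, whether or not the map is
  defined there.
\<close>

lemma thin_image_point: "thin {v. v \<noteq> 0 \<and> maps_to g x (hpoint v)}"
proof (cases "{v. v \<noteq> 0 \<and> maps_to g x (hpoint v)} = {}")
  case False
  then obtain v0 where v0: "v0 \<noteq> 0" "maps_to g x (hpoint v0)" by auto
  have multiple: "\<exists>k. v = k *s v0" if "v \<noteq> 0" "maps_to g x (hpoint v)" for v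
    using maps_to_unique[OF v0(2) that(2)] hpoint_eq_iff[OF v0(1) that(1)] by auto
  show ?thesis
  proof (cases "v0 $ 1 = 0 \<and> v0 $ 2 = 0")
    case True
    have "thin {y. 1 * y $ 1 + 0 * y $ 2 + 0 * y $ 3 = 0}" by (intro thin_linear) simp
    then show ?thesis by (rule thin_subset) (use multiple True in fastforce)
  next
    case False
    then have "thin {y. v0 $ 2 * y $ 1 + (- v0 $ 1) * y $ 2 + 0 * y $ 3 = 0}" by (intro thin_linear) auto
    then show ?thesis by (rule thin_subset) (use multiple in fastforce)
  qed
qed (metis thin_empty)

lemma generic_points_meet:
  assumes "generically P" "generically Q"
  obtains y where "P y" "Q y"
proof -
  obtain H d where H: "H \<noteq> 0" "\<And>v. v \<noteq> 0 \<Longrightarrow> eval3 H v \<noteq> 0 \<Longrightarrow> P (hpoint v)"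
    using assms(1) unfolding generically_def by blast
  obtain H' d where H': "H' \<noteq> 0" "\<And>v. v \<noteq> 0 \<Longrightarrow> eval3 H' v \<noteq> 0 \<Longrightarrow> Q (hpoint v)"
    using assms(2) unfolding generically_def by blast
  have "H * H' * varT \<noteq> 0" using H H' by (simp add: varT_def)
  then obtain v where "eval3 (H * H' * varT) v \<noteq> 0" using eval3_eq_0_imp by blast
  then have "eval3 H v \<noteq> 0" "eval3 H' v \<noteq> 0" "v \<noteq> 0" by auto
  then show ?thesis using H H' that by blast
qed

lemma d_top_eqI:
  assumes "thin T" "\<And>v. v \<noteq> 0 \<Longrightarrow> v \<notin> T \<Longrightarrow> finite {x. maps_to g x (hpoint v)} \<and> card {x. maps_to g x (hpoint v)} = N"
  shows "d_top g = N"
  unfolding d_top_def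
proof (rule the_equality)
  show gen: "generically (\<lambda>y. finite {x. maps_to g x y} \<and> card {x. maps_to g x y} = N)"
    using assms unfolding thin_def generically_def by meson
  fix k assume "generically (\<lambda>y. finite {x. maps_to g x y} \<and> card {x. maps_to g x y} = k)"
  then show "k = N" using gen by (rule generic_points_meet) simp
qed

context generic_blaschke begin

lemma eval_num_den:
  "eval3 (blaschke_num \<theta> k a' l b') x = \<theta> * (zfac a' k (x $ 1) (x $ 3) * zfac b' l (x $ 2) (x $ 3))"
  "eval3 (blaschke_den k a' l b') x = pfac a' k (x $ 1) (x $ 3) * pfac b' l (x $ 2) (x $ 3)"
  by (simp_all add: blaschke_num_def blaschke_den_def zfac_def pfac_def)

lemma fibre_maps_to:
  assumes "(z, w) \<in> fibre u v"
  shows "maps_to f (hpoint (vector [z, w, 1])) (hpoint (vector [u, v, 1]))"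
proof (rule blaschke_map_affine[OF refl])
  have dom: "(z, w) \<in> dom" using assms by (simp add: fibre_iff)
  then show "\<forall>i<m. cnj (a i) * z \<noteq> 1" "\<forall>i<n. cnj (b i) * w \<noteq> 1" "\<forall>i<p. cnj (c i) * z \<noteq> 1" "\<forall>i<q. cnj (d i) * w \<noteq> 1"
    by (auto simp: dom_iff pfac_eq_0_iff)
  have "blaschke1 \<theta> k a' l b' z w = \<theta> * (zfac a' k z 1 * zfac b' l w 1) / (pfac a' k z 1 * pfac b' l w 1)" for \<theta> k a' l b'
    by (simp add: blaschke1_def zfac_def pfac_def prod_dividef)
  moreover have "g (z, w) = (u, v)" using assms by (simp add: fibre_def)
  ultimately show "blaschke_fun m n p q (a, b, c, d, \<theta>\<^sub>1, \<theta>\<^sub>2) (z, w) = (u, v)" by (simp add: g_eq)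
qed

text \<open>
  The value of the map may be computed by any representative \<open>G\<close>. Cancelling the denominators of the Blaschke triple as polynomials, before
  evaluating, yields curve equations that are also valid where these denominators vanish.
\<close>

lemma maps_to_equation:
  assumes "represents G f" "eval_triple G x = k *s v" "k \<noteq> 0"
  shows "value_eqs v (x $ 1) (x $ 3) (x $ 2) (x $ 3)"
proof -
  let ?N1 = "blaschke_num \<theta>\<^sub>1 m a n b" and ?N2 = "blaschke_num \<theta>\<^sub>2 p c q d"
  let ?D1 = "blaschke_den m a n b" and ?D2 = "blaschke_den p c q d"
  have D: "?D1 \<noteq> 0" "?D2 \<noteq> 0" using bidisc_less[OF origin_bidisc] by auto
  have F: "F $ 1 = ?N1 * ?D2" "F $ 2 = ?N2 * ?D1" "F $ 3 = ?D1 * ?D2"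
    by (simp_all add: blaschke_triple.simps)
  have "?D2 * (G $ 1 * ?D1) = ?D2 * (G $ 3 * ?N1)" "?D1 * (G $ 2 * ?D2) = ?D1 * (G $ 3 * ?N2)"
    using represents_proportional[OF assms(1) represents_F, of 1 3] represents_proportional[OF assms(1) represents_F, of 2 3]
    unfolding F by (simp_all only: mult_ac)
  then have e: "G $ 1 * ?D1 = G $ 3 * ?N1" "G $ 2 * ?D2 = G $ 3 * ?N2" using D mult_left_cancel by blast+
  have ev: "eval3 (G $ i) x = k * v $ i" for i
    using arg_cong[OF assms(2), of "\<lambda>y. y $ i"] by (simp add: eval_triple_def)
  have "k * (v $ 1 * eval3 ?D1 x) = k * (v $ 3 * eval3 ?N1 x)" "k * (v $ 2 * eval3 ?D2 x) = k * (v $ 3 * eval3 ?N2 x)"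
    using arg_cong[OF e(1), of "\<lambda>P. eval3 P x"] arg_cong[OF e(2), of "\<lambda>P. eval3 P x"] by (simp_all add: ev mult.assoc)
  then show ?thesis using assms(3) unfolding value_eqs_def eval_num_den mult_cancel_left by (simp add: mult_ac)
qed

text \<open>
  A point \<open>x\<close> of the plane other than \<open>[1 : 0 : 0]\<close> and \<open>[0 : 1 : 0]\<close> determines the point \<open>([x\<^sub>1 : x\<^sub>3], [x\<^sub>2 : x\<^sub>3])\<close> of the product of two
  projective lines. If \<open>x\<close> is mapped to a good value, this point lies on both curves and is therefore finite.
\<close>

lemma preimages_generic:
  assumes v: "v $ 3 \<noteq> 0" and good: "good (v $ 1 / v $ 3) (v $ 2 / v $ 3)"
    and no: "\<not> maps_to f (hpoint (axis 1 1)) (hpoint v)" "\<not> maps_to f (hpoint (axis 2 1)) (hpoint v)"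
  shows "{x. maps_to f x (hpoint v)} = (\<lambda>(z, w). hpoint (vector [z, w, 1])) ` fibre (v $ 1 / v $ 3) (v $ 2 / v $ 3)"
proof (intro equalityI subsetI)
  let ?u = "v $ 1 / v $ 3" and ?u' = "v $ 2 / v $ 3"
  have nz1: "vector [z, w, 1] \<noteq> (0 :: complex ^ 3)" for z w by (simp add: vec_eq_iff forall_3)
  have "v \<noteq> 0" using v by auto
  {
    fix x assume "x \<in> (\<lambda>(z, w). hpoint (vector [z, w, 1])) ` fibre ?u ?u'"
    then obtain z w where x: "x = hpoint (vector [z, w, 1])" "(z, w) \<in> fibre ?u ?u'" by auto
    have "v = v $ 3 *s vector [?u, ?u', 1]" using v by (simp add: vec_eq_iff forall_3)
    then have "hpoint (vector [?u, ?u', 1]) = hpoint v" using hpoint_eq_iff[OF nz1 \<open>v \<noteq> 0\<close>] v by blast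
    then show "x \<in> {x. maps_to f x (hpoint v)}" using fibre_maps_to[OF x(2)] x(1) by simp
  }
  fix y assume "y \<in> {x. maps_to f x (hpoint v)}"
  then obtain G x where G: "represents G f" "x \<noteq> 0" "eval_triple G x \<noteq> 0" "y = hpoint x" "hpoint v = hpoint (eval_triple G x)"
    and y: "maps_to f y (hpoint v)"
    by (auto simp: maps_to_def)
  obtain k where k: "k \<noteq> 0" "eval_triple G x = k *s v" using hpoint_eq_iff[OF \<open>v \<noteq> 0\<close> G(3)] G(5) by auto
  have h: "value_eqs v (x $ 1) (x $ 3) (x $ 2) (x $ 3)" by (rule maps_to_equation[OF G(1) k(2,1)])
  have "(x $ 1, x $ 3) \<noteq> (0, 0)"
  proof
    assume "(x $ 1, x $ 3) = (0, 0)"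
    then have "x = x $ 2 *s axis 2 1" "x $ 2 \<noteq> 0" using G(2) by (auto simp: vec_eq_iff forall_3 axis_def)
    then have "hpoint (axis 2 1) = y"
      unfolding G(4) using hpoint_eq_iff[OF _ G(2), of "axis 2 1"] by (auto simp: axis_eq_0_iff)
    then show False using no y by simp
  qed
  moreover have "(x $ 2, x $ 3) \<noteq> (0, 0)"
  proof
    assume "(x $ 2, x $ 3) = (0, 0)"
    then have "x = x $ 1 *s axis 1 1" "x $ 1 \<noteq> 0" using G(2) by (auto simp: vec_eq_iff forall_3 axis_def)
    then have "hpoint (axis 1 1) = y"
      unfolding G(4) using hpoint_eq_iff[OF _ G(2), of "axis 1 1"] by (auto simp: axis_eq_0_iff)
    then show False using no y by simp
  qed
  moreover have e: "eq1 ?u (x $ 1) (x $ 3) (x $ 2) (x $ 3)" "eq2 ?u' (x $ 1) (x $ 3) (x $ 2) (x $ 3)"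
    using h v by (simp_all add: value_eqs_def eq1_def eq2_def field_simps)
  ultimately have reg: "regular (x $ 1) (x $ 3) (x $ 2) (x $ 3)" using good by (simp add: good_def)
  then have x3: "x $ 3 \<noteq> 0" by (simp add: regular_def)
  have "(x $ 1 / x $ 3, x $ 2 / x $ 3) \<in> fibre ?u ?u'"
    unfolding fibre_iff using regular_affine(1)[OF reg] e eq_affine[OF x3 x3] by simp
  moreover have "x = x $ 3 *s vector [x $ 1 / x $ 3, x $ 2 / x $ 3, 1]" using x3 by (simp add: vec_eq_iff forall_3)
  then have "hpoint (vector [x $ 1 / x $ 3, x $ 2 / x $ 3, 1]) = y"
    unfolding G(4) using hpoint_eq_iff[OF nz1 G(2)] x3 by blast
  ultimately show "y \<in> (\<lambda>(z, w). hpoint (vector [z, w, 1])) ` fibre ?u ?u'"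
    by (intro image_eqI[of _ _ "(x $ 1 / x $ 3, x $ 2 / x $ 3)"]) simp_all
qed

lemma inj_chart: "inj (\<lambda>(z, w). hpoint (vector [z, w, 1]))"
proof (rule injI, clarify)
  fix z w z' w' :: complex assume "hpoint (vector [z, w, 1]) = hpoint (vector [z', w', 1])"
  then obtain k where "vector [z', w', 1] = k *s (vector [z, w, 1] :: complex ^ 3)"
    by (subst (asm) hpoint_eq_iff) (auto simp: vec_eq_iff forall_3)
  then show "z = z' \<and> w = w'" by (simp add: vec_eq_iff forall_3)
qed

lemma d_top_eq: "d_top f = m * q + n * p"
proof -
  obtain H e where H: "H \<noteq> 0" "homogeneous e H"
    "\<And>y. y $ 3 \<noteq> 0 \<Longrightarrow> eval3 H y \<noteq> 0 \<Longrightarrow> good (y $ 1 / y $ 3) (y $ 2 / y $ 3) \<and> card (fibre (y $ 1 / y $ 3) (y $ 2 / y $ 3)) = m * q + n * p"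
    using generic_fibre_card by blast
  define T where "T = {y. eval3 H y = 0} \<union> {y. 0 * y $ 1 + 0 * y $ 2 + 1 * y $ 3 = 0} \<union>
     {v. v \<noteq> 0 \<and> maps_to f (hpoint (axis 1 1)) (hpoint v)} \<union> {v. v \<noteq> 0 \<and> maps_to f (hpoint (axis 2 1)) (hpoint v)}"
  have "thin {y. eval3 H y = 0}" using H unfolding thin_def by auto
  moreover have "thin {y. 0 * y $ 1 + 0 * y $ 2 + 1 * y $ 3 = 0}" by (rule thin_linear) simp
  ultimately have "thin T" unfolding T_def by (intro thin_Un thin_image_point)
  then show ?thesis
  proof (rule d_top_eqI)
    fix v assume "v \<noteq> 0" "v \<notin> T"
    then have v: "v $ 3 \<noteq> 0" "eval3 H v \<noteq> 0" "\<not> maps_to f (hpoint (axis 1 1)) (hpoint v)" "\<not> maps_to f (hpoint (axis 2 1)) (hpoint v)"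
      by (auto simp: T_def)
    let ?F = "fibre (v $ 1 / v $ 3) (v $ 2 / v $ 3)"
    have g: "good (v $ 1 / v $ 3) (v $ 2 / v $ 3)" "card ?F = m * q + n * p" using H(3)[OF v(1,2)] by auto
    show "finite {x. maps_to f x (hpoint v)} \<and> card {x. maps_to f x (hpoint v)} = m * q + n * p"
      unfolding preimages_generic[OF v(1) g(1) v(3,4)]
      using fibre_finite_good[OF g(1)] g(2) inj_chart by (simp add: card_image inj_on_subset[OF inj_chart])
  qed
qed

end

section \<open>Separated zeros are generic\<close>

definition separated :: "nat \<Rightarrow> nat \<Rightarrow> (nat \<Rightarrow> complex) \<Rightarrow> (nat \<Rightarrow> complex) \<Rightarrow> bool" where
  "separated m p a c \<longleftrightarrow> (\<forall>i<m. \<forall>j<m. i \<noteq> j \<longrightarrow> a i \<noteq> a j) \<and> (\<forall>i<p. \<forall>j<p. i \<noteq> j \<longrightarrow> c i \<noteq> c j) \<and> (\<forall>i<m. \<forall>j<p. a i \<noteq> c j)"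

lemma separatedD:
  assumes "separated m p a c"
  shows "inj_on a {..<m}" "inj_on c {..<p}" "a ` {..<m} \<inter> c ` {..<p} = {}"
proof -
  show "inj_on a {..<m}" by (rule inj_onI) (use assms in \<open>unfold separated_def lessThan_iff, blast\<close>)
  show "inj_on c {..<p}" by (rule inj_onI) (use assms in \<open>unfold separated_def lessThan_iff, blast\<close>)
  show "a ` {..<m} \<inter> c ` {..<p} = {}" using assms by (auto simp: separated_def)
qed

definition separated_params :: "nat \<Rightarrow> nat \<Rightarrow> nat \<Rightarrow> nat \<Rightarrow> blaschke_params set" where
  "separated_params m n p q = {(a, b, c, d, \<theta>\<^sub>1, \<theta>\<^sub>2) \<in> blaschke_space m n p q. separated m p a c \<and> separated n q b d}"

lemma open_separated:
  fixes A C :: "'s::topological_space \<Rightarrow> nat \<Rightarrow> complex"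
  assumes "continuous_on UNIV A" "continuous_on UNIV C"
  shows "open {s. separated m p (A s) (C s)}"
proof -
  have 1: "open {s. A s i \<noteq> A s j}" "open {s. C s i \<noteq> C s j}" "open {s. A s i \<noteq> C s j}" for i j
    by (intro open_Collect_neq continuous_on_product_then_coordinatewise[OF assms(1)]
        continuous_on_product_then_coordinatewise[OF assms(2)])+
  have "{s. separated m p (A s) (C s)} = (\<Inter>i<m. \<Inter>j\<in>{..<m} - {i}. {s. A s i \<noteq> A s j}) \<inter>
     (\<Inter>i<p. \<Inter>j\<in>{..<p} - {i}. {s. C s i \<noteq> C s j}) \<inter> (\<Inter>i<m. \<Inter>j<p. {s. A s i \<noteq> C s j})"
    unfolding separated_def by auto
  also have "open \<dots>" by (intro open_Int open_INT finite_lessThan finite_Diff ballI 1)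
  finally show ?thesis .
qed

lemma separated_params_openin: "openin (top_of_set (blaschke_space m n p q)) (separated_params m n p q)"
proof -
  let ?U = "{s :: blaschke_params. separated m p (fst s) (fst (snd (snd s)))} \<inter> {s. separated n q (fst (snd s)) (fst (snd (snd (snd s))))}"
  have "open ?U" by (intro open_Int open_separated continuous_intros)
  moreover have "separated_params m n p q = blaschke_space m n p q \<inter> ?U" by (auto simp: separated_params_def)
  ultimately show ?thesis by (simp only: openin_open_Int)
qed

text \<open>
  Distinct indices are shifted at distinct speeds, so two zeros that move coincide for at most one \<open>\<epsilon>\<close>. The
  offset \<open>k\<close> keeps the speeds of two families of zeros apart.
\<close>

definition shift :: "nat \<Rightarrow> nat \<Rightarrow> (nat \<Rightarrow> complex) \<Rightarrow> complex \<Rightarrow> nat \<Rightarrow> complex" where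
  "shift k m a \<epsilon> = (\<lambda>i. if i < m then a i + \<epsilon> * of_nat (k + i) else a i)"

lemma shift_0: "shift k m a 0 = a" by (simp add: shift_def fun_eq_iff)

lemma continuous_on_shift: "continuous_on UNIV (shift k m a)"
proof (rule continuous_on_coordinatewise_then_product)
  show "continuous_on UNIV (\<lambda>\<epsilon>. shift k m a \<epsilon> i)" for i
    by (cases "i < m") (auto simp: shift_def intro!: continuous_intros)
qed

lemma eventually_shift_neq:
  fixes x y u v :: complex
  assumes "u \<noteq> v"
  shows "eventually (\<lambda>\<epsilon>. x + \<epsilon> * u \<noteq> y + \<epsilon> * v) (at 0)"
proof (cases "x = y")
  case True
  then show ?thesis using assms by (auto simp: eventually_at intro!: exI[of _ 1])
next
  case False
  have "((\<lambda>\<epsilon>. (x + \<epsilon> * u) - (y + \<epsilon> * v)) \<longlongrightarrow> (x + 0 * u) - (y + 0 * v)) (at 0)" by (intro tendsto_intros)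
  then have "eventually (\<lambda>\<epsilon>. (x + \<epsilon> * u) - (y + \<epsilon> * v) \<noteq> 0) (at 0)"
    using False by (intro tendsto_imp_eventually_ne) auto
  then show ?thesis by simp
qed

lemma eventually_separated: "eventually (\<lambda>\<epsilon>. separated m p (shift 0 m a \<epsilon>) (shift m p c \<epsilon>)) (at 0)"
proof -
  have "eventually (\<lambda>\<epsilon>. \<forall>i\<in>{..<m}. \<forall>j\<in>{..<m} - {i}. a i + \<epsilon> * of_nat (0 + i) \<noteq> a j + \<epsilon> * of_nat (0 + j)) (at 0)"
    by (intro eventually_ball_finite ballI eventually_shift_neq finite_lessThan finite_Diff) (unfold of_nat_eq_iff, auto)
  moreover have "eventually (\<lambda>\<epsilon>. \<forall>i\<in>{..<p}. \<forall>j\<in>{..<p} - {i}. c i + \<epsilon> * of_nat (m + i) \<noteq> c j + \<epsilon> * of_nat (m + j)) (at 0)"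
    by (intro eventually_ball_finite ballI eventually_shift_neq finite_lessThan finite_Diff) (unfold of_nat_eq_iff, auto)
  moreover have "eventually (\<lambda>\<epsilon>. \<forall>i\<in>{..<m}. \<forall>j\<in>{..<p}. a i + \<epsilon> * of_nat (0 + i) \<noteq> c j + \<epsilon> * of_nat (m + j)) (at 0)"
    by (intro eventually_ball_finite ballI eventually_shift_neq finite_lessThan finite_Diff) (unfold of_nat_eq_iff, auto)
  ultimately show ?thesis
    by eventually_elim (auto simp: separated_def shift_def)
qed

lemma eventually_shift_disc:
  assumes "a \<in> {..<m} \<rightarrow>\<^sub>E ball 0 1"
  shows "eventually (\<lambda>\<epsilon>. shift k m a \<epsilon> \<in> {..<m} \<rightarrow>\<^sub>E ball 0 1) (at 0)"
proof -
  have "eventually (\<lambda>\<epsilon>. \<forall>i\<in>{..<m}. a i + \<epsilon> * of_nat (k + i) \<in> ball 0 1) (at 0)"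
  proof (intro eventually_ball_finite ballI)
    fix i assume "i \<in> {..<m}"
    then have "a i + 0 * of_nat (k + i) \<in> ball 0 1" using assms by (auto simp: PiE_iff)
    moreover have "((\<lambda>\<epsilon>. a i + \<epsilon> * of_nat (k + i)) \<longlongrightarrow> a i + 0 * of_nat (k + i)) (at 0)" by (intro tendsto_intros)
    ultimately show "eventually (\<lambda>\<epsilon>. a i + \<epsilon> * of_nat (k + i) \<in> ball 0 1) (at 0)"
      by (intro topological_tendstoD) auto
  qed simp
  then show ?thesis by eventually_elim (use assms in \<open>auto simp: shift_def PiE_iff extensional_def\<close>)
qed

lemma separated_params_dense: "blaschke_space m n p q \<subseteq> closure (separated_params m n p q)"
proof
  fix s assume "s \<in> blaschke_space m n p q"
  then obtain a b c d t1 t2 where s: "s = (a, b, c, d, t1, t2)" and a: "a \<in> {..<m} \<rightarrow>\<^sub>E ball 0 1" and b: "b \<in> {..<n} \<rightarrow>\<^sub>E ball 0 1"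
    and c: "c \<in> {..<p} \<rightarrow>\<^sub>E ball 0 1" and d: "d \<in> {..<q} \<rightarrow>\<^sub>E ball 0 1" and t: "t1 \<in> sphere 0 1" "t2 \<in> sphere 0 1"
    by (auto simp: blaschke_space_def)
  define h where "h \<epsilon> = (shift 0 m a \<epsilon>, shift 0 n b \<epsilon>, shift m p c \<epsilon>, shift n q d \<epsilon>, t1, t2)" for \<epsilon>
  have "continuous_on UNIV h" unfolding h_def by (intro continuous_intros continuous_on_shift)
  then have "(h \<longlongrightarrow> h 0) (at 0)" by (simp add: continuous_on_def)
  then have lim: "(h \<longlongrightarrow> s) (at 0)" by (simp add: h_def shift_0 s)
  have "eventually (\<lambda>\<epsilon>. h \<epsilon> \<in> separated_params m n p q) (at 0)"
    using eventually_separated[of m p a c] eventually_separated[of n q b d] eventually_shift_disc[OF a, of 0]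
      eventually_shift_disc[OF b, of 0] eventually_shift_disc[OF c, of m] eventually_shift_disc[OF d, of n]
    by eventually_elim (use t in \<open>simp add: h_def separated_params_def blaschke_space_def\<close>)
  then have "eventually (\<lambda>\<epsilon>. h \<epsilon> \<in> closure (separated_params m n p q)) (at 0)"
    by (rule eventually_mono) (use closure_subset in blast)
  then show "s \<in> closure (separated_params m n p q)"
    by (rule Lim_in_closed_set[OF closed_closure _ _ lim]) simp
qed

subsection \<open>Full measure\<close>

lemma AE_pair_fst:
  assumes "sigma_finite_measure N" "AE x in M. P x"
  shows "AE z in M \<Otimes>\<^sub>M N. P (fst z)"
proof -
  obtain A where A: "{x \<in> space M. \<not> P x} \<subseteq> A" "A \<in> sets M" "emeasure M A = 0" using assms(2) by (auto elim: AE_E)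
  have "emeasure (M \<Otimes>\<^sub>M N) (A \<times> space N) = 0"
    using A by (simp add: sigma_finite_measure.emeasure_pair_measure_Times[OF assms(1)])
  then show ?thesis using A by (intro AE_I[of _ _ "A \<times> space N"]) (auto simp: space_pair_measure)
qed

lemma AE_pair_snd:
  assumes "sigma_finite_measure N" "AE x in N. P x"
  shows "AE z in M \<Otimes>\<^sub>M N. P (snd z)"
proof -
  obtain A where A: "{x \<in> space N. \<not> P x} \<subseteq> A" "A \<in> sets N" "emeasure N A = 0" using assms(2) by (auto elim: AE_E)
  have "emeasure (M \<Otimes>\<^sub>M N) (space M \<times> A) = 0"
    using A by (simp add: sigma_finite_measure.emeasure_pair_measure_Times[OF assms(1)])
  then show ?thesis using A by (intro AE_I[of _ _ "space M \<times> A"]) (auto simp: space_pair_measure)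
qed

lemma AE_pair_neq:
  fixes f :: "'a \<Rightarrow> complex" and h :: "'b \<Rightarrow> complex"
  assumes "sigma_finite_measure M" "sigma_finite_measure N" "f \<in> borel_measurable M" "h \<in> borel_measurable N"
    and "\<And>k. AE y in N. h y \<noteq> k"
  shows "AE z in M \<Otimes>\<^sub>M N. f (fst z) \<noteq> h (snd z)"
proof -
  interpret pair_sigma_finite M N using assms by (simp add: pair_sigma_finite_def)
  have [measurable]: "f \<in> borel_measurable M" "h \<in> borel_measurable N" by fact+
  have "AE x in M. AE y in N. f (fst (x, y)) \<noteq> h (snd (x, y))" using assms(5) by (auto simp: eq_commute)
  moreover have "{z \<in> space (M \<Otimes>\<^sub>M N). f (fst z) \<noteq> h (snd z)} \<in> sets (M \<Otimes>\<^sub>M N)" by measurable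
  ultimately show ?thesis by (intro AE_pair_measure)
qed

lemma finite_measure_disc: "finite_measure disc_measure"
proof (rule finite_measureI)
  have "emeasure disc_measure (space disc_measure) = emeasure lborel (ball (0::complex) 1)"
    by (simp add: disc_measure_def space_restrict_space emeasure_restrict_space)
  then show "emeasure disc_measure (space disc_measure) \<noteq> \<infinity>" using emeasure_lborel_ball_finite[of "0::complex" 1] by simp
qed

lemma finite_measure_circle: "finite_measure circle_measure"
proof -
  have "finite_measure (restrict_space lborel {0..<2 * pi})"
    by (rule finite_measureI) (simp add: space_restrict_space emeasure_restrict_space)
  moreover have "cis \<in> measurable (restrict_space lborel {0..<2 * pi}) (restrict_space borel (sphere 0 1))"
    by (intro measurable_restrict_space2 measurable_restrict_space1)
      (auto intro!: borel_measurable_continuous_onI continuous_intros)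
  ultimately show ?thesis unfolding circle_measure_def by (rule finite_measure.finite_measure_distr)
qed

interpretation disc: finite_measure disc_measure by (rule finite_measure_disc)
interpretation circle: finite_measure circle_measure by (rule finite_measure_circle)
interpretation discs: product_sigma_finite "\<lambda>_::nat. disc_measure"
  unfolding product_sigma_finite_def by (simp add: disc.sigma_finite_measure_axioms)

abbreviation discs :: "nat \<Rightarrow> (nat \<Rightarrow> complex) measure" where
  "discs m \<equiv> \<Pi>\<^sub>M i\<in>{..<m}. disc_measure"

lemma sigma_finite_discs: "sigma_finite_measure (discs m)"
  by (rule discs.sigma_finite) simp

lemma AE_disc_neq: "AE z in disc_measure. z \<noteq> k"
  unfolding disc_measure_def
  by (subst AE_restrict_space_iff) (use AE_lborel_singleton[of k] in \<open>auto elim: eventually_mono\<close>)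

lemma measurable_disc_component [measurable]:
  assumes "i < m"
  shows "(\<lambda>a. a i) \<in> borel_measurable (discs m)"
proof -
  have "(\<lambda>a. a i) \<in> measurable (discs m) disc_measure" using assms by (intro measurable_component_singleton) simp
  moreover have "(\<lambda>z. z) \<in> borel_measurable disc_measure"
    unfolding disc_measure_def by (intro measurable_restrict_space1) simp
  ultimately show ?thesis by (rule measurable_compose)
qed

lemma AE_discs_neq_const:
  assumes "j < m"
  shows "AE a in discs m. a j \<noteq> k"
proof -
  let ?A = "\<lambda>i. if i = j then {z \<in> space disc_measure. z = k} else space disc_measure"
  have sets: "{z \<in> space disc_measure. z = k} \<in> sets disc_measure"
    unfolding disc_measure_def by (auto simp: sets_restrict_space space_restrict_space intro!: image_eqI[of _ _ "{k} \<inter> ball 0 1"])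
  have "emeasure disc_measure {z \<in> space disc_measure. z = k} = 0"
    using AE_disc_neq[of k] sets by (subst (asm) AE_iff_measurable[OF _ refl]) auto
  then have "(\<Prod>i<m. emeasure disc_measure (?A i)) = 0" using assms by (intro prod_zero) auto
  then have "emeasure (discs m) (Pi\<^sub>E {..<m} ?A) = 0" using sets by (subst discs.emeasure_PiM) auto
  moreover have "Pi\<^sub>E {..<m} ?A \<in> sets (discs m)" using sets by (intro sets_PiM_I_finite) auto
  ultimately show ?thesis
    by (intro AE_I[of _ _ "Pi\<^sub>E {..<m} ?A"]) (auto simp: space_PiM PiE_iff extensional_def)
qed

text \<open>
  Fubini: for fixed values of the other coordinates, the \<open>i\<close>-th coordinate avoids the \<open>j\<close>-th one almost surely.
\<close>

lemma AE_discs_neq: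
  assumes "i < m" "j < m" "i \<noteq> j"
  shows "AE a in discs m. a i \<noteq> a j"
proof -
  define I where "I = {..<m} - {i}"
  have I: "{..<m} = insert i I" "finite I" "i \<notin> I" using assms by (auto simp: I_def)
  define N where "N = {a \<in> space (discs m). a i = a j}"
  have [measurable]: "(\<lambda>a. a i) \<in> borel_measurable (discs m)" "(\<lambda>a. a j) \<in> borel_measurable (discs m)"
    using assms measurable_disc_component by auto
  have N: "N \<in> sets (discs m)" unfolding N_def by measurable
  have "emeasure (discs m) N = (\<integral>\<^sup>+ a. indicator N a \<partial>(discs m))" using N by simp
  also have "\<dots> = (\<integral>\<^sup>+ a. (\<integral>\<^sup>+ z. indicator N (a(i := z)) \<partial>disc_measure) \<partial>(\<Pi>\<^sub>M i\<in>I. disc_measure))"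
    unfolding I(1) using N by (intro discs.product_nn_integral_insert I(2,3)) (simp add: I(1))
  also have "\<dots> = (\<integral>\<^sup>+ a. 0 \<partial>(\<Pi>\<^sub>M i\<in>I. disc_measure))"
  proof (intro nn_integral_cong)
    fix a
    have "(\<integral>\<^sup>+ z. indicator N (a(i := z)) \<partial>disc_measure) = (\<integral>\<^sup>+ z. 0 \<partial>disc_measure)"
      using AE_disc_neq[of "a j"] assms(3) by (intro nn_integral_cong_AE) (auto simp: N_def elim!: eventually_mono)
    then show "(\<integral>\<^sup>+ z. indicator N (a(i := z)) \<partial>disc_measure) = 0" by simp
  qed
  finally have "emeasure (discs m) N = 0" by simp
  then show ?thesis using N by (intro AE_I[of _ _ N]) (auto simp: N_def)
qed

lemma separated_params_AE: "AE s in blaschke_measure m n p q. s \<in> separated_params m n p q"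
proof -
  note sf = sigma_finite_discs disc.sigma_finite_measure_axioms circle.sigma_finite_measure_axioms
  have sp: "sigma_finite_measure (M \<Otimes>\<^sub>M N)" if "sigma_finite_measure M" "sigma_finite_measure N" for M :: "'x measure" and N :: "'y measure"
  proof -
    interpret pair_sigma_finite M N using that by (simp add: pair_sigma_finite_def)
    show ?thesis by unfold_locales
  qed
  let ?C = "circle_measure \<Otimes>\<^sub>M circle_measure"
  have R: "sigma_finite_measure ?C" "sigma_finite_measure (discs q \<Otimes>\<^sub>M ?C)" "sigma_finite_measure (discs p \<Otimes>\<^sub>M discs q \<Otimes>\<^sub>M ?C)"
    "sigma_finite_measure (discs n \<Otimes>\<^sub>M discs p \<Otimes>\<^sub>M discs q \<Otimes>\<^sub>M ?C)"
    by (intro sp sf)+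
  have a: "AE s in blaschke_measure m n p q. P (fst s)" if "AE a in discs m. P a" for P
    unfolding blaschke_measure_def by (intro AE_pair_fst R that)
  have b: "AE s in blaschke_measure m n p q. P (fst (snd s))" if "AE a in discs n. P a" for P
    unfolding blaschke_measure_def by (intro AE_pair_snd[where P = "\<lambda>s. P (fst s)"] AE_pair_fst R that)
  have c: "AE s in blaschke_measure m n p q. P (fst (snd (snd s)))" if "AE a in discs p. P a" for P
    unfolding blaschke_measure_def
    by (intro AE_pair_snd[where P = "\<lambda>s. P (fst (snd s))"] AE_pair_snd[where P = "\<lambda>s. P (fst s)"] AE_pair_fst R that)
  have d: "AE s in blaschke_measure m n p q. P (fst (snd (snd (snd s))))" if "AE a in discs q. P a" for P
    unfolding blaschke_measure_def
    by (intro AE_pair_snd[where P = "\<lambda>s. P (fst (snd (snd s)))"] AE_pair_snd[where P = "\<lambda>s. P (fst (snd s))"]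
        AE_pair_snd[where P = "\<lambda>s. P (fst s)"] AE_pair_fst R that)
  have ac: "AE s in blaschke_measure m n p q. fst s i \<noteq> fst (snd (snd s)) j" if ij: "i < m" "j < p" for i j
    unfolding blaschke_measure_def
  proof (rule AE_pair_neq[where f = "\<lambda>a. a i" and h = "\<lambda>s. fst (snd s) j"])
    show "AE y in discs n \<Otimes>\<^sub>M discs p \<Otimes>\<^sub>M discs q \<Otimes>\<^sub>M ?C. fst (snd y) j \<noteq> k" for k
      by (intro AE_pair_snd[where P = "\<lambda>s. fst s j \<noteq> k"] AE_pair_fst R AE_discs_neq_const[OF ij(2)])
    show "(\<lambda>s. fst (snd s) j) \<in> borel_measurable (discs n \<Otimes>\<^sub>M discs p \<Otimes>\<^sub>M discs q \<Otimes>\<^sub>M ?C)"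
      using measurable_disc_component[OF ij(2)] by measurable
  qed (use measurable_disc_component[OF ij(1)] R sf in auto)
  have bd: "AE s in blaschke_measure m n p q. fst (snd s) i \<noteq> fst (snd (snd (snd s))) j" if ij: "i < n" "j < q" for i j
    unfolding blaschke_measure_def
  proof (rule AE_pair_snd[where P = "\<lambda>s. fst s i \<noteq> fst (snd (snd s)) j", OF R(4)],
      rule AE_pair_neq[where f = "\<lambda>a. a i" and h = "\<lambda>s. fst (snd s) j"])
    show "AE y in discs p \<Otimes>\<^sub>M discs q \<Otimes>\<^sub>M ?C. fst (snd y) j \<noteq> k" for k
      by (intro AE_pair_snd[where P = "\<lambda>s. fst s j \<noteq> k"] AE_pair_fst R AE_discs_neq_const[OF ij(2)])
    show "(\<lambda>s. fst (snd s) j) \<in> borel_measurable (discs p \<Otimes>\<^sub>M discs q \<Otimes>\<^sub>M ?C)"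
      using measurable_disc_component[OF ij(2)] by measurable
  qed (use measurable_disc_component[OF ij(1)] R sf in auto)
  have self: "AE x in discs k. \<forall>i\<in>{..<k}. \<forall>j\<in>{..<k} - {i}. x i \<noteq> x j" for k
    by (intro AE_finite_allI finite_lessThan finite_Diff) (auto intro: AE_discs_neq)
  have "AE s in blaschke_measure m n p q. \<forall>i\<in>{..<m}. \<forall>j\<in>{..<p}. fst s i \<noteq> fst (snd (snd s)) j"
    by (intro AE_finite_allI finite_lessThan ac) auto
  moreover have "AE s in blaschke_measure m n p q. \<forall>i\<in>{..<n}. \<forall>j\<in>{..<q}. fst (snd s) i \<noteq> fst (snd (snd (snd s))) j"
    by (intro AE_finite_allI finite_lessThan bd) auto
  ultimately show ?thesis
    using AE_space a[OF self] b[OF self] c[OF self] d[OF self]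
  proof eventually_elim
    case (elim s)
    then show ?case unfolding space_blaschke_measure by (cases s) (auto simp: separated_params_def separated_def)
  qed
qed

section \<open>Topological degree exceeds dynamical degree\<close>

theorem theorem1p3:
  fixes m n p q :: nat
  assumes "m \<ge> 1" "n \<ge> 1" "p \<ge> 1" "q \<ge> 1"
    and "int m * int q - int n * int p > 0"
  shows "\<exists>B. B \<subseteq> blaschke_space m n p q
    \<and> openin (top_of_set (blaschke_space m n p q)) B
    \<and> blaschke_space m n p q \<subseteq> closure B
    \<and> (AE s in blaschke_measure m n p q. s \<in> B)
    \<and> (\<forall>s\<in>B. d_top (blaschke_map m n p q s) = m * q + n * p
             \<and> real (m * q + n * p) > lambda1 (blaschke_map m n p q s))"
proof (intro exI conjI ballI)
  let ?B = "separated_params m n p q"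
  show "?B \<subseteq> blaschke_space m n p q" by (auto simp: separated_params_def)
  show "openin (top_of_set (blaschke_space m n p q)) ?B" by (rule separated_params_openin)
  show "blaschke_space m n p q \<subseteq> closure ?B" by (rule separated_params_dense)
  show "AE s in blaschke_measure m n p q. s \<in> ?B" by (rule separated_params_AE)
  fix s assume "s \<in> ?B"
  then obtain a b c d \<theta>1 \<theta>2 where s: "s = (a, b, c, d, \<theta>1, \<theta>2)" and sp: "s \<in> blaschke_space m n p q"
    and sep: "separated m p a c" "separated n q b d"
    by (auto simp: separated_params_def)
  interpret generic_blaschke m n p q a b c d \<theta>1 \<theta>2
  proof
    show "inj_on a {..<m}" "inj_on c {..<p}" "a ` {..<m} \<inter> c ` {..<p} = {}" by (rule separatedD[OF sep(1)])+
    show "inj_on b {..<n}" "inj_on d {..<q}" "b ` {..<n} \<inter> d ` {..<q} = {}" by (rule separatedD[OF sep(2)])+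
  qed (use assms sp in \<open>auto simp: s blaschke_space_def PiE_iff\<close>)
  have "int (n * p) < int (m * q)" using assms(5) by simp
  then have "n * p < m * q" by (simp only: of_nat_less_iff)
  then show "real (m * q + n * p) > lambda1 (blaschke_map m n p q s)" unfolding s by (rule lambda1_less)
  show "d_top (blaschke_map m n p q s) = m * q + n * p" unfolding s by (rule d_top_eq)
qed

end
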